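(* Let $f:\mathcal U\times\mathcal V\to\mathcal Z$ be a function between finite sets, let $\varepsilon\ge 0$, and let $\pi$ be a two-party quantum protocol for the evaluation of $f$ that is $\varepsilon$-correct and $\varepsilon$-secure against dishonest Bob. Then there is a cheating strategy for Alice such that, for every $u_0\in\mathcal U$ and $v\in\mathcal V$, when Alice uses input $u_0$ while honest Bob has input $v$, it gives her a value $\tilde v\in\mathcal V$ distributed according to some distribution $Q(\tilde v|u_0,v)$ such that for all $u\in\mathcal U$: $$\Pr_{\tilde v\sim Q(\cdot|u_0,v)}\big[f(u,v)=f(u,\tilde v)\big]\ \ge\ 1-28\,\varepsilon .$$
   Context: All registers are finite-dimensional Hilbert spaces. CPTP means completely positive trace-preserving. **Protocols.** A two-party quantum protocol $\pi$ for $f$ is specified by the local quantum operations of honest Alice $\mathsf A$ and honest Bob $\mathsf B$, who are connected only by a quantum channel: over finitely many rounds they apply local CPTP maps to registers they hold and exchange message registers. Alice receives input register $U$ (basis $\{|u\rangle\}_{u\in\mathcal U}$), Bob receives input register $V$ (basis $\{|v\rangle\}_{v\in\mathcal V}$). At the end honest Alice outputs register $X$ and honest Bob outputs register $Y$ (both with basis indexed by $\mathcal Z$). A dishonest player may replace his or her local operations by arbitrary CPTP maps with an arbitrary final output register, while the other player stays honest. The execution is a CPTP map: $\pi_{\mathsf A,\mathsf B}:UV\to XY$ if both are honest, $\pi_{\mathsf A,\mathsf B'}:UV\to XY'$ for honest Alice and dishonest Bob $\mathsf B'$ with output register $Y'$. **Ideal functionality.** $\mathcal F:\tilde U\tilde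 V\to\tilde X\tilde Y$ is the CPTP map $$\mathcal F(|u\rangle\langle u'|_{\tilde U}\otimes|v\rangle\langle v'|_{\tilde V})=\delta_{u,u'}\delta_{v,v'}\,|f(u,v)\rangle\langle f(u,v)|_{\tilde X}\otimes|f(u,v)\rangle\langle f(u,v)|_{\tilde Y}.$$ Ideal honest players just forward inputs and outputs to and from $\mathcal F$; with both honest, the joint map $\mathcal F_{\hat{\mathsf A},\hat{\mathsf B}}$ is $\mathcal F$ with $\tilde U,\tilde V,\tilde X,\tilde Y$ identified with $U,V,X,Y$. An ideal adversary $\hat{\mathsf B}'$ is given by CPTP maps $\Lambda^1_{V\to\tilde VK}$ and $\Lambda^2_{K\tilde Y\to Y'}$ ($K$ an auxiliary register), and $$\mathcal F_{\hat{\mathsf A},\hat{\mathsf B}'}=[\mathrm{id}_{\tilde X\to X}\otimes\Lambda^2_{K\tilde Y\to Y'}]\circ[\mathcal F_{\tilde U\tilde V\to\tilde X\tilde Y}\otimes\mathrm{id}_K]\circ[\mathrm{id}_{U\to\tilde U}\otimes\Lambda^1_{V\to\tilde VK}].$$ **Closeness.** For states $\rho,\sigma$, write $\rho\approx_\varepsilon\sigma$ if $\sqrt{1-F(\rho,\sigma)^2}\le\varepsilon$, where $F(\rho,\sigma)=\mathrm{tr}\sqrt{\sqrt\rho\,\sigma\sqrt\rho}$. **Correctness and security.** For a probability distribution $p$ on $\mathcal U\times\mathcal V$, let $\rho_{UVR}$ be a purification, with reference register $R$, of $\sum_{u,v}p(u,v)|u\rangle\langle u|_U\otimes|v\rangle\langle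 v|_V$, for instance the pure state $\sum_{u,v}\sqrt{p(u,v)}\,|u\rangle_U|v\rangle_V|uv\rangle_R$. Let $\varepsilon\ge0$. The protocol $\pi$ is *$\varepsilon$-correct* if for every $p$, $$[\mathrm{id}_R\otimes\pi_{\mathsf A,\mathsf B}](\rho_{UVR})\approx_\varepsilon[\mathrm{id}_R\otimes\mathcal F_{\hat{\mathsf A},\hat{\mathsf B}}](\rho_{UVR}).$$ It is *$\varepsilon$-secure against dishonest Bob* if for every $p$ and every real adversary (dishonest Bob) $\mathsf B'$ there exists an ideal adversary $\hat{\mathsf B}'$ (which may depend on $p$) such that $$[\mathrm{id}_R\otimes\pi_{\mathsf A,\mathsf B'}](\rho_{UVR})\approx_\varepsilon[\mathrm{id}_R\otimes\mathcal F_{\hat{\mathsf A},\hat{\mathsf B}'}](\rho_{UVR}).$$ **Cheating strategy for Alice.** A choice of dishonest behaviour for Alice in the protocol $\pi$, run against honest Bob, possibly using private randomness, and ending with a measurement that gives Alice a classical outcome $\tilde v\in\mathcal V$. When Alice uses input $u_0$ and Bob has input $v$, the input registers are prepared in the state $|u_0\rangle_U|v\rangle_V$, and $Q(\tilde v|u_0,v)$ is the resulting probability of outcome $\tilde v$. The strategy does not depend on Bob's input $v$. *)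

theory Defs
  imports
    "HOL-Probability.Probability_Mass_Function"
    "HOL-Library.Countable_Set"
    "Jordan_Normal_Form.Schur_Decomposition"
begin

no_notation Finite_Cartesian_Product.vec_nth (infixl \<open>$\<close> 90)
hide_const (open) Finite_Cartesian_Product.vec Finite_Cartesian_Product.mat
hide_type (open) Finite_Cartesian_Product.vec

section \<open>Linear algebra on finite-dimensional registers\<close>

text \<open>A register is given by its dimension \<open>d\<close>; its operators are the \<open>d \<times> d\<close> complex matrices.
  In a composite register of dimensions \<open>m\<close>, \<open>n\<close>, the basis vector \<open>|i\<rangle>|k\<rangle>\<close> has index \<open>i * n + k\<close>.
  This makes tensor products strictly associative.\<close>

definition mtrace :: "complex mat \<Rightarrow> complex" where
  "mtrace A = (\<Sum>i<dim_row A. A $$ (i, i))"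

text \<open>The order on \<^typ>\<open>complex\<close> is the partial one: \<open>0 \<le> z\<close> says that \<open>z\<close> is real and nonnegative.\<close>

definition psd :: "nat \<Rightarrow> complex mat \<Rightarrow> bool" where
  "psd d A \<longleftrightarrow> A \<in> carrier_mat d d \<and> (\<forall>v \<in> carrier_vec d. 0 \<le> (A *\<^sub>v v) \<bullet>c v)"

text \<open>The positive semidefinite square root of a positive semidefinite matrix exists and is unique.\<close>

definition psd_sqrt :: "complex mat \<Rightarrow> complex mat" where
  "psd_sqrt A = (SOME B. psd (dim_row A) B \<and> B * B = A)"

definition fidelity :: "complex mat \<Rightarrow> complex mat \<Rightarrow> real" where
  "fidelity \<rho> \<sigma> = Re (mtrace (psd_sqrt (psd_sqrt \<rho> * \<sigma> * psd_sqrt \<rho>)))"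

definition eps_close :: "real \<Rightarrow> complex mat \<Rightarrow> complex mat \<Rightarrow> bool" where
  "eps_close \<epsilon> \<rho> \<sigma> \<longleftrightarrow> sqrt (1 - (fidelity \<rho> \<sigma>)\<^sup>2) \<le> \<epsilon>"

definition tensor_vec :: "complex vec \<Rightarrow> complex vec \<Rightarrow> complex vec" (infixl \<open>\<otimes>\<^sub>v\<close> 72) where
  "v \<otimes>\<^sub>v w = vec (dim_vec v * dim_vec w) (\<lambda>i. v $ (i div dim_vec w) * w $ (i mod dim_vec w))"

definition tensor_mat :: "complex mat \<Rightarrow> complex mat \<Rightarrow> complex mat" (infixl \<open>\<otimes>\<^sub>m\<close> 72) where
  "A \<otimes>\<^sub>m B = mat (dim_row A * dim_row B) (dim_col A * dim_col B)
     (\<lambda>(i, j). A $$ (i div dim_row B, j div dim_col B) * B $$ (i mod dim_row B, j mod dim_col B))"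

text \<open>The operator \<open>|v\<rangle>\<langle>w|\<close>.\<close>

definition ketbra :: "complex vec \<Rightarrow> complex vec \<Rightarrow> complex mat" where
  "ketbra v w = mat (dim_vec v) (dim_vec w) (\<lambda>(i, j). v $ i * cnj (w $ j))"

text \<open>A register whose basis is indexed by a finite type \<open>'a\<close> has dimension \<open>CARD('a)\<close>;
  the enumeration of its basis is the fixed bijection \<^term>\<open>to_nat_on\<close>.\<close>

definition ket :: "'a::finite \<Rightarrow> complex vec" where
  "ket a = unit_vec CARD('a) (to_nat_on (UNIV :: 'a set) a)"


section \<open>Channels\<close>

text \<open>\<open>app\<close> is only meaningful on operators of the input register.\<close>

record channel =
  idim :: nat
  odim :: nat
  app :: "complex mat \<Rightarrow> complex mat"

definition id_channel :: "nat \<Rightarrow> channel" where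
  "id_channel d = \<lparr>idim = d, odim = d, app = (\<lambda>\<rho>. \<rho>)\<rparr>"

definition comp_channel :: "channel \<Rightarrow> channel \<Rightarrow> channel" (infixl \<open>\<circ>\<^sub>c\<close> 65) where
  "\<Gamma> \<circ>\<^sub>c \<Lambda> = \<lparr>idim = idim \<Lambda>, odim = odim \<Gamma>, app = (\<lambda>\<rho>. app \<Gamma> (app \<Lambda> \<rho>))\<rparr>"

definition matrix_unit :: "nat \<Rightarrow> nat \<Rightarrow> nat \<Rightarrow> complex mat" where
  "matrix_unit d i j = ketbra (unit_vec d i) (unit_vec d j)"

text \<open>The linear map with \<open>A \<otimes> B \<mapsto> \<Lambda> A \<otimes> \<Gamma> B\<close>, obtained by expanding the argument
  in the matrix units \<open>|i\<rangle>\<langle>j| \<otimes> |k\<rangle>\<langle>l|\<close>.\<close>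

definition tensor_channel :: "channel \<Rightarrow> channel \<Rightarrow> channel" (infixl \<open>\<otimes>\<^sub>c\<close> 72) where
  "\<Lambda> \<otimes>\<^sub>c \<Gamma> = \<lparr>idim = idim \<Lambda> * idim \<Gamma>, odim = odim \<Lambda> * odim \<Gamma>,
     app = (\<lambda>\<rho>. mat (odim \<Lambda> * odim \<Gamma>) (odim \<Lambda> * odim \<Gamma>) (\<lambda>rs.
       \<Sum>i<idim \<Lambda>. \<Sum>j<idim \<Lambda>. \<Sum>k<idim \<Gamma>. \<Sum>l<idim \<Gamma>.
         \<rho> $$ (i * idim \<Gamma> + k, j * idim \<Gamma> + l) *
         (app \<Lambda> (matrix_unit (idim \<Lambda>) i j) \<otimes>\<^sub>m app \<Gamma> (matrix_unit (idim \<Gamma>) k l)) $$ rs))\<rparr>"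

definition linear_channel :: "channel \<Rightarrow> bool" where
  "linear_channel \<Lambda> \<longleftrightarrow>
     (\<forall>A \<in> carrier_mat (idim \<Lambda>) (idim \<Lambda>). app \<Lambda> A \<in> carrier_mat (odim \<Lambda>) (odim \<Lambda>)) \<and>
     (\<forall>A \<in> carrier_mat (idim \<Lambda>) (idim \<Lambda>). \<forall>B \<in> carrier_mat (idim \<Lambda>) (idim \<Lambda>).
        app \<Lambda> (A + B) = app \<Lambda> A + app \<Lambda> B) \<and>
     (\<forall>c. \<forall>A \<in> carrier_mat (idim \<Lambda>) (idim \<Lambda>). app \<Lambda> (c \<cdot>\<^sub>m A) = c \<cdot>\<^sub>m app \<Lambda> A)"

definition completely_positive :: "channel \<Rightarrow> bool" where
  "completely_positive \<Lambda> \<longleftrightarrow>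
     (\<forall>k \<rho>. psd (k * idim \<Lambda>) \<rho> \<longrightarrow> psd (k * odim \<Lambda>) (app (id_channel k \<otimes>\<^sub>c \<Lambda>) \<rho>))"

definition trace_preserving :: "channel \<Rightarrow> bool" where
  "trace_preserving \<Lambda> \<longleftrightarrow> (\<forall>A \<in> carrier_mat (idim \<Lambda>) (idim \<Lambda>). mtrace (app \<Lambda> A) = mtrace A)"

definition cptp :: "nat \<Rightarrow> nat \<Rightarrow> channel \<Rightarrow> bool" where
  "cptp m n \<Lambda> \<longleftrightarrow> idim \<Lambda> = m \<and> odim \<Lambda> = n \<and>
     linear_channel \<Lambda> \<and> completely_positive \<Lambda> \<and> trace_preserving \<Lambda>"

text \<open>The relabelling \<open>|i\<rangle>|k\<rangle> \<mapsto> |k\<rangle>|i\<rangle>\<close> for \<open>i < m\<close>, \<open>k < n\<close>; the output index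
  \<open>r = k * m + i\<close> comes from the input index \<open>i * n + k\<close>.\<close>

definition swap_channel :: "nat \<Rightarrow> nat \<Rightarrow> channel" where
  "swap_channel m n = \<lparr>idim = m * n, odim = n * m,
     app = (\<lambda>\<rho>. mat (n * m) (n * m) (\<lambda>(r, s).
       \<rho> $$ ((r mod m) * n + r div m, (s mod m) * n + s div m)))\<rparr>"


section \<open>Two-party protocols\<close>

text \<open>A party's behaviour: \<open>memory i\<close> is the dimension of the private register before step \<open>i\<close>,
  \<open>local_op i\<close> the operation applied in step \<open>i\<close>. Memory \<open>0\<close> is the input register, and the
  memory after the last step is the output register.\<close>

record party =
  memory :: "nat \<Rightarrow> nat"
  local_op :: "nat \<Rightarrow> channel"

text \<open>In step \<open>i < steps\<close> both parties act on their memory and on the message received last;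
  the operation returns the new memory and an outgoing message. The messages are then exchanged:
  \<open>to_alice (Suc i)\<close> and \<open>to_bob (Suc i)\<close> are their dimensions. Dimension \<open>1\<close> means that
  no message is sent, so protocols in which the players take turns are included.\<close>

record protocol =
  steps :: nat
  to_alice :: "nat \<Rightarrow> nat"
  to_bob :: "nat \<Rightarrow> nat"
  alice :: party
  bob :: party

text \<open>Alice's registers are ordered (memory, message) and Bob's (message, memory), so that the
  message registers are adjacent in the joint state.\<close>

definition alice_behaviour :: "protocol \<Rightarrow> nat \<Rightarrow> party \<Rightarrow> bool" where
  "alice_behaviour \<pi> d A \<longleftrightarrow> memory A 0 = d \<and>
     (\<forall>i < steps \<pi>. cptp (memory A i * to_alice \<pi> i) (memory A (Suc i) * to_bob \<pi> (Suc i))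
                         (local_op A i))"

definition bob_behaviour :: "protocol \<Rightarrow> nat \<Rightarrow> party \<Rightarrow> bool" where
  "bob_behaviour \<pi> d B \<longleftrightarrow> memory B 0 = d \<and>
     (\<forall>i < steps \<pi>. cptp (to_bob \<pi> i * memory B i) (to_alice \<pi> (Suc i) * memory B (Suc i))
                         (local_op B i))"

definition out_dim :: "protocol \<Rightarrow> party \<Rightarrow> nat" where
  "out_dim \<pi> P = memory P (steps \<pi>)"

definition protocol_for ::
  "('u::finite \<Rightarrow> 'v::finite \<Rightarrow> 'z::finite) \<Rightarrow> protocol \<Rightarrow> bool" where
  "protocol_for f \<pi> \<longleftrightarrow>
     to_alice \<pi> 0 = 1 \<and> to_bob \<pi> 0 = 1 \<and> to_alice \<pi> (steps \<pi>) = 1 \<and> to_bob \<pi> (steps \<pi>) = 1 \<and>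
     alice_behaviour \<pi> CARD('u) (alice \<pi>) \<and> out_dim \<pi> (alice \<pi>) = CARD('z) \<and>
     bob_behaviour \<pi> CARD('v) (bob \<pi>) \<and> out_dim \<pi> (bob \<pi>) = CARD('z)"

text \<open>The joint state before step \<open>i\<close> is ordered: Alice's memory, message to Alice,
  message to Bob, Bob's memory.\<close>

fun run :: "protocol \<Rightarrow> party \<Rightarrow> party \<Rightarrow> nat \<Rightarrow> channel" where
  "run \<pi> A B 0 = id_channel (memory A 0 * memory B 0)"
| "run \<pi> A B (Suc i) =
     (id_channel (memory A (Suc i)) \<otimes>\<^sub>c swap_channel (to_bob \<pi> (Suc i)) (to_alice \<pi> (Suc i))
        \<otimes>\<^sub>c id_channel (memory B (Suc i)))
     \<circ>\<^sub>c (local_op A i \<otimes>\<^sub>c local_op B i) \<circ>\<^sub>c run \<pi> A B i"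

definition execute :: "protocol \<Rightarrow> party \<Rightarrow> party \<Rightarrow> channel" where
  "execute \<pi> A B = run \<pi> A B (steps \<pi>)"


section \<open>Correctness and security\<close>

text \<open>\<open>|u\<rangle>\<langle>u'| \<otimes> |v\<rangle>\<langle>v'|\<close> contributes only if \<open>u = u'\<close> and \<open>v = v'\<close>: the diagonal entries
  \<open>\<langle>uv|\<sigma>|uv\<rangle>\<close> determine the output.\<close>

definition ideal_functionality :: "('u::finite \<Rightarrow> 'v::finite \<Rightarrow> 'z::finite) \<Rightarrow> channel" where
  "ideal_functionality f = \<lparr>idim = CARD('u) * CARD('v), odim = CARD('z) * CARD('z),
     app = (\<lambda>\<sigma>. mat (CARD('z) * CARD('z)) (CARD('z) * CARD('z)) (\<lambda>rs.
       \<Sum>u\<in>UNIV. \<Sum>v\<in>UNIV. ((\<sigma> *\<^sub>v (ket u \<otimes>\<^sub>v ket v)) \<bullet>c (ket u \<otimes>\<^sub>v ket v)) *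
         (ketbra (ket (f u v)) (ket (f u v)) \<otimes>\<^sub>m ketbra (ket (f u v)) (ket (f u v))) $$ rs))\<rparr>"

text \<open>The auxiliary register \<open>K\<close> has dimension \<open>k\<close>; the input of \<open>\<Lambda>\<^sub>2\<close> is ordered as
  (output of the functionality, \<open>K\<close>).\<close>

definition ideal_execution ::
  "('u::finite \<Rightarrow> 'v::finite \<Rightarrow> 'z::finite) \<Rightarrow> nat \<Rightarrow> channel \<Rightarrow> channel \<Rightarrow> channel" where
  "ideal_execution f k \<Lambda>\<^sub>1 \<Lambda>\<^sub>2 =
     (id_channel CARD('z) \<otimes>\<^sub>c \<Lambda>\<^sub>2) \<circ>\<^sub>c (ideal_functionality f \<otimes>\<^sub>c id_channel k)
     \<circ>\<^sub>c (id_channel CARD('u) \<otimes>\<^sub>c \<Lambda>\<^sub>1)"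

text \<open>The vector \<open>\<Sum>\<^sub>u\<^sub>,\<^sub>v sqrt (p (u, v)) |u v\<rangle>\<^sub>R |u\<rangle>\<^sub>U |v\<rangle>\<^sub>V\<close> and the corresponding state.\<close>

definition purification_vec :: "('u::finite \<times> 'v::finite) pmf \<Rightarrow> complex vec" where
  "purification_vec p =
     vec ((CARD('u) * CARD('v)) * (CARD('u) * CARD('v))) (\<lambda>i.
       \<Sum>u\<in>UNIV. \<Sum>v\<in>UNIV. complex_of_real (sqrt (pmf p (u, v))) *
         ((ket u \<otimes>\<^sub>v ket v) \<otimes>\<^sub>v (ket u \<otimes>\<^sub>v ket v)) $ i)"

text \<open>All purifications of the same state agree up to an isometry on \<open>R\<close>, under which closeness is
  invariant, so fixing the canonical one loses nothing.\<close>

definition purified_input :: "('u::finite \<times> 'v::finite) pmf \<Rightarrow> complex mat" where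
  "purified_input p = ketbra (purification_vec p) (purification_vec p)"

definition eps_correct ::
  "real \<Rightarrow> ('u::finite \<Rightarrow> 'v::finite \<Rightarrow> 'z::finite) \<Rightarrow> protocol \<Rightarrow> bool" where
  "eps_correct \<epsilon> f \<pi> \<longleftrightarrow> (\<forall>p :: ('u \<times> 'v) pmf.
     eps_close \<epsilon>
       (app (id_channel (CARD('u) * CARD('v)) \<otimes>\<^sub>c execute \<pi> (alice \<pi>) (bob \<pi>)) (purified_input p))
       (app (id_channel (CARD('u) * CARD('v)) \<otimes>\<^sub>c ideal_functionality f) (purified_input p)))"

definition eps_secure_against_bob ::
  "real \<Rightarrow> ('u::finite \<Rightarrow> 'v::finite \<Rightarrow> 'z::finite) \<Rightarrow> protocol \<Rightarrow> bool" where
  "eps_secure_against_bob \<epsilon> f \<pi> \<longleftrightarrow>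
     (\<forall>(p :: ('u \<times> 'v) pmf) B'. bob_behaviour \<pi> CARD('v) B' \<longrightarrow>
       (\<exists>k \<Lambda>\<^sub>1 \<Lambda>\<^sub>2. cptp CARD('v) (CARD('v) * k) \<Lambda>\<^sub>1 \<and> cptp (CARD('z) * k) (out_dim \<pi> B') \<Lambda>\<^sub>2 \<and>
         eps_close \<epsilon>
           (app (id_channel (CARD('u) * CARD('v)) \<otimes>\<^sub>c execute \<pi> (alice \<pi>) B') (purified_input p))
           (app (id_channel (CARD('u) * CARD('v)) \<otimes>\<^sub>c ideal_execution f k \<Lambda>\<^sub>1 \<Lambda>\<^sub>2)
             (purified_input p))))"


section \<open>Cheating strategies for Alice\<close>

definition povm :: "nat \<Rightarrow> ('v::finite \<Rightarrow> complex mat) \<Rightarrow> bool" where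
  "povm d M \<longleftrightarrow> (\<forall>v. psd d (M v)) \<and> (\<forall>i<d. \<forall>j<d. (\<Sum>v\<in>UNIV. M v $$ (i, j)) = 1\<^sub>m d $$ (i, j))"

text \<open>Alice draws a dishonest behaviour and a final measurement of her output register from
  a finitely supported distribution (her private randomness).\<close>

type_synonym 'v alice_strategy = "(party \<times> ('v \<Rightarrow> complex mat)) pmf"

definition cheating_strategy ::
  "('u::finite \<Rightarrow> 'v::finite \<Rightarrow> 'z::finite) \<Rightarrow> protocol \<Rightarrow> 'v alice_strategy \<Rightarrow> bool" where
  "cheating_strategy f \<pi> S \<longleftrightarrow> finite (set_pmf S) \<and>
     (\<forall>(A, M) \<in> set_pmf S. alice_behaviour \<pi> CARD('u) A \<and> povm (out_dim \<pi> A) M)"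

text \<open>Probability of outcome \<open>w\<close> on input \<open>|u\<^sub>0\<rangle>|v\<rangle>\<close>; Bob's output register is not measured.\<close>

definition outcome_prob ::
  "protocol \<Rightarrow> 'v alice_strategy \<Rightarrow> 'u::finite \<Rightarrow> 'v::finite \<Rightarrow> 'v \<Rightarrow> real" where
  "outcome_prob \<pi> S u\<^sub>0 v w = measure_pmf.expectation S (\<lambda>(A, M).
     Re (mtrace ((M w \<otimes>\<^sub>m 1\<^sub>m (out_dim \<pi> (bob \<pi>))) *
       app (execute \<pi> A (bob \<pi>)) (ketbra (ket u\<^sub>0 \<otimes>\<^sub>v ket v) (ket u\<^sub>0 \<otimes>\<^sub>v ket v)))))"

end

theory Submission
  imports Defs "Jordan_Normal_Form.Spectral_Radius"
begin

text \<open>Let both parties follow the protocol but keep the environments of their local operations. Against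
  purified Bob, security provides a simulator that submits some \<open>w\<close> for Bob's input \<open>v\<close>, with a distribution
  that does not depend on Alice's input. The real and the ideal final states, restricted to everything but
  Alice's environment, have large fidelity, so by Uhlmann's theorem a contraction on Alice's environment
  carries a purification of the real state close to one of the ideal state, in which \<open>w\<close> can be read off.
  Measuring \<open>w\<close> through this contraction is Alice's attack. In the ideal execution her output is \<open>f(u, w)\<close>;
  in the real one it is almost surely \<open>f(u, v)\<close> by correctness, so \<open>f(u, w) = f(u, v)\<close> with high probability.
  This bounds the average success for every distribution of \<open>(u\<^sub>0, u, v)\<close>, and the minimax theorem yields one
  randomised attack that is good for all inputs.\<close>

section \<open>Linear algebra\<close>

text \<open>The simulator may depend on the input distribution, so every distribution comes with its
  own attack that is good only on average; a game between inputs and attacks has to be solved.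
  Purifications are handled as finite families of Kraus amplitudes. The same amplitudes
  \<open>K e f\<close>, with \<open>e\<close> a history of Alice's environment and \<open>f\<close>
  one of Bob's, describe the honest run, the run against purified Bob and the run of purified Alice:
  each history is either a summation index or a part of the output. Uhlmann's matrix
  \<open>W\<close> acts on \<open>e\<close> in a run that Alice plays honestly, and the measurement
  built from it acts on the same \<open>e\<close> as a register of purified Alice. Closeness
  \<epsilon> yields fidelity at least \<open>1 - \<epsilon>\<^sup>2\<close>. Averaged over the mixed
  input distribution, the simulator's value is bad with probability at most
  \<open>8 * \<epsilon>\<^sup>2\<close> and Alice's guess falls short of it by at most
  \<open>3 * \<epsilon>\<close>; passing to either marginal doubles these, and \<open>16 *
  \<epsilon>\<^sup>2 + 6 * \<epsilon> \<le> 22 * \<epsilon>\<close> for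
  \<open>\<epsilon> \<le> 1\<close>. The margin between 22 and 28 pays for the minimax step.\<close>

abbreviation dagger :: "complex mat \<Rightarrow> complex mat" (\<open>_\<^sup>\<dagger>\<close> [1000] 1000) where
  "A\<^sup>\<dagger> \<equiv> mat_adjoint A"

lemma dim_dagger [simp]: "dim_row (A\<^sup>\<dagger>) = dim_col A" "dim_col (A\<^sup>\<dagger>) = dim_row A"
  by (simp_all add: mat_adjoint_def)

lemma dagger_carrier [simp]: "A\<^sup>\<dagger> \<in> carrier_mat n m \<longleftrightarrow> A \<in> carrier_mat m n"
  by (metis carrier_matD carrier_matI dim_dagger)

lemma index_dagger [simp]:
  "i < dim_col A \<Longrightarrow> j < dim_row A \<Longrightarrow> A\<^sup>\<dagger> $$ (i, j) = cnj (A $$ (j, i))"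
  by (simp add: mat_adjoint_def mat_of_rows_index)

lemma dagger_dagger [simp]: "(A\<^sup>\<dagger>)\<^sup>\<dagger> = A"
  by (intro eq_matI) auto

lemma index_mult_sum:
  "i < dim_row A \<Longrightarrow> j < dim_col B \<Longrightarrow> dim_col A = dim_row B \<Longrightarrow>
    (A * B) $$ (i, j) = (\<Sum>k<dim_row B. A $$ (i, k) * B $$ (k, j))"
  by (simp add: scalar_prod_def atLeast0LessThan)

lemma dagger_mult:
  assumes "dim_col A = dim_row B"
  shows "(A * B)\<^sup>\<dagger> = B\<^sup>\<dagger> * A\<^sup>\<dagger>"
proof (intro eq_matI)
  fix i j assume "i < dim_row (B\<^sup>\<dagger> * A\<^sup>\<dagger>)" "j < dim_col (B\<^sup>\<dagger> * A\<^sup>\<dagger>)"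
  then have ij: "i < dim_col B" "j < dim_row A" by auto
  have "(A * B)\<^sup>\<dagger> $$ (i, j) = cnj ((A * B) $$ (j, i))" using ij by (intro index_dagger) auto
  also have "\<dots> = (\<Sum>k<dim_row B. cnj (A $$ (j, k)) * cnj (B $$ (k, i)))"
    using ij assms by (subst index_mult_sum) auto
  also have "\<dots> = (B\<^sup>\<dagger> * A\<^sup>\<dagger>) $$ (i, j)"
    using ij assms by (subst index_mult_sum) (auto intro!: sum.cong)
  finally show "(A * B)\<^sup>\<dagger> $$ (i, j) = (B\<^sup>\<dagger> * A\<^sup>\<dagger>) $$ (i, j)" .
qed auto

lemma mult_assoc_dim:
  assumes "dim_col A = dim_row B" "dim_col B = dim_row C"
  shows "(A :: complex mat) * B * C = A * (B * C)"
  by (rule assoc_mult_mat[of _ "dim_row A" "dim_col A" _ "dim_col B" _ "dim_col C"]) (use assms in auto)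

lemma dagger_minus:
  "dim_row A = dim_row B \<Longrightarrow> dim_col A = dim_col B \<Longrightarrow> (A - B)\<^sup>\<dagger> = A\<^sup>\<dagger> - B\<^sup>\<dagger>"
  by (intro eq_matI) auto

lemma dagger_one [simp]: "(1\<^sub>m n)\<^sup>\<dagger> = 1\<^sub>m n"
  by (intro eq_matI) auto

section \<open>Squared norms, quadratic forms and positive semidefinite matrices\<close>

definition norm2 :: "complex vec \<Rightarrow> real" where
  "norm2 v = (\<Sum>i<dim_vec v. (cmod (v $ i))\<^sup>2)"

lemma norm2_ge0 [simp]: "0 \<le> norm2 v"
  by (simp add: norm2_def sum_nonneg)

lemma cscalar_self: "v \<bullet>c v = of_real (norm2 v)"
  by (simp add: scalar_prod_def norm2_def atLeast0LessThan flip: complex_norm_square of_real_sum del: of_real_power)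

lemma mult_mat_vec_sum:
  "i < dim_row A \<Longrightarrow> dim_col A = dim_vec v \<Longrightarrow> (A *\<^sub>v v) $ i = (\<Sum>k<dim_vec v. A $$ (i, k) * v $ k)"
  by (simp add: scalar_prod_def atLeast0LessThan)

lemma quadratic_form:
  assumes "A \<in> carrier_mat d d" "v \<in> carrier_vec d"
  shows "(A *\<^sub>v v) \<bullet>c v = (\<Sum>i<d. \<Sum>j<d. A $$ (i, j) * v $ j * cnj (v $ i))"
  using assms by (simp add: scalar_prod_def atLeast0LessThan sum_distrib_right)

text \<open>The quadratic form of a Gram matrix is a squared norm. The exact value in the second
  part is what turns a statement about projections into one about norms in
  \<open>partial_isometry_contraction\<close>.\<close>

lemma psd_mult_dagger:
  assumes "G \<in> carrier_mat d k"
  shows "psd d (G * G\<^sup>\<dagger>)" and "v \<in> carrier_vec d \<Longrightarrow> ((G * G\<^sup>\<dagger>) *\<^sub>v v) \<bullet>c v = of_real (norm2 (G\<^sup>\<dagger> *\<^sub>v v))"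
proof -
  have *: "((G * G\<^sup>\<dagger>) *\<^sub>v v) \<bullet>c v = of_real (norm2 (G\<^sup>\<dagger> *\<^sub>v v))" if v: "v \<in> carrier_vec d" for v
  proof -
    have "((G * G\<^sup>\<dagger>) *\<^sub>v v) \<bullet>c v = (\<Sum>i<d. \<Sum>j<d. (\<Sum>a<k. G $$ (i, a) * cnj (G $$ (j, a))) * v $ j * cnj (v $ i))"
      using assms v by (subst quadratic_form[of _ d]) (auto intro!: sum.cong simp: index_mult_sum simp del: index_mult_mat(1))
    also have "\<dots> = (\<Sum>i<d. \<Sum>j<d. \<Sum>a<k. (G $$ (i, a) * cnj (v $ i)) * (cnj (G $$ (j, a)) * v $ j))"
      by (simp add: sum_distrib_right sum_distrib_left mult_ac)
    also have "\<dots> = (\<Sum>i<d. \<Sum>a<k. \<Sum>j<d. (G $$ (i, a) * cnj (v $ i)) * (cnj (G $$ (j, a)) * v $ j))"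
      by (rule sum.cong[OF refl sum.swap])
    also have "\<dots> = (\<Sum>a<k. \<Sum>i<d. \<Sum>j<d. (G $$ (i, a) * cnj (v $ i)) * (cnj (G $$ (j, a)) * v $ j))"
      by (rule sum.swap)
    also have "\<dots> = (\<Sum>a<k. (\<Sum>i<d. G $$ (i, a) * cnj (v $ i)) * (\<Sum>j<d. cnj (G $$ (j, a)) * v $ j))"
      by (simp only: sum_product)
    also have "\<dots> = (\<Sum>a<k. (G\<^sup>\<dagger> *\<^sub>v v) $ a * cnj ((G\<^sup>\<dagger> *\<^sub>v v) $ a))"
      using assms v by (intro sum.cong) (auto simp: mult_mat_vec_sum mult.commute simp del: index_mult_mat_vec)
    also have "\<dots> = of_real (norm2 (G\<^sup>\<dagger> *\<^sub>v v))"
      using assms by (simp add: norm2_def flip: complex_norm_square del: of_real_power index_mult_mat_vec)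
    finally show ?thesis .
  qed
  show "v \<in> carrier_vec d \<Longrightarrow> ((G * G\<^sup>\<dagger>) *\<^sub>v v) \<bullet>c v = of_real (norm2 (G\<^sup>\<dagger> *\<^sub>v v))" by (rule *)
  show "psd d (G * G\<^sup>\<dagger>)"
    unfolding psd_def using assms * by (auto simp: less_eq_complex_def)
qed

text \<open>Polarisation. That \<open>0 \<le> z\<close> makes z real means that the quadratic form
  has no imaginary part. Testing it at \<open>e_i + c * e_j\<close> gives the imaginary part of the
  claim for c = 1 and the real part for c = \<i>.\<close>

lemma psd_hermitian:
  assumes "psd d A"
  shows "A\<^sup>\<dagger> = A"
proof -
  have A: "A \<in> carrier_mat d d" and q: "\<And>v. v \<in> carrier_vec d \<Longrightarrow> Im ((A *\<^sub>v v) \<bullet>c v) = 0"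
    using assms by (auto simp: psd_def less_eq_complex_def)
  have pol: "Im (A $$ (i, i) + c * A $$ (i, j) + cnj c * A $$ (j, i) + c * cnj c * A $$ (j, j)) = 0"
    if ij: "i < d" "j < d" for i j c
  proof -
    \<comment> \<open>The two indicators are added, so for \<open>i = j\<close> the vector is
      \<open>(1 + c) * e_i\<close>; with \<open>c = 0\<close> this covers the diagonal
      entries.\<close>
    define v where "v = vec d (\<lambda>k. (if k = i then 1 else 0) + (if k = j then c else 0))"
    have v: "v \<in> carrier_vec d" by (simp add: v_def)
    have vs: "(\<Sum>k<d. g k * v $ k) = g i + c * g j" "(\<Sum>k<d. g k * cnj (v $ k)) = g i + cnj c * g j" for g
      using ij by (simp_all add: v_def distrib_left sum.distrib mult_delta_right if_distrib[of cnj] mult.commute[of c]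
          mult.commute[of "cnj c"] cong: if_cong)
    have "(A *\<^sub>v v) \<bullet>c v = (\<Sum>k<d. (\<Sum>l<d. A $$ (k, l) * v $ l) * cnj (v $ k))"
      using A v by (simp add: quadratic_form sum_distrib_right)
    also have "\<dots> = A $$ (i, i) + c * A $$ (i, j) + cnj c * A $$ (j, i) + c * cnj c * A $$ (j, j)"
      unfolding vs by (simp add: algebra_simps)
    finally show ?thesis using q[OF v] by simp
  qed
  have d: "Im (A $$ (i, i)) = 0" if "i < d" for i using pol[OF that that, of 0] by simp
  show ?thesis
  proof (intro eq_matI)
    fix i j assume "i < dim_row A" "j < dim_col A"
    then have ij: "i < d" "j < d" using A by auto
    have "A $$ (j, i) = cnj (A $$ (i, j))"
      using pol[OF ij, of 1] pol[OF ij, of \<i>] d[OF ij(1)] d[OF ij(2)] by (simp add: complex_eq_iff)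
    then show "A\<^sup>\<dagger> $$ (i, j) = A $$ (i, j)" using ij A by simp
  qed (use A in auto)
qed

section \<open>The spectral theorem for Hermitian matrices\<close>

definition diagm :: "nat \<Rightarrow> (nat \<Rightarrow> complex) \<Rightarrow> complex mat" where
  "diagm n d = mat n n (\<lambda>(i, j). if i = j then d i else 0)"

lemma diagm_carrier [simp]: "diagm n d \<in> carrier_mat n n" "dim_row (diagm n d) = n" "dim_col (diagm n d) = n"
  by (simp_all add: diagm_def)

lemma diagm_mult: "diagm n d * diagm n e = diagm n (\<lambda>i. d i * e i)"
proof (intro eq_matI)
  fix i j assume "i < dim_row (diagm n (\<lambda>i. d i * e i))" "j < dim_col (diagm n (\<lambda>i. d i * e i))"
  then have ij: "i < n" "j < n" by auto
  then have "(diagm n d * diagm n e) $$ (i, j) = (\<Sum>k<n. (if k = i then d i * (if i = j then e i else 0) else 0))"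
    by (simp only: index_mult_sum diagm_carrier) (auto simp: diagm_def mult_delta_left)
  then show "(diagm n d * diagm n e) $$ (i, j) = diagm n (\<lambda>i. d i * e i) $$ (i, j)"
    using ij by (simp add: diagm_def)
qed auto

lemma diagm_dagger: "(diagm n d)\<^sup>\<dagger> = diagm n (\<lambda>i. cnj (d i))"
  by (intro eq_matI) (auto simp: diagm_def)

lemma unitary_commute:
  "U \<in> carrier_mat n n \<Longrightarrow> U\<^sup>\<dagger> * U = 1\<^sub>m n \<Longrightarrow> U * U\<^sup>\<dagger> = 1\<^sub>m n"
  by (rule mat_mult_left_right_inverse[of _ n]) auto

text \<open>A complex matrix has an eigenvector; Gram-Schmidt applied to a basis that starts with it
  keeps it as the first vector.\<close>

lemma unitary_extending_eigenvector:
  assumes A: "A \<in> carrier_mat n n" and n: "n > 0"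
  obtains U e where "U \<in> carrier_mat n n" "U\<^sup>\<dagger> * U = 1\<^sub>m n"
    "\<And>i. i < n \<Longrightarrow> (U\<^sup>\<dagger> * (A * U)) $$ (i, 0) = (if i = 0 then e else 0)"
proof -
  obtain e where "eigenvalue A e"
    using spectrum_non_empty[OF A n] by (auto simp: spectrum_def)
  then obtain v where ev: "v \<in> carrier_vec n" "v \<noteq> 0\<^sub>v n" "A *\<^sub>v v = e \<cdot>\<^sub>v v"
    using A by (auto simp: eigenvalue_def eigenvector_def)
  interpret cof_vec_space n "TYPE(complex)" .
  define ws where "ws = gram_schmidt n (basis_completion v)"
  from basis_completion[OF ev(1,2)]
  have b: "distinct (basis_completion v)" "\<not> lin_dep (set (basis_completion v))"
    "set (basis_completion v) \<subseteq> carrier_vec n" "hd (basis_completion v) = v" "length (basis_completion v) = n"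
    by auto
  from gram_schmidt_result[OF b(3,1,2) refl, folded ws_def]
  have ws: "set ws \<subseteq> carrier_vec n" "corthogonal ws" "length ws = n" by (auto simp: b)
  obtain vs where "basis_completion v = v # vs" using b(4,5) n by (cases "basis_completion v") auto
  then have hd: "ws ! 0 = v"
    using gram_schmidt_hd[OF ev(1), of vs] ws(3) n by (cases ws) (auto simp: ws_def)
  \<comment> \<open>Gram-Schmidt leaves the vectors orthogonal but not normalised; dividing column
    \<open>j\<close> by its norm \<open>N j\<close> makes \<open>U\<close> unitary.\<close>
  define N where "N j = complex_of_real (sqrt (norm2 (ws ! j)))" for j
  have wsc: "ws ! j \<in> carrier_vec n" if "j < n" for j using ws that by (auto simp: set_conv_nth)
  have N: "N j * N j = of_real (norm2 (ws ! j))" "cnj (N j) = N j" for j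
    by (simp_all add: N_def flip: of_real_mult)
  have N0: "N j \<noteq> 0" if "j < n" for j
  proof -
    have "ws ! j \<bullet>c ws ! j \<noteq> 0" using corthogonalD[OF ws(2), of j j] that ws(3) by auto
    then show ?thesis by (simp add: N_def cscalar_self)
  qed
  define U where "U = mat n n (\<lambda>(i, j). ws ! j $ i / N j)"
  have U: "U \<in> carrier_mat n n" by (simp add: U_def)
  have UU: "U\<^sup>\<dagger> * U = 1\<^sub>m n"
  proof (intro eq_matI)
    fix i j assume "i < dim_row (1\<^sub>m n :: complex mat)" "j < dim_col (1\<^sub>m n :: complex mat)"
    then have ij: "i < n" "j < n" by auto
    have "(U\<^sup>\<dagger> * U) $$ (i, j) = (\<Sum>k<n. ws ! j $ k * cnj (ws ! i $ k)) / (N i * N j)"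
      using ij U by (subst index_mult_sum) (auto simp: U_def N sum_divide_distrib mult_ac intro!: sum.cong)
    also have "(\<Sum>k<n. ws ! j $ k * cnj (ws ! i $ k)) = ws ! j \<bullet>c ws ! i"
      using wsc[OF ij(1)] by (simp add: scalar_prod_def atLeast0LessThan)
    also have "\<dots> / (N i * N j) = (if i = j then 1 else 0)"
    proof (cases "i = j")
      case True then show ?thesis using N0[OF ij(1)] by (simp add: cscalar_self flip: N(1))
    next
      case False then show ?thesis using corthogonalD[OF ws(2), of j i] ij ws(3) by simp
    qed
    finally show "(U\<^sup>\<dagger> * U) $$ (i, j) = 1\<^sub>m n $$ (i, j)" using ij by simp
  qed (use U in auto)
  have AU: "(A * U) $$ (k, 0) = e * U $$ (k, 0)" if k: "k < n" for k
  proof -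
    have "(A * U) $$ (k, 0) = (\<Sum>l<n. A $$ (k, l) * v $ l) / N 0"
      using A U k n by (subst index_mult_sum) (auto simp: U_def hd sum_divide_distrib)
    also have "(\<Sum>l<n. A $$ (k, l) * v $ l) = (A *\<^sub>v v) $ k"
      using A ev(1) k by (subst mult_mat_vec_sum) auto
    also have "\<dots> / N 0 = e * U $$ (k, 0)" using ev k n by (simp add: U_def hd)
    finally show ?thesis .
  qed
  have "(U\<^sup>\<dagger> * (A * U)) $$ (i, 0) = (if i = 0 then e else 0)" if i: "i < n" for i
  proof -
    have "(U\<^sup>\<dagger> * (A * U)) $$ (i, 0) = (\<Sum>k<n. U\<^sup>\<dagger> $$ (i, k) * (e * U $$ (k, 0)))"
      using A U n i by (subst index_mult_sum) (auto simp: AU simp del: index_mult_mat(1) intro!: sum.cong)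
    also have "\<dots> = e * (U\<^sup>\<dagger> * U) $$ (i, 0)"
      using U n i by (subst index_mult_sum) (auto simp: sum_distrib_left mult_ac)
    finally show ?thesis using i n by (simp add: UU)
  qed
  with that U UU show thesis by blast
qed

lemma unitary_conj_solve:
  assumes "U \<in> carrier_mat n n" "U\<^sup>\<dagger> * U = 1\<^sub>m n" "A \<in> carrier_mat n n"
  shows "U * (U\<^sup>\<dagger> * A * U) * U\<^sup>\<dagger> = A"
proof -
  have "U * (U\<^sup>\<dagger> * A * U) * U\<^sup>\<dagger> = (U * U\<^sup>\<dagger>) * A * (U * U\<^sup>\<dagger>)"
    using assms(1,3) by (simp add: mult_assoc_dim)
  then show ?thesis using assms unitary_commute[OF assms(1,2)] by simp
qed

text \<open>Induction on the dimension. Conjugation by a unitary whose first column is an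
  eigenvector clears the first column below the diagonal; Hermitian symmetry then clears the first
  row, which leaves the eigenvalue and a smaller Hermitian block \<open>B3\<close>.\<close>

theorem hermitian_spectral:
  assumes "A \<in> carrier_mat n n" "A\<^sup>\<dagger> = A"
  shows "\<exists>U d. U \<in> carrier_mat n n \<and> U\<^sup>\<dagger> * U = 1\<^sub>m n \<and> A = U * diagm n d * U\<^sup>\<dagger>"
  using assms
proof (induction n arbitrary: A)
  case 0
  then have "A = 1\<^sub>m 0 * diagm 0 (\<lambda>_. 0) * (1\<^sub>m 0)\<^sup>\<dagger>" by (intro eq_matI) auto
  then show ?case by (intro exI[of _ "1\<^sub>m 0"]) auto
next
  case (Suc n)
  obtain W e where W: "W \<in> carrier_mat (Suc n) (Suc n)" "W\<^sup>\<dagger> * W = 1\<^sub>m (Suc n)"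
    and col: "\<And>i. i < Suc n \<Longrightarrow> (W\<^sup>\<dagger> * (A * W)) $$ (i, 0) = (if i = 0 then e else 0)"
    using unitary_extending_eigenvector[OF Suc.prems(1)] by auto
  define B where "B = W\<^sup>\<dagger> * A * W"
  have B: "B \<in> carrier_mat (Suc n) (Suc n)" using W Suc.prems by (auto simp: B_def)
  have Bh: "B\<^sup>\<dagger> = B" using W(1) Suc.prems by (simp add: B_def dagger_mult mult_assoc_dim)
  have B0: "B $$ (i, 0) = (if i = 0 then e else 0)" if "i < Suc n" for i
    using col[OF that] W(1) Suc.prems by (simp add: B_def mult_assoc_dim del: index_mult_mat(1))
  have Bsym: "B $$ (i, j) = cnj (B $$ (j, i))" if "i < Suc n" "j < Suc n" for i j
    using arg_cong[OF Bh, of "\<lambda>M. M $$ (i, j)"] B that by simp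
  have B0': "B $$ (0, i) = (if i = 0 then e else 0)" if "i < Suc n" for i
    using Bsym[of 0 i] Bsym[of 0 0] B0[OF that] B0[of 0] that by (auto split: if_splits)
  define B3 where "B3 = mat n n (\<lambda>(i, j). B $$ (Suc i, Suc j))"
  have "B3\<^sup>\<dagger> = B3" by (intro eq_matI) (auto simp: B3_def Bsym[symmetric])
  from Suc.IH[OF _ this] obtain U d where U: "U \<in> carrier_mat n n" "U\<^sup>\<dagger> * U = 1\<^sub>m n"
    and BU: "B3 = U * diagm n d * U\<^sup>\<dagger>" by (auto simp: B3_def)
  \<comment> \<open>\<open>V\<close> is the direct sum of 1 and \<open>U\<close>; correspondingly
    \<open>d'\<close> lists the split-off eigenvalue before those of \<open>B3\<close>.\<close>
  define V where "V = mat (Suc n) (Suc n) (\<lambda>(i, j). if i = 0 \<or> j = 0 then of_bool (i = j) else U $$ (i - 1, j - 1))"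
  define d' where "d' = case_nat e d"
  have V: "V \<in> carrier_mat (Suc n) (Suc n)" by (simp add: V_def)
  have V0: "V $$ (0, j) = of_bool (j = 0)" "V $$ (j, 0) = of_bool (j = 0)" if "j < Suc n" for j
    using that by (auto simp: V_def)
  have VS: "V $$ (Suc i, Suc j) = U $$ (i, j)" if "i < n" "j < n" for i j
    using that by (auto simp: V_def)
  have VV: "V\<^sup>\<dagger> * V = 1\<^sub>m (Suc n)"
  proof (intro eq_matI)
    fix i j assume "i < dim_row (1\<^sub>m (Suc n) :: complex mat)" "j < dim_col (1\<^sub>m (Suc n) :: complex mat)"
    then have ij: "i < Suc n" "j < Suc n" by auto
    have *: "(V\<^sup>\<dagger> * V) $$ (i, j) = cnj (V $$ (0, i)) * V $$ (0, j) + (\<Sum>k<n. cnj (V $$ (Suc k, i)) * V $$ (Suc k, j))"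
      using ij V by (subst index_mult_sum) (auto simp: sum.lessThan_Suc_shift simp del: sum.lessThan_Suc)
    show "(V\<^sup>\<dagger> * V) $$ (i, j) = 1\<^sub>m (Suc n) $$ (i, j)"
    proof (cases "i = 0 \<or> j = 0")
      case True then show ?thesis unfolding * using ij by (auto simp: V0)
    next
      case False
      then obtain a b where ab: "i = Suc a" "j = Suc b" "a < n" "b < n" using ij by (cases i; cases j) auto
      have "(\<Sum>k<n. cnj (U $$ (k, a)) * U $$ (k, b)) = (U\<^sup>\<dagger> * U) $$ (a, b)"
        using U(1) ab by (subst index_mult_sum) auto
      then show ?thesis unfolding * using ab U(2) by (simp add: V0 VS)
    qed
  qed (use V in auto)
  have VD: "V * diagm (Suc n) d' * V\<^sup>\<dagger> = B"
  proof (intro eq_matI)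
    fix i j assume "i < dim_row B" "j < dim_col B"
    then have ij: "i < Suc n" "j < Suc n" using B by auto
    have e1: "(X * diagm m f * Y) $$ (i, j) = (\<Sum>k<m. X $$ (i, k) * f k * Y $$ (k, j))"
      if "X \<in> carrier_mat m m" "Y \<in> carrier_mat m m" "i < m" "j < m" for X Y m f i j
    proof -
      have "(X * diagm m f) $$ (i, k) = X $$ (i, k) * f k" if "k < m" for k
        using that \<open>i < m\<close> \<open>X \<in> _\<close> by (subst index_mult_sum) (auto simp: diagm_def if_distrib[of "\<lambda>x. _ * x"] cong: if_cong)
      then show ?thesis using that by (subst index_mult_sum) auto
    qed
    have *: "(V * diagm (Suc n) d' * V\<^sup>\<dagger>) $$ (i, j) =
        V $$ (i, 0) * e * cnj (V $$ (j, 0)) + (\<Sum>k<n. V $$ (i, Suc k) * d k * cnj (V $$ (j, Suc k)))"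
      using ij V by (subst e1) (auto simp: sum.lessThan_Suc_shift d'_def simp del: sum.lessThan_Suc)
    show "(V * diagm (Suc n) d' * V\<^sup>\<dagger>) $$ (i, j) = B $$ (i, j)"
    proof (cases "i = 0 \<or> j = 0")
      case True then show ?thesis unfolding * using ij by (auto simp: V0 B0 B0')
    next
      case False
      then obtain a b where ab: "i = Suc a" "j = Suc b" "a < n" "b < n" using ij by (cases i; cases j) auto
      have "(\<Sum>k<n. U $$ (a, k) * d k * cnj (U $$ (b, k))) = B3 $$ (a, b)"
        unfolding BU using U(1) ab by (subst e1) auto
      then show ?thesis unfolding * using ab by (simp add: V0 VS B3_def)
    qed
  qed (use V B in auto)
  have "A = (W * V) * diagm (Suc n) d' * (W * V)\<^sup>\<dagger>"
  proof -
    have "A = W * B * W\<^sup>\<dagger>" unfolding B_def using unitary_conj_solve W Suc.prems by simp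
    then show ?thesis using W(1) V by (simp add: VD[symmetric] dagger_mult mult_assoc_dim)
  qed
  moreover have "(W * V)\<^sup>\<dagger> * (W * V) = 1\<^sub>m (Suc n)"
  proof -
    have "(W * V)\<^sup>\<dagger> * (W * V) = V\<^sup>\<dagger> * (W\<^sup>\<dagger> * W) * V" using W(1) V by (simp add: dagger_mult mult_assoc_dim)
    then show ?thesis using W(2) VV V by simp
  qed
  ultimately show ?case using W(1) V by (intro exI[of _ "W * V"] exI[of _ d']) auto
qed

text \<open>The eigenvalues are the values of the quadratic form at the columns of \<open>U\<close>,
  hence real and nonnegative.\<close>

lemma psd_spectral:
  assumes "psd n A"
  shows "\<exists>U r. U \<in> carrier_mat n n \<and> U\<^sup>\<dagger> * U = 1\<^sub>m n \<and> (\<forall>i<n. 0 \<le> (r i :: real)) \<and>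
    A = U * diagm n (\<lambda>i. of_real (r i)) * U\<^sup>\<dagger>"
proof -
  have A: "A \<in> carrier_mat n n" using assms by (simp add: psd_def)
  obtain U d where U: "U \<in> carrier_mat n n" "U\<^sup>\<dagger> * U = 1\<^sub>m n" and AU: "A = U * diagm n d * U\<^sup>\<dagger>"
    using hermitian_spectral[OF A psd_hermitian[OF assms]] by blast
  have "U\<^sup>\<dagger> * (A * U) = (U\<^sup>\<dagger> * U) * diagm n d * (U\<^sup>\<dagger> * U)"
    unfolding AU using U(1) by (simp add: mult_assoc_dim)
  then have D: "U\<^sup>\<dagger> * (A * U) = diagm n d" unfolding U(2) by simp
  have "0 \<le> d i" if i: "i < n" for i
  proof -
    have "col U i \<in> carrier_vec n" using U(1) by (intro carrier_vecI) simp
    then have "0 \<le> (A *\<^sub>v col U i) \<bullet>c col U i" using assms unfolding psd_def by blast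
    also have "(A *\<^sub>v col U i) \<bullet>c col U i = (\<Sum>k<n. (A * U) $$ (k, i) * cnj (U $$ (k, i)))"
      using U(1) A i by (simp add: scalar_prod_def atLeast0LessThan)
    also have "\<dots> = (U\<^sup>\<dagger> * (A * U)) $$ (i, i)"
      using U(1) A i by (subst index_mult_sum) (auto simp: mult.commute simp del: index_mult_mat(1) intro!: sum.cong)
    finally show ?thesis using i by (simp add: D diagm_def)
  qed
  then have d: "d i = of_real (Re (d i)) \<and> 0 \<le> Re (d i)" if "i < n" for i
    using that by (auto simp: less_eq_complex_def complex_eq_iff)
  then have "diagm n d = diagm n (\<lambda>i. of_real (Re (d i)))" by (intro eq_matI) (auto simp: diagm_def)
  with AU U d show ?thesis by (intro exI[of _ U] exI[of _ "\<lambda>i. Re (d i)"]) auto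
qed

lemma conj_diagm_mult:
  assumes "U \<in> carrier_mat n n" "U\<^sup>\<dagger> * U = 1\<^sub>m n"
  shows "(U * diagm n a * U\<^sup>\<dagger>) * (U * diagm n b * U\<^sup>\<dagger>) = U * diagm n (\<lambda>i. a i * b i) * U\<^sup>\<dagger>"
proof -
  have "(U * diagm n a * U\<^sup>\<dagger>) * (U * diagm n b * U\<^sup>\<dagger>) = U * diagm n a * (U\<^sup>\<dagger> * U) * diagm n b * U\<^sup>\<dagger>"
    using assms(1) by (simp add: mult_assoc_dim)
  also have "\<dots> = U * (diagm n a * diagm n b) * U\<^sup>\<dagger>"
    unfolding assms(2) using assms(1) by (simp add: mult_assoc_dim)
  finally show ?thesis by (simp add: diagm_mult)
qed

section \<open>Positive square roots\<close>

lemma psd_sqrt_ex: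
  assumes "psd n A"
  shows "\<exists>B. psd n B \<and> B * B = A"
proof -
  obtain U r where U: "U \<in> carrier_mat n n" "U\<^sup>\<dagger> * U = 1\<^sub>m n" and r: "\<forall>i<n. 0 \<le> (r i :: real)"
    and A: "A = U * diagm n (\<lambda>i. of_real (r i)) * U\<^sup>\<dagger>"
    using psd_spectral[OF assms] by blast
  \<comment> \<open>With the fourth roots of the eigenvalues, the Gram matrix of \<open>G\<close> is
    the square root of \<open>A\<close>, and its positivity comes from being a Gram matrix.\<close>
  define G where "G = U * diagm n (\<lambda>i. of_real (sqrt (sqrt (r i))))"
  have G: "G * G\<^sup>\<dagger> = U * diagm n (\<lambda>i. of_real (sqrt (sqrt (r i)) * sqrt (sqrt (r i)))) * U\<^sup>\<dagger>"
  proof -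
    have "G * G\<^sup>\<dagger> = U * (diagm n (\<lambda>i. of_real (sqrt (sqrt (r i)))) * diagm n (\<lambda>i. of_real (sqrt (sqrt (r i))))) * U\<^sup>\<dagger>"
      using U(1) by (simp add: G_def dagger_mult mult_assoc_dim diagm_dagger)
    then show ?thesis by (simp only: diagm_mult of_real_mult)
  qed
  have "psd n (G * G\<^sup>\<dagger>)" using U(1) by (intro psd_mult_dagger(1)[of _ _ n]) (auto simp: G_def)
  moreover have "(G * G\<^sup>\<dagger>) * (G * G\<^sup>\<dagger>) = A"
  proof -
    have "diagm n (\<lambda>i. complex_of_real (sqrt (sqrt (r i)) * sqrt (sqrt (r i))) * complex_of_real (sqrt (sqrt (r i)) * sqrt (sqrt (r i))))
        = diagm n (\<lambda>i. of_real (r i))"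
      using r by (intro eq_matI) (auto simp: diagm_def simp flip: of_real_mult)
    then show ?thesis unfolding G conj_diagm_mult[OF U] A by simp
  qed
  ultimately show ?thesis by blast
qed

lemma psd_sqrt:
  assumes "psd n A"
  shows "psd n (psd_sqrt A)" "psd_sqrt A * psd_sqrt A = A"
proof -
  have "dim_row A = n" using assms by (auto simp: psd_def)
  then have "psd n (psd_sqrt A) \<and> psd_sqrt A * psd_sqrt A = A"
    unfolding psd_sqrt_def using someI_ex[OF psd_sqrt_ex[OF assms]] by simp
  then show "psd n (psd_sqrt A)" "psd_sqrt A * psd_sqrt A = A" by auto
qed

lemma mult_dagger_index:
  assumes "X \<in> carrier_mat n m" "Y \<in> carrier_mat n m" "i < n" "j < n"
  shows "(X * Y\<^sup>\<dagger>) $$ (i, j) = (\<Sum>k<m. X $$ (i, k) * cnj (Y $$ (j, k)))"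
  using assms by (subst index_mult_sum) (auto intro!: sum.cong)

text \<open>The common value \<open>S\<close> makes the rows of \<open>X - Y\<close> vanish.\<close>

lemma eq_if_same_gram:
  assumes X: "X \<in> carrier_mat n m" and Y: "Y \<in> carrier_mat n m"
    and "X * X\<^sup>\<dagger> = S" "X * Y\<^sup>\<dagger> = S" "Y * X\<^sup>\<dagger> = S" "Y * Y\<^sup>\<dagger> = S"
  shows "X = Y"
proof (intro eq_matI)
  fix i j assume "i < dim_row Y" "j < dim_col Y"
  then have ij: "i < n" "j < m" using Y by auto
  have "complex_of_real (\<Sum>k<m. (cmod (X $$ (i, k) - Y $$ (i, k)))\<^sup>2) =
      (\<Sum>k<m. X $$ (i, k) * cnj (X $$ (i, k))) - (\<Sum>k<m. X $$ (i, k) * cnj (Y $$ (i, k)))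
      - (\<Sum>k<m. Y $$ (i, k) * cnj (X $$ (i, k))) + (\<Sum>k<m. Y $$ (i, k) * cnj (Y $$ (i, k)))"
    unfolding of_real_sum complex_norm_square by (simp add: algebra_simps sum.distrib sum_subtractf)
  also have "\<dots> = 0" 
    using mult_dagger_index[OF X X ij(1) ij(1)] mult_dagger_index[OF X Y ij(1) ij(1)]
      mult_dagger_index[OF Y X ij(1) ij(1)] mult_dagger_index[OF Y Y ij(1) ij(1)] assms(3-6) by simp
  finally have "(\<Sum>k<m. (cmod (X $$ (i, k) - Y $$ (i, k)))\<^sup>2) = 0" by (simp only: of_real_eq_0_iff)
  then show "X $$ (i, j) = Y $$ (i, j)" using ij(2) by (subst (asm) sum_nonneg_eq_0_iff) auto
qed (use X Y in auto)

section \<open>Contractions and partial isometries\<close>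

definition contraction :: "complex mat \<Rightarrow> bool" where
  "contraction C \<longleftrightarrow> (\<forall>v \<in> carrier_vec (dim_col C). norm2 (C *\<^sub>v v) \<le> norm2 v)"

lemma contraction_mult:
  assumes "contraction A" "contraction B" "dim_col A = dim_row B"
  shows "contraction (A * B)"
  unfolding contraction_def
proof
  fix v :: "complex vec" assume v: "v \<in> carrier_vec (dim_col (A * B))"
  then have "(A * B) *\<^sub>v v = A *\<^sub>v (B *\<^sub>v v)"
    using assms(3) by (intro assoc_mult_mat_vec[of _ "dim_row A" "dim_col A" _ "dim_col B"]) auto
  moreover have "norm2 (A *\<^sub>v (B *\<^sub>v v)) \<le> norm2 (B *\<^sub>v v)"
    using assms(1,3) unfolding contraction_def by (metis carrier_vecI dim_mult_mat_vec)
  moreover have "norm2 (B *\<^sub>v v) \<le> norm2 v" using assms(2) v unfolding contraction_def by auto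
  ultimately show "norm2 ((A * B) *\<^sub>v v) \<le> norm2 v" by simp
qed

text \<open>\<open>C\<^sup>\<dagger> * C\<close> is a projection \<open>P\<close>, so the loss of
  squared norm under \<open>C\<close> is the quadratic form of the complementary projection
  \<open>Q\<close>. This is nonnegative because \<open>Q\<close> is its own Gram matrix.\<close>

lemma partial_isometry_contraction:
  assumes P: "(C\<^sup>\<dagger> * C) * (C\<^sup>\<dagger> * C) = C\<^sup>\<dagger> * C"
  shows "contraction C"
  unfolding contraction_def
proof
  fix v :: "complex vec" assume v: "v \<in> carrier_vec (dim_col C)"
  define P where "P = C\<^sup>\<dagger> * C"
  define k where "k = dim_col C"
  have Pc: "P \<in> carrier_mat k k" by (auto simp: P_def k_def)
  have Ph: "P\<^sup>\<dagger> = P" by (simp add: P_def dagger_mult)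
  have PP: "P * P = P" using P by (simp add: P_def)
  define Q where "Q = 1\<^sub>m k - P"
  have Q: "Q \<in> carrier_mat k k" using Pc by (auto simp: Q_def)
  have vk: "v \<in> carrier_vec k" using v by (simp add: k_def)
  have "Q\<^sup>\<dagger> = Q" unfolding Q_def using Pc by (subst dagger_minus) (auto simp: Ph)
  moreover have "Q * Q = Q"
  proof -
    have "Q * Q = Q * 1\<^sub>m k - Q * P" unfolding Q_def
      by (rule mult_minus_distrib_mat[of _ k k _ k]) (use Pc in auto)
    also have "Q * P = 1\<^sub>m k * P - P * P" unfolding Q_def
      by (rule minus_mult_distrib_mat[of _ k k _ _ k]) (use Pc in auto)
    also have "\<dots> = 0\<^sub>m k k" using Pc by (simp add: PP)
    finally show ?thesis using Q by auto
  qed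
  ultimately have QQ: "Q * Q\<^sup>\<dagger> = Q" by simp
  have "(Q *\<^sub>v v) \<bullet>c v = of_real (norm2 (Q\<^sup>\<dagger> *\<^sub>v v))"
    using psd_mult_dagger(2)[OF Q vk] unfolding QQ .
  moreover have "Q *\<^sub>v v = v - P *\<^sub>v v"
    unfolding Q_def using Pc vk by (subst minus_mult_distrib_mat_vec[of _ k k]) auto
  moreover have "(v - P *\<^sub>v v) \<bullet>c v = v \<bullet>c v - (P *\<^sub>v v) \<bullet>c v"
    by (rule minus_scalar_prod_distrib[of _ k]) (use Pc vk in auto)
  moreover have "(P *\<^sub>v v) \<bullet>c v = of_real (norm2 (C *\<^sub>v v))"
    using psd_mult_dagger(2)[of "C\<^sup>\<dagger>" k "dim_row C" v] vk by (auto simp: P_def k_def)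
  ultimately have "complex_of_real (norm2 (Q\<^sup>\<dagger> *\<^sub>v v)) = of_real (norm2 v - norm2 (C *\<^sub>v v))"
    by (simp add: cscalar_self)
  then have "norm2 (Q\<^sup>\<dagger> *\<^sub>v v) = norm2 v - norm2 (C *\<^sub>v v)" by (simp only: of_real_eq_iff)
  then show "norm2 (C *\<^sub>v v) \<le> norm2 v" using norm2_ge0[of "Q\<^sup>\<dagger> *\<^sub>v v"] by simp
qed

text \<open>The matrices \<open>C\<^sup>\<dagger>\<close> and
  \<open>C\<^sup>\<dagger> * C * C\<^sup>\<dagger>\<close> have all four mutual Gram matrices equal
  to \<open>C\<^sup>\<dagger> * C\<close> and therefore coincide; multiplying by \<open>C\<close>
  from the left gives the claim.\<close>

lemma partial_isometry_dagger:
  assumes P: "(C\<^sup>\<dagger> * C) * (C\<^sup>\<dagger> * C) = C\<^sup>\<dagger> * C"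
  shows "(C * C\<^sup>\<dagger>) * (C * C\<^sup>\<dagger>) = C * C\<^sup>\<dagger>"
proof -
  have P': "C\<^sup>\<dagger> * (C * (C\<^sup>\<dagger> * C)) = C\<^sup>\<dagger> * C" using P by (simp add: mult_assoc_dim)
  have "C\<^sup>\<dagger> = C\<^sup>\<dagger> * C * C\<^sup>\<dagger>"
    by (rule eq_if_same_gram[of _ "dim_col C" "dim_row C" _ "C\<^sup>\<dagger> * C"])
      (auto simp: dagger_mult mult_assoc_dim P')
  then have "C * (C\<^sup>\<dagger> * C * C\<^sup>\<dagger>) = C * C\<^sup>\<dagger>" by simp
  then show ?thesis by (simp add: mult_assoc_dim)
qed

text \<open>Two purifications of the same operator differ by a partial isometry on the environment.
  This replaces a polar decomposition and works for rectangular matrices: \<open>V\<close> is built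
  from a pseudo-inverse of the common Gram matrix \<open>S\<close>.\<close>

lemma same_gram_factor:
  assumes P: "P \<in> carrier_mat d k" and G: "G \<in> carrier_mat d l" and eq: "P * P\<^sup>\<dagger> = G * G\<^sup>\<dagger>"
  shows "\<exists>V \<in> carrier_mat l k. P = G * V \<and> contraction V \<and> contraction (V\<^sup>\<dagger>)"
proof -
  define S where "S = G * G\<^sup>\<dagger>"
  have "psd d S" unfolding S_def by (rule psd_mult_dagger[OF G])
  then obtain U r where U: "U \<in> carrier_mat d d" "U\<^sup>\<dagger> * U = 1\<^sub>m d"
    and S: "S = U * diagm d (\<lambda>i. of_real (r i)) * U\<^sup>\<dagger>"
    using psd_spectral by blast
  \<comment> \<open>Since \<open>inverse 0 = 0\<close>, this is the Moore-Penrose inverse of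
    \<open>S\<close>, also when \<open>S\<close> is singular.\<close>
  define T where "T = U * diagm d (\<lambda>i. of_real (inverse (r i))) * U\<^sup>\<dagger>"
  have dims: "T \<in> carrier_mat d d" "S \<in> carrier_mat d d" using U G by (auto simp: T_def S_def)
  have Th: "T\<^sup>\<dagger> = T" using U(1) by (simp add: T_def dagger_mult mult_assoc_dim diagm_dagger)
  have Sh: "S\<^sup>\<dagger> = S" by (simp add: S_def dagger_mult)
  have ri: "of_real (r i) * (of_real (inverse (r i)) * complex_of_real (r i)) = of_real (r i)"
    "of_real (inverse (r i)) * (of_real (r i) * of_real (inverse (r i))) = complex_of_real (inverse (r i))" for i
    by (cases "r i = 0"; simp)+
  have STS: "S * (T * S) = S" and TST: "T * (S * T) = T"
    unfolding S T_def conj_diagm_mult[OF U] ri by auto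
  have STS': "S * (T * (S * X)) = S * X" if "dim_row X = d" for X
    using STS dims that by (metis (no_types, lifting) carrier_matD index_mult_mat(2,3) mult_assoc_dim)
  have TST': "T * (S * (T * X)) = T * X" if "dim_row X = d" for X
    using TST dims that by (metis (no_types, lifting) carrier_matD index_mult_mat(2,3) mult_assoc_dim)
  have PP: "P * P\<^sup>\<dagger> = S" "P * (P\<^sup>\<dagger> * X) = S * X" if "dim_row X = d" for X
    using eq P that by (auto simp: S_def mult_assoc_dim[symmetric])
  have GG: "G * (G\<^sup>\<dagger> * X) = S * X" if "dim_row X = d" for X
    using G that by (auto simp: S_def mult_assoc_dim[symmetric])
  have P1: "P * P\<^sup>\<dagger> = S" using eq by (simp add: S_def)
  note ds = carrier_matD[OF P] carrier_matD[OF G] carrier_matD[OF dims(1)] carrier_matD[OF dims(2)]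
  define V where "V = G\<^sup>\<dagger> * (T * P)"
  have V: "V \<in> carrier_mat l k" using P G by (auto simp: V_def)
  \<comment> \<open>\<open>S * T\<close> is the projection onto the range of \<open>S\<close>, which
    is the range of \<open>P\<close> as well; the equality is checked through Gram matrices.\<close>
  have "P = S * (T * P)"
    by (rule eq_if_same_gram[of _ d k _ S])
      (use P dims in \<open>auto simp: dagger_mult mult_assoc_dim PP P1 Th Sh STS STS' ds\<close>)
  also have "\<dots> = G * V" using P G by (simp add: V_def GG mult_assoc_dim ds)
  finally have 1: "P = G * V" .
  have VV: "V * V\<^sup>\<dagger> = G\<^sup>\<dagger> * (T * G)"
    by (simp add: V_def dagger_mult mult_assoc_dim ds Th PP TST')
  have "(V * V\<^sup>\<dagger>) * (V * V\<^sup>\<dagger>) = V * V\<^sup>\<dagger>"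
    unfolding VV by (simp add: mult_assoc_dim ds GG TST')
  then have id: "((V\<^sup>\<dagger>)\<^sup>\<dagger> * V\<^sup>\<dagger>) * ((V\<^sup>\<dagger>)\<^sup>\<dagger> * V\<^sup>\<dagger>) = (V\<^sup>\<dagger>)\<^sup>\<dagger> * V\<^sup>\<dagger>" by simp
  have "contraction (V\<^sup>\<dagger>)" by (rule partial_isometry_contraction[OF id])
  moreover have "contraction V"
    using partial_isometry_dagger[OF id] by (intro partial_isometry_contraction) simp
  ultimately show ?thesis using 1 V by blast
qed

section \<open>Trace, fidelity and Uhlmann's theorem\<close>

lemma mtrace_mult_commute:
  assumes "A \<in> carrier_mat n m" "B \<in> carrier_mat m n"
  shows "mtrace (A * B) = mtrace (B * A)"
proof -
  have "mtrace (A * B) = (\<Sum>i<n. \<Sum>k<m. A $$ (i, k) * B $$ (k, i))"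
    using assms unfolding mtrace_def by (auto simp: index_mult_sum simp del: index_mult_mat(1) intro!: sum.cong)
  also have "\<dots> = (\<Sum>k<m. \<Sum>i<n. A $$ (i, k) * B $$ (k, i))" by (rule sum.swap)
  also have "\<dots> = mtrace (B * A)"
    using assms unfolding mtrace_def
    by (auto simp: index_mult_sum mult.commute simp del: index_mult_mat(1) intro!: sum.cong)
  finally show ?thesis .
qed

lemma psd_mtrace:
  assumes "psd n A"
  shows "0 \<le> Re (mtrace A)"
proof -
  obtain B where B: "psd n B" "B * B = A" using psd_sqrt_ex[OF assms] by blast
  have Bc: "B \<in> carrier_mat n n" using B by (simp add: psd_def)
  have "Re (A $$ (i, i)) \<ge> 0" if i: "i < n" for i
  proof -
    have "A $$ (i, i) = (\<Sum>k<n. B $$ (i, k) * cnj (B $$ (i, k)))"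
      using mult_dagger_index[OF Bc Bc i i] B(2) psd_hermitian[OF B(1)] by simp
    then show ?thesis by (simp add: sum_nonneg)
  qed
  then show ?thesis using assms by (auto simp: mtrace_def psd_def intro!: sum_nonneg)
qed

lemma psd_conj:
  assumes "psd n S" "A \<in> carrier_mat m n"
  shows "psd m (A * S * A\<^sup>\<dagger>)"
proof -
  obtain B where B: "psd n B" "B * B = S" using psd_sqrt_ex[OF assms(1)] by blast
  have Bc: "B \<in> carrier_mat n n" using B by (simp add: psd_def)
  have "A * S * A\<^sup>\<dagger> = (A * B) * (A * B)\<^sup>\<dagger>"
    using assms(2) Bc psd_hermitian[OF B(1)] by (simp add: B(2)[symmetric] dagger_mult mult_assoc_dim)
  then show ?thesis using assms(2) Bc psd_mult_dagger(1)[of "A * B" m n] by simp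
qed

lemma fidelity_nonneg:
  assumes "psd n \<rho>" "psd n \<sigma>"
  shows "0 \<le> fidelity \<rho> \<sigma>"
proof -
  let ?r = "psd_sqrt \<rho>"
  have r: "psd n ?r" by (rule psd_sqrt[OF assms(1)])
  have "psd n (?r * \<sigma> * ?r)" using psd_conj[OF assms(2), of ?r n] r psd_hermitian[OF r] by (simp add: psd_def)
  then show ?thesis unfolding fidelity_def by (intro psd_mtrace[of n] psd_sqrt)
qed

text \<open>With \<open>r\<close> the root of \<open>M * M\<^sup>\<dagger>\<close>, the fidelity is
  the trace of the root \<open>T\<close> of the Gram matrix of \<open>r * N\<close>. Comparing Gram
  matrices twice gives \<open>T = r * N * V\<close> and \<open>r = M * V'\<close> with contractions,
  and cyclicity of the trace collects them into \<open>W = V' * V\<^sup>\<dagger>\<close>. The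
  numbers of columns \<open>k\<close> and \<open>l\<close> may differ because \<open>W\<close> is
  only a contraction.\<close>

theorem uhlmann:
  assumes M: "M \<in> carrier_mat d k" and N: "N \<in> carrier_mat d l"
  shows "\<exists>W \<in> carrier_mat k l. contraction (W\<^sup>\<dagger>) \<and> fidelity (M * M\<^sup>\<dagger>) (N * N\<^sup>\<dagger>) = Re (mtrace (M * W * N\<^sup>\<dagger>))"
proof -
  define r where "r = psd_sqrt (M * M\<^sup>\<dagger>)"
  have r: "psd d r" "r * r = M * M\<^sup>\<dagger>" unfolding r_def by (rule psd_sqrt[OF psd_mult_dagger(1)[OF M]])+
  have rc: "r \<in> carrier_mat d d" and rh: "r\<^sup>\<dagger> = r" using r psd_hermitian[OF r(1)] by (auto simp: psd_def)
  define T where "T = psd_sqrt (r * (N * N\<^sup>\<dagger>) * r)"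
  have "psd d (r * (N * N\<^sup>\<dagger>) * r)"
    using psd_conj[OF psd_mult_dagger(1)[OF N] rc] by (simp add: rh)
  from psd_sqrt[OF this] have T: "psd d T" "T * T = r * (N * N\<^sup>\<dagger>) * r" by (simp_all add: T_def)
  have Tc: "T \<in> carrier_mat d d" and Th: "T\<^sup>\<dagger> = T" using T psd_hermitian[OF T(1)] by (auto simp: psd_def)
  have "T * T\<^sup>\<dagger> = (r * N) * (r * N)\<^sup>\<dagger>" using rc N by (simp add: Th T(2) dagger_mult mult_assoc_dim rh)
  then obtain V where V: "V \<in> carrier_mat l d" "T = r * N * V" "contraction V"
    using same_gram_factor[OF Tc, of "r * N" l] rc N by auto
  have "r * r\<^sup>\<dagger> = M * M\<^sup>\<dagger>" by (simp add: rh r(2))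
  then obtain V' where V': "V' \<in> carrier_mat k d" "r = M * V'" "contraction (V'\<^sup>\<dagger>)"
    using same_gram_factor[OF rc M] by blast
  have "fidelity (M * M\<^sup>\<dagger>) (N * N\<^sup>\<dagger>) = Re (mtrace T)" by (simp add: fidelity_def T_def r_def)
  also have "T = V\<^sup>\<dagger> * N\<^sup>\<dagger> * (M * V')"
  proof -
    have "T = (r * N * V)\<^sup>\<dagger>" using V(2) Th by simp
    also have "\<dots> = V\<^sup>\<dagger> * N\<^sup>\<dagger> * r" using rc N V(1) by (simp add: dagger_mult mult_assoc_dim rh)
    finally show ?thesis by (simp add: V'(2))
  qed
  also have "mtrace (V\<^sup>\<dagger> * N\<^sup>\<dagger> * (M * V')) = mtrace ((M * V') * (V\<^sup>\<dagger> * N\<^sup>\<dagger>))"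
    using V V' M N by (intro mtrace_mult_commute[of _ d d]) auto
  also have "(M * V') * (V\<^sup>\<dagger> * N\<^sup>\<dagger>) = M * (V' * V\<^sup>\<dagger>) * N\<^sup>\<dagger>"
    using V(1) V'(1) M N by (simp add: mult_assoc_dim)
  finally have F: "fidelity (M * M\<^sup>\<dagger>) (N * N\<^sup>\<dagger>) = Re (mtrace (M * (V' * V\<^sup>\<dagger>) * N\<^sup>\<dagger>))" .
  have "contraction ((V' * V\<^sup>\<dagger>)\<^sup>\<dagger>)"
    using V V' by (simp add: dagger_mult contraction_mult)
  with F show ?thesis using V(1) V'(1) by (intro bexI[of _ "V' * V\<^sup>\<dagger>"]) auto
qed

text \<open>The columns of the purifications become families over arbitrary finite index sets, which
  are later sets of Kraus indices. The inequality says that the transpose of \<open>W\<close> is a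
  contraction; in this form it bounds the outcome weights when \<open>W\<close> is used as a
  measurement.\<close>

theorem uhlmann_family:
  fixes m :: "'i \<Rightarrow> nat \<Rightarrow> complex" and n :: "'j \<Rightarrow> nat \<Rightarrow> complex"
  assumes fin: "finite I" "finite J" and \<rho>: "\<rho> \<in> carrier_mat d d" and \<sigma>: "\<sigma> \<in> carrier_mat d d"
    and \<rho>m: "\<And>x y. x < d \<Longrightarrow> y < d \<Longrightarrow> \<rho> $$ (x, y) = (\<Sum>a\<in>I. m a x * cnj (m a y))"
    and \<sigma>n: "\<And>x y. x < d \<Longrightarrow> y < d \<Longrightarrow> \<sigma> $$ (x, y) = (\<Sum>b\<in>J. n b x * cnj (n b y))"
  shows "0 \<le> fidelity \<rho> \<sigma>"
    and "\<exists>W. (\<forall>g. (\<Sum>b\<in>J. (cmod (\<Sum>a\<in>I. g a * W a b))\<^sup>2) \<le> (\<Sum>a\<in>I. (cmod (g a))\<^sup>2)) \<and>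
      fidelity \<rho> \<sigma> = Re (\<Sum>x<d. \<Sum>b\<in>J. (\<Sum>a\<in>I. m a x * W a b) * cnj (n b x))"
proof -
  obtain h where h: "bij_betw h {..<card I} I" using ex_bij_betw_nat_finite[OF fin(1)] by (auto simp: atLeast0LessThan)
  obtain h' where h': "bij_betw h' {..<card J} J" using ex_bij_betw_nat_finite[OF fin(2)] by (auto simp: atLeast0LessThan)
  have sI: "(\<Sum>a\<in>I. g a) = (\<Sum>a<card I. g (h a))" for g :: "'i \<Rightarrow> 'x::comm_monoid_add"
    using sum.reindex_bij_betw[OF h, of g] by simp
  have sJ: "(\<Sum>b\<in>J. g b) = (\<Sum>b<card J. g (h' b))" for g :: "'j \<Rightarrow> 'x::comm_monoid_add"
    using sum.reindex_bij_betw[OF h', of g] by simp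
  define M where "M = mat d (card I) (\<lambda>(x, a). m (h a) x)"
  define N where "N = mat d (card J) (\<lambda>(x, b). n (h' b) x)"
  have M: "M \<in> carrier_mat d (card I)" and N: "N \<in> carrier_mat d (card J)" by (simp_all add: M_def N_def)
  have \<rho>M: "\<rho> = M * M\<^sup>\<dagger>"
    using \<rho> M by (intro eq_matI; (subst mult_dagger_index[OF M M])?) (auto simp: \<rho>m sI M_def)
  have \<sigma>N: "\<sigma> = N * N\<^sup>\<dagger>"
    using \<sigma> N by (intro eq_matI; (subst mult_dagger_index[OF N N])?) (auto simp: \<sigma>n sJ N_def)
  show "0 \<le> fidelity \<rho> \<sigma>" unfolding \<rho>M \<sigma>N by (intro fidelity_nonneg[of d] psd_mult_dagger(1)[OF M] psd_mult_dagger(1)[OF N])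
  obtain W where W: "W \<in> carrier_mat (card I) (card J)" "contraction (W\<^sup>\<dagger>)"
    and F: "fidelity \<rho> \<sigma> = Re (mtrace (M * W * N\<^sup>\<dagger>))"
    using uhlmann[OF M N] unfolding \<rho>M \<sigma>N by blast
  define W' where "W' a b = W $$ (the_inv_into {..<card I} h a, the_inv_into {..<card J} h' b)" for a b
  have W': "W' (h a) (h' b) = W $$ (a, b)" if "a < card I" "b < card J" for a b
    using that h h' by (simp add: W'_def the_inv_into_f_f bij_betw_def)
  have "(\<Sum>b\<in>J. (cmod (\<Sum>a\<in>I. g a * W' a b))\<^sup>2) \<le> (\<Sum>a\<in>I. (cmod (g a))\<^sup>2)" for g
  proof -
    \<comment> \<open>The conjugation turns the adjoint of \<open>W\<close> into its transpose
      without changing norms.\<close>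
    define v where "v = vec (card I) (\<lambda>a. cnj (g (h a)))"
    have "norm2 (W\<^sup>\<dagger> *\<^sub>v v) \<le> norm2 v" using W by (auto simp: contraction_def v_def)
    also have "norm2 v = (\<Sum>a\<in>I. (cmod (g a))\<^sup>2)" by (simp add: norm2_def v_def sI)
    also have "norm2 (W\<^sup>\<dagger> *\<^sub>v v) = (\<Sum>b<card J. (cmod (\<Sum>a<card I. g (h a) * W' (h a) (h' b)))\<^sup>2)"
    proof -
      have "(W\<^sup>\<dagger> *\<^sub>v v) $ b = cnj (\<Sum>a<card I. g (h a) * W' (h a) (h' b))" if b: "b < card J" for b
        using W(1) b by (subst mult_mat_vec_sum) (auto simp: v_def W' mult.commute intro!: sum.cong)
      then show ?thesis using W(1) by (simp add: norm2_def del: index_mult_mat_vec cnj_sum)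
    qed
    finally show ?thesis by (simp add: sI sJ)
  qed
  moreover have "mtrace (M * W * N\<^sup>\<dagger>) = (\<Sum>x<d. \<Sum>b\<in>J. (\<Sum>a\<in>I. m a x * W' a b) * cnj (n b x))"
  proof -
    have "M * W \<in> carrier_mat d (card J)" using M W by auto
    note * = mult_dagger_index[OF this N]
    have "mtrace (M * W * N\<^sup>\<dagger>) = (\<Sum>x<d. \<Sum>b<card J. (M * W) $$ (x, b) * cnj (N $$ (x, b)))"
      unfolding mtrace_def using M W by (intro sum.cong) (auto simp: * simp del: index_mult_mat(1))
    also have "\<dots> = (\<Sum>x<d. \<Sum>b<card J. (\<Sum>a<card I. m (h a) x * W' (h a) (h' b)) * cnj (n (h' b) x))"
      using M N W by (intro sum.cong refl arg_cong2[of _ _ _ _ "(*)"])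
        (auto simp: index_mult_sum W' M_def N_def simp del: index_mult_mat(1))
    finally show ?thesis by (simp add: sI sJ)
  qed
  ultimately show "\<exists>W. (\<forall>g. (\<Sum>b\<in>J. (cmod (\<Sum>a\<in>I. g a * W a b))\<^sup>2) \<le> (\<Sum>a\<in>I. (cmod (g a))\<^sup>2)) \<and>
      fidelity \<rho> \<sigma> = Re (\<Sum>x<d. \<Sum>b\<in>J. (\<Sum>a\<in>I. m a x * W a b) * cnj (n b x))"
    using F by (intro exI[of _ W']) simp
qed

section \<open>Kraus families\<close>

lemma index_less_mult: "i < m \<Longrightarrow> k < n \<Longrightarrow> i * n + k < m * (n::nat)"
proof -
  assume "i < m" "k < n"
  then have "i * n + k < Suc i * n" "Suc i * n \<le> m * n" by (simp, intro mult_le_mono1, simp)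
  then show ?thesis by (rule less_le_trans)
qed

lemma sum_lessThan_mult:
  "(\<Sum>z<m * n. g z) = (\<Sum>i<m. \<Sum>k<(n::nat). g (i * n + k))"
proof -
  have "(\<Sum>k<n. g (i * n + k)) = sum g {i * n..<i * n + n}" for i
    using sum.shift_bounds_nat_ivl[of g 0 "i * n" n] by (simp add: atLeast0LessThan add.commute)
  then show ?thesis by (simp add: sum.nat_group)
qed

lemma sum_swap3:
  "(\<Sum>a\<in>A. \<Sum>b\<in>B. \<Sum>i\<in>C. g a b i) = (\<Sum>i\<in>C. \<Sum>a\<in>A. \<Sum>b\<in>B. g a b i)"
proof -
  have "(\<Sum>a\<in>A. \<Sum>b\<in>B. \<Sum>i\<in>C. g a b i) = (\<Sum>a\<in>A. \<Sum>i\<in>C. \<Sum>b\<in>B. g a b i)"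
    by (rule sum.cong[OF refl sum.swap])
  also have "\<dots> = (\<Sum>i\<in>C. \<Sum>a\<in>A. \<Sum>b\<in>B. g a b i)" by (rule sum.swap)
  finally show ?thesis .
qed

lemma sum_of_bool:
  fixes g :: "'a \<Rightarrow> complex"
  assumes "finite A" "i \<in> A"
  shows "(\<Sum>k\<in>A. of_bool (k = i) * g k) = g i" "(\<Sum>k\<in>A. of_bool (i = k) * g k) = g i"
    "(\<Sum>k\<in>A. g k * of_bool (k = i)) = g i" "(\<Sum>k\<in>A. g k * of_bool (i = k)) = g i"
  using assms by (simp_all add: of_bool_def mult_delta_left mult_delta_right sum.delta sum.delta')

lemma dim_tensor [simp]: "dim_row (A \<otimes>\<^sub>m B) = dim_row A * dim_row B" "dim_col (A \<otimes>\<^sub>m B) = dim_col A * dim_col B"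
  by (simp_all add: tensor_mat_def)

lemma tensor_carrier [intro]:
  "A \<in> carrier_mat n m \<Longrightarrow> B \<in> carrier_mat n' m' \<Longrightarrow> A \<otimes>\<^sub>m B \<in> carrier_mat (n * n') (m * m')"
  by (intro carrier_matI) auto

lemma index_tensor:
  "i < dim_row A * dim_row B \<Longrightarrow> j < dim_col A * dim_col B \<Longrightarrow>
    (A \<otimes>\<^sub>m B) $$ (i, j) = A $$ (i div dim_row B, j div dim_col B) * B $$ (i mod dim_row B, j mod dim_col B)"
  by (simp add: tensor_mat_def)

lemma index_tensor':
  assumes "A \<in> carrier_mat n m" "B \<in> carrier_mat n' m'" "r < n" "s < n'" "i < m" "k < m'"
  shows "(A \<otimes>\<^sub>m B) $$ (r * n' + s, i * m' + k) = A $$ (r, i) * B $$ (s, k)"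
  using assms by (subst index_tensor) (auto simp: index_less_mult)

text \<open>A Kraus representation together with its completeness relation, which expresses trace
  preservation; both are written in entries. The index type is free, so that tensor products and
  compositions are indexed by pairs and can be renamed by \<open>kraus_reindex\<close>.\<close>

definition kraus :: "nat \<Rightarrow> nat \<Rightarrow> channel \<Rightarrow> 'i set \<Rightarrow> ('i \<Rightarrow> complex mat) \<Rightarrow> bool" where
  "kraus m n \<Lambda> I K \<longleftrightarrow> finite I \<and> idim \<Lambda> = m \<and> odim \<Lambda> = n \<and> (\<forall>a\<in>I. K a \<in> carrier_mat n m) \<and>
    (\<forall>\<rho>\<in>carrier_mat m m. app \<Lambda> \<rho> \<in> carrier_mat n n \<and>
      (\<forall>r<n. \<forall>s<n. app \<Lambda> \<rho> $$ (r, s) =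
        (\<Sum>a\<in>I. \<Sum>i<m. \<Sum>j<m. K a $$ (r, i) * \<rho> $$ (i, j) * cnj (K a $$ (s, j))))) \<and>
    (\<forall>i<m. \<forall>j<m. (\<Sum>a\<in>I. \<Sum>r<n. K a $$ (r, i) * cnj (K a $$ (r, j))) = of_bool (i = j))"

lemma krausD:
  assumes "kraus m n \<Lambda> I K"
  shows "finite I" "idim \<Lambda> = m" "odim \<Lambda> = n" "a \<in> I \<Longrightarrow> K a \<in> carrier_mat n m"
    "\<rho> \<in> carrier_mat m m \<Longrightarrow> app \<Lambda> \<rho> \<in> carrier_mat n n"
    "\<rho> \<in> carrier_mat m m \<Longrightarrow> r < n \<Longrightarrow> s < n \<Longrightarrow> app \<Lambda> \<rho> $$ (r, s) =
        (\<Sum>a\<in>I. \<Sum>i<m. \<Sum>j<m. K a $$ (r, i) * \<rho> $$ (i, j) * cnj (K a $$ (s, j)))"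
    "i < m \<Longrightarrow> j < m \<Longrightarrow> (\<Sum>a\<in>I. \<Sum>r<n. K a $$ (r, i) * cnj (K a $$ (r, j))) = of_bool (i = j)"
  using assms unfolding kraus_def by blast+

lemma matrix_unit_carrier [simp]: "matrix_unit d i j \<in> carrier_mat d d"
  by (simp add: matrix_unit_def ketbra_def)

lemma index_matrix_unit: "a < d \<Longrightarrow> b < d \<Longrightarrow> i < d \<Longrightarrow> j < d \<Longrightarrow>
    matrix_unit d i j $$ (a, b) = of_bool (a = i) * of_bool (b = j)"
  by (simp add: matrix_unit_def ketbra_def)

text \<open>The definition of \<open>tensor_channel\<close> expands its argument in matrix units, so
  their images are the link to Kraus families.\<close>

lemma kraus_matrix_unit:
  assumes "kraus m n \<Lambda> I K" "i < m" "j < m" "r < n" "s < n"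
  shows "app \<Lambda> (matrix_unit m i j) $$ (r, s) = (\<Sum>a\<in>I. K a $$ (r, i) * cnj (K a $$ (s, j)))"
proof -
  have "(\<Sum>i'<m. \<Sum>j'<m. K a $$ (r, i') * matrix_unit m i j $$ (i', j') * cnj (K a $$ (s, j'))) =
      K a $$ (r, i) * cnj (K a $$ (s, j))" for a
  proof -
    have "(\<Sum>i'<m. \<Sum>j'<m. K a $$ (r, i') * matrix_unit m i j $$ (i', j') * cnj (K a $$ (s, j'))) =
        (\<Sum>i'<m. of_bool (i' = i) * (\<Sum>j'<m. of_bool (j' = j) * (K a $$ (r, i') * cnj (K a $$ (s, j')))))"
      using assms by (intro sum.cong refl) (auto simp: index_matrix_unit sum_distrib_left mult_ac intro!: sum.cong)
    then show ?thesis using assms by (simp add: sum_of_bool)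
  qed
  then show ?thesis using krausD(6)[OF assms(1) matrix_unit_carrier assms(4,5)] by simp
qed

text \<open>Once every index is split into its two digits, both sides are the same multiple sum in a
  different order; the completeness relation factors into those of \<open>K\<close> and
  \<open>L\<close>.\<close>

lemma kraus_tensor:
  assumes K: "kraus m n \<Lambda> I K" and L: "kraus m' n' \<Gamma> J L"
  shows "kraus (m * m') (n * n') (\<Lambda> \<otimes>\<^sub>c \<Gamma>) (I \<times> J) (\<lambda>(a, b). K a \<otimes>\<^sub>m L b)"
  unfolding kraus_def
proof (intro conjI ballI allI impI)
  show "finite (I \<times> J)" using krausD(1)[OF K] krausD(1)[OF L] by simp
  note dims = krausD(2,3)[OF K] krausD(2,3)[OF L]
  show "idim (\<Lambda> \<otimes>\<^sub>c \<Gamma>) = m * m'" "odim (\<Lambda> \<otimes>\<^sub>c \<Gamma>) = n * n'" by (simp_all add: tensor_channel_def dims)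
  note Kc = krausD(4)[OF K] and Lc = krausD(4)[OF L]
  show "(case x of (a, b) \<Rightarrow> K a \<otimes>\<^sub>m L b) \<in> carrier_mat (n * n') (m * m')" if "x \<in> I \<times> J" for x
    using that Kc Lc by auto
  show "app (\<Lambda> \<otimes>\<^sub>c \<Gamma>) \<rho> \<in> carrier_mat (n * n') (n * n')" for \<rho> by (simp add: tensor_channel_def dims)
  show "app (\<Lambda> \<otimes>\<^sub>c \<Gamma>) \<rho> $$ (r, s) = (\<Sum>x\<in>I \<times> J. \<Sum>p<m * m'. \<Sum>q<m * m'.
      (case x of (a, b) \<Rightarrow> K a \<otimes>\<^sub>m L b) $$ (r, p) * \<rho> $$ (p, q) * cnj ((case x of (a, b) \<Rightarrow> K a \<otimes>\<^sub>m L b) $$ (s, q)))"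
    if rs: "r < n * n'" "s < n * n'" for \<rho> r s
  proof -
    define r1 r2 s1 s2 where "r1 = r div n'" "r2 = r mod n'" "s1 = s div n'" "s2 = s mod n'"
    have n': "n' > 0" using rs by (cases "n' = 0") auto
    have b: "r1 < n" "r2 < n'" "s1 < n" "s2 < n'"
      using rs n' by (auto simp: r1_r2_s1_s2_def less_mult_imp_div_less)
    have rr: "r = r1 * n' + r2" "s = s1 * n' + s2" by (simp_all add: r1_r2_s1_s2_def)
    let ?T = "\<lambda>a b i k j l. K a $$ (r1, i) * L b $$ (r2, k) * \<rho> $$ (i * m' + k, j * m' + l) *
        cnj (K a $$ (s1, j) * L b $$ (s2, l))"
    have car: "app \<Lambda> (matrix_unit m i j) \<in> carrier_mat n n" "app \<Gamma> (matrix_unit m' i j) \<in> carrier_mat n' n'" for i j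
      by (rule krausD(5)[OF K], simp, rule krausD(5)[OF L], simp)
    have "app (\<Lambda> \<otimes>\<^sub>c \<Gamma>) \<rho> $$ (r, s) = (\<Sum>i<m. \<Sum>j<m. \<Sum>k<m'. \<Sum>l<m'. \<rho> $$ (i * m' + k, j * m' + l) *
        (app \<Lambda> (matrix_unit m i j) \<otimes>\<^sub>m app \<Gamma> (matrix_unit m' k l)) $$ (r, s))"
      using rs by (simp add: tensor_channel_def dims)
    also have "\<dots> = (\<Sum>i<m. \<Sum>j<m. \<Sum>k<m'. \<Sum>l<m'. \<Sum>a\<in>I. \<Sum>b\<in>J. ?T a b i k j l)"
    proof (intro sum.cong refl)
      fix i j k l assume "i \<in> {..<m}" "j \<in> {..<m}" "k \<in> {..<m'}" "l \<in> {..<m'}"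
      then have i: "i < m" "j < m" "k < m'" "l < m'" by auto
      have e: "(app \<Lambda> (matrix_unit m i j) \<otimes>\<^sub>m app \<Gamma> (matrix_unit m' k l)) $$ (r, s) =
          (\<Sum>a\<in>I. K a $$ (r1, i) * cnj (K a $$ (s1, j))) * (\<Sum>b\<in>J. L b $$ (r2, k) * cnj (L b $$ (s2, l)))"
        unfolding rr using b i
        by (simp add: index_tensor'[OF car] kraus_matrix_unit[OF K] kraus_matrix_unit[OF L])
      show "\<rho> $$ (i * m' + k, j * m' + l) * (app \<Lambda> (matrix_unit m i j) \<otimes>\<^sub>m app \<Gamma> (matrix_unit m' k l)) $$ (r, s) =
          (\<Sum>a\<in>I. \<Sum>b\<in>J. ?T a b i k j l)"
        by (simp only: e[unfolded sum_product] sum_distrib_left) (simp only: mult_ac complex_cnj_mult)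
    qed
    also have "\<dots> = (\<Sum>i<m. \<Sum>k<m'. \<Sum>j<m. \<Sum>l<m'. \<Sum>a\<in>I. \<Sum>b\<in>J. ?T a b i k j l)"
      by (rule sum.cong[OF refl], rule sum.swap)
    also have "\<dots> = (\<Sum>i<m. \<Sum>k<m'. \<Sum>j<m. \<Sum>a\<in>I. \<Sum>b\<in>J. \<Sum>l<m'. ?T a b i k j l)"
      by (intro sum.cong refl sum_swap3[symmetric])
    also have "\<dots> = (\<Sum>i<m. \<Sum>k<m'. \<Sum>a\<in>I. \<Sum>b\<in>J. \<Sum>j<m. \<Sum>l<m'. ?T a b i k j l)"
      by (rule sum.cong[OF refl], rule sum.cong[OF refl], rule sum_swap3[symmetric])
    also have "\<dots> = (\<Sum>i<m. \<Sum>a\<in>I. \<Sum>b\<in>J. \<Sum>k<m'. \<Sum>j<m. \<Sum>l<m'. ?T a b i k j l)"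
      by (rule sum.cong[OF refl], rule sum_swap3[symmetric])
    also have "\<dots> = (\<Sum>a\<in>I. \<Sum>b\<in>J. \<Sum>i<m. \<Sum>k<m'. \<Sum>j<m. \<Sum>l<m'. ?T a b i k j l)"
      by (rule sum_swap3[symmetric])
    also have "\<dots> = (\<Sum>a\<in>I. \<Sum>b\<in>J. \<Sum>p<m * m'. \<Sum>q<m * m'.
      (K a \<otimes>\<^sub>m L b) $$ (r, p) * \<rho> $$ (p, q) * cnj ((K a \<otimes>\<^sub>m L b) $$ (s, q)))"
      unfolding sum_lessThan_mult rr using b
      by (intro sum.cong refl) (simp add: index_tensor'[OF Kc Lc])
    finally show ?thesis by (simp only: sum.cartesian_product' prod.case)
  qed
  show "(\<Sum>x\<in>I \<times> J. \<Sum>r<n * n'. (case x of (a, b) \<Rightarrow> K a \<otimes>\<^sub>m L b) $$ (r, p) *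
      cnj ((case x of (a, b) \<Rightarrow> K a \<otimes>\<^sub>m L b) $$ (r, q))) = of_bool (p = q)"
    if pq: "p < m * m'" "q < m * m'" for p q
  proof -
    define i k j l where "i = p div m'" "k = p mod m'" "j = q div m'" "l = q mod m'"
    have m': "m' > 0" using pq by (cases "m' = 0") auto
    have b: "i < m" "k < m'" "j < m" "l < m'"
      using pq m' by (auto simp: i_k_j_l_def less_mult_imp_div_less)
    have pp: "p = i * m' + k" "q = j * m' + l" by (simp_all add: i_k_j_l_def)
    have "(\<Sum>x\<in>I \<times> J. \<Sum>r<n * n'. (case x of (a, b) \<Rightarrow> K a \<otimes>\<^sub>m L b) $$ (r, p) *
        cnj ((case x of (a, b) \<Rightarrow> K a \<otimes>\<^sub>m L b) $$ (r, q))) =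
      (\<Sum>a\<in>I. \<Sum>b\<in>J. \<Sum>r<n. \<Sum>s<n'. (K a $$ (r, i) * cnj (K a $$ (r, j))) * (L b $$ (s, k) * cnj (L b $$ (s, l))))"
      unfolding sum_lessThan_mult pp sum.cartesian_product' prod.case using b
      by (intro sum.cong refl) (simp add: index_tensor'[OF Kc Lc] mult_ac)
    also have "\<dots> = (\<Sum>a\<in>I. \<Sum>r<n. K a $$ (r, i) * cnj (K a $$ (r, j))) * (\<Sum>b\<in>J. \<Sum>s<n'. L b $$ (s, k) * cnj (L b $$ (s, l)))"
      by (simp only: sum_product)
    also have "\<dots> = of_bool (i = j) * of_bool (k = l)"
      using krausD(7)[OF K b(1,3)] krausD(7)[OF L b(2,4)] by simp
    also have "\<dots> = of_bool (p = q)"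
      using b unfolding pp by (auto simp: of_bool_def) (metis b(2) b(4) add.commute div_mult_self3 div_less add_0 mod_less mod_mult_self3 not_less_zero neq0_conv)+
    finally show ?thesis .
  qed
qed

text \<open>The sums over the intermediate basis come from the matrix products and are moved
  outwards. For completeness, the relation of \<open>L\<close> collapses the two intermediate
  indices to one and the relation of \<open>K\<close> remains.\<close>

lemma kraus_comp:
  assumes K: "kraus m n \<Lambda> I K" and L: "kraus n p \<Gamma> J L"
  shows "kraus m p (\<Gamma> \<circ>\<^sub>c \<Lambda>) (I \<times> J) (\<lambda>(a, b). L b * K a)"
  unfolding kraus_def
proof (intro conjI ballI allI impI)
  show "finite (I \<times> J)" using krausD(1)[OF K] krausD(1)[OF L] by simp
  show "idim (\<Gamma> \<circ>\<^sub>c \<Lambda>) = m" "odim (\<Gamma> \<circ>\<^sub>c \<Lambda>) = p"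
    using krausD(2)[OF K] krausD(3)[OF L] by (simp_all add: comp_channel_def)
  note Kc = krausD(4)[OF K] and Lc = krausD(4)[OF L]
  show "(case x of (a, b) \<Rightarrow> L b * K a) \<in> carrier_mat p m" if "x \<in> I \<times> J" for x
    using that mult_carrier_mat[OF Lc Kc] by auto
  have idx: "(L b * K a) $$ (r, i) = (\<Sum>s<n. L b $$ (r, s) * K a $$ (s, i))"
    if "a \<in> I" "b \<in> J" "r < p" "i < m" for a b r i
    using Kc[OF that(1)] Lc[OF that(2)] that by (subst index_mult_sum) auto
  show "app (\<Gamma> \<circ>\<^sub>c \<Lambda>) \<rho> \<in> carrier_mat p p" if "\<rho> \<in> carrier_mat m m" for \<rho>
    using krausD(5)[OF L krausD(5)[OF K that]] by (simp add: comp_channel_def)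
  show "app (\<Gamma> \<circ>\<^sub>c \<Lambda>) \<rho> $$ (r, t) = (\<Sum>x\<in>I \<times> J. \<Sum>i<m. \<Sum>j<m.
      (case x of (a, b) \<Rightarrow> L b * K a) $$ (r, i) * \<rho> $$ (i, j) * cnj ((case x of (a, b) \<Rightarrow> L b * K a) $$ (t, j)))"
    if \<rho>: "\<rho> \<in> carrier_mat m m" and rt: "r < p" "t < p" for \<rho> r t
  proof -
    let ?T = "\<lambda>a b i j s s'. L b $$ (r, s) * (K a $$ (s, i) * \<rho> $$ (i, j) * cnj (K a $$ (s', j))) * cnj (L b $$ (t, s'))"
    have "(\<Sum>x\<in>I \<times> J. \<Sum>i<m. \<Sum>j<m. (case x of (a, b) \<Rightarrow> L b * K a) $$ (r, i) * \<rho> $$ (i, j) *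
        cnj ((case x of (a, b) \<Rightarrow> L b * K a) $$ (t, j))) =
      (\<Sum>a\<in>I. \<Sum>b\<in>J. \<Sum>i<m. \<Sum>j<m. (L b * K a) $$ (r, i) * \<rho> $$ (i, j) * cnj ((L b * K a) $$ (t, j)))"
      by (simp only: sum.cartesian_product' prod.case)
    also have "\<dots> = (\<Sum>a\<in>I. \<Sum>b\<in>J. \<Sum>i<m. \<Sum>j<m. \<Sum>s<n. \<Sum>s'<n. ?T a b i j s s')"
      using rt by (intro sum.cong refl)
        (simp add: idx sum_product sum_distrib_left sum_distrib_right mult_ac)
    also have "\<dots> = (\<Sum>a\<in>I. \<Sum>b\<in>J. \<Sum>s<n. \<Sum>i<m. \<Sum>j<m. \<Sum>s'<n. ?T a b i j s s')"
      by (rule sum.cong[OF refl], rule sum.cong[OF refl], rule sum_swap3)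
    also have "\<dots> = (\<Sum>a\<in>I. \<Sum>b\<in>J. \<Sum>s<n. \<Sum>s'<n. \<Sum>i<m. \<Sum>j<m. ?T a b i j s s')"
      by (rule sum.cong[OF refl], rule sum.cong[OF refl], rule sum.cong[OF refl], rule sum_swap3)
    also have "\<dots> = (\<Sum>b\<in>J. \<Sum>a\<in>I. \<Sum>s<n. \<Sum>s'<n. \<Sum>i<m. \<Sum>j<m. ?T a b i j s s')"
      by (rule sum.swap)
    also have "\<dots> = (\<Sum>b\<in>J. \<Sum>s<n. \<Sum>s'<n. \<Sum>a\<in>I. \<Sum>i<m. \<Sum>j<m. ?T a b i j s s')"
      by (rule sum.cong[OF refl], rule sum_swap3[symmetric])
    also have "\<dots> = (\<Sum>b\<in>J. \<Sum>s<n. \<Sum>s'<n. L b $$ (r, s) * app \<Lambda> \<rho> $$ (s, s') * cnj (L b $$ (t, s')))"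
      by (intro sum.cong refl) (simp add: krausD(6)[OF K \<rho>] sum_distrib_left sum_distrib_right)
    also have "\<dots> = app (\<Gamma> \<circ>\<^sub>c \<Lambda>) \<rho> $$ (r, t)"
      using krausD(6)[OF L krausD(5)[OF K \<rho>] rt] by (simp add: comp_channel_def)
    finally show ?thesis by simp
  qed
  show "(\<Sum>x\<in>I \<times> J. \<Sum>r<p. (case x of (a, b) \<Rightarrow> L b * K a) $$ (r, i) *
      cnj ((case x of (a, b) \<Rightarrow> L b * K a) $$ (r, j))) = of_bool (i = j)"
    if ij: "i < m" "j < m" for i j
  proof -
    let ?T = "\<lambda>a b r s s'. K a $$ (s, i) * cnj (K a $$ (s', j)) * (L b $$ (r, s) * cnj (L b $$ (r, s')))"
    have "(\<Sum>x\<in>I \<times> J. \<Sum>r<p. (case x of (a, b) \<Rightarrow> L b * K a) $$ (r, i) *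
        cnj ((case x of (a, b) \<Rightarrow> L b * K a) $$ (r, j))) =
      (\<Sum>a\<in>I. \<Sum>b\<in>J. \<Sum>r<p. (L b * K a) $$ (r, i) * cnj ((L b * K a) $$ (r, j)))"
      by (simp only: sum.cartesian_product' prod.case)
    also have "\<dots> = (\<Sum>a\<in>I. \<Sum>b\<in>J. \<Sum>r<p. \<Sum>s<n. \<Sum>s'<n. ?T a b r s s')"
      using ij by (intro sum.cong refl) (simp add: idx sum_product mult_ac)
    also have "\<dots> = (\<Sum>a\<in>I. \<Sum>s<n. \<Sum>b\<in>J. \<Sum>r<p. \<Sum>s'<n. ?T a b r s s')"
      by (rule sum.cong[OF refl], rule sum_swap3)
    also have "\<dots> = (\<Sum>a\<in>I. \<Sum>s<n. \<Sum>s'<n. \<Sum>b\<in>J. \<Sum>r<p. ?T a b r s s')"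
      by (rule sum.cong[OF refl], rule sum.cong[OF refl], rule sum_swap3)
    also have "\<dots> = (\<Sum>a\<in>I. \<Sum>s<n. \<Sum>s'<n. K a $$ (s, i) * cnj (K a $$ (s', j)) * of_bool (s = s'))"
      by (intro sum.cong refl) (simp add: krausD(7)[OF L, symmetric] sum_distrib_left)
    also have "\<dots> = (\<Sum>a\<in>I. \<Sum>s<n. K a $$ (s, i) * cnj (K a $$ (s, j)))"
      by (intro sum.cong refl) (simp add: sum_of_bool)
    also have "\<dots> = of_bool (i = j)" by (rule krausD(7)[OF K ij])
    finally show ?thesis .
  qed
qed

lemma kraus_single:
  assumes "idim \<Lambda> = m" "odim \<Lambda> = n" "V \<in> carrier_mat n m" 
    "\<And>\<rho>. \<rho> \<in> carrier_mat m m \<Longrightarrow> app \<Lambda> (\<rho> :: complex mat) = V * \<rho> * V\<^sup>\<dagger>" "V\<^sup>\<dagger> * V = 1\<^sub>m m"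
  shows "kraus m n \<Lambda> {x} (\<lambda>_. V)"
  unfolding kraus_def
proof (intro conjI ballI allI impI)
  fix \<rho> :: "complex mat" assume \<rho>: "\<rho> \<in> carrier_mat m m"
  show "app \<Lambda> \<rho> \<in> carrier_mat n n" using assms \<rho> by auto
  have V\<rho>: "V * \<rho> \<in> carrier_mat n m" using assms \<rho> by auto
  fix r s assume rs: "r < n" "s < n"
  have "app \<Lambda> \<rho> $$ (r, s) = (\<Sum>j<m. (\<Sum>i<m. V $$ (r, i) * \<rho> $$ (i, j)) * cnj (V $$ (s, j)))"
    unfolding assms(4)[OF \<rho>] mult_dagger_index[OF V\<rho> assms(3) rs]
    using assms(3) \<rho> rs by (intro sum.cong refl) (subst index_mult_sum, auto)
  also have "\<dots> = (\<Sum>i<m. \<Sum>j<m. V $$ (r, i) * \<rho> $$ (i, j) * cnj (V $$ (s, j)))"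
    unfolding sum_distrib_right by (rule sum.swap)
  finally show "app \<Lambda> \<rho> $$ (r, s) = (\<Sum>a\<in>{x}. \<Sum>i<m. \<Sum>j<m. V $$ (r, i) * \<rho> $$ (i, j) * cnj (V $$ (s, j)))" by simp
next
  fix i j assume ij: "i < m" "j < m"
  have "(V\<^sup>\<dagger> * V) $$ (j, i) = (\<Sum>r<n. V $$ (r, i) * cnj (V $$ (r, j)))"
    using assms(3) ij by (subst index_mult_sum) (auto simp: mult.commute)
  then show "(\<Sum>a\<in>{x}. \<Sum>r<n. V $$ (r, i) * cnj (V $$ (r, j))) = of_bool (i = j)"
    using ij by (cases "i = j") (simp_all add: assms(5))
qed (use assms in auto)

lemma kraus_id: "kraus d d (id_channel d) {x} (\<lambda>_. 1\<^sub>m d)"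
  by (rule kraus_single) (auto simp: id_channel_def)

definition swap_mat :: "nat \<Rightarrow> nat \<Rightarrow> complex mat" where
  "swap_mat m n = mat (n * m) (m * n) (\<lambda>(r, i). of_bool (i = (r mod m) * n + r div m))"

lemma kraus_swap: "kraus (m * n) (n * m) (swap_channel m n) {x} (\<lambda>_. swap_mat m n)"
proof -
  have b: "(r mod m) * n + r div m < m * n" if "r < n * m" for r
  proof -
    have "m > 0" using that by (cases "m = 0") auto
    then show ?thesis using that by (intro index_less_mult) (auto simp: less_mult_imp_div_less)
  qed
  show ?thesis unfolding kraus_def
  proof (intro conjI ballI allI impI)
    fix \<rho> :: "complex mat" and r s assume rs: "r < n * m" "s < n * m"
    have "(\<Sum>i<m * n. \<Sum>j<m * n. swap_mat m n $$ (r, i) * \<rho> $$ (i, j) * cnj (swap_mat m n $$ (s, j))) =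
        (\<Sum>i<m * n. of_bool (i = (r mod m) * n + r div m) * (\<Sum>j<m * n. \<rho> $$ (i, j) * of_bool (j = (s mod m) * n + s div m)))"
      unfolding sum_distrib_left using rs
      by (intro sum.cong refl) (simp add: swap_mat_def mult.assoc)
    then show "app (swap_channel m n) \<rho> $$ (r, s) =
        (\<Sum>a\<in>{x}. \<Sum>i<m * n. \<Sum>j<m * n. swap_mat m n $$ (r, i) * \<rho> $$ (i, j) * cnj (swap_mat m n $$ (s, j)))"
      using rs b by (simp add: swap_channel_def sum_of_bool)
  next
    fix i j assume ij: "i < m * n" "j < m * n"
    have "(\<Sum>r<n * m. swap_mat m n $$ (r, i) * cnj (swap_mat m n $$ (r, j))) =
        (\<Sum>k<n. \<Sum>l<m. of_bool (i = l * n + k) * of_bool (j = l * n + k))"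
      unfolding sum_lessThan_mult using ij by (intro sum.cong refl) (auto simp: swap_mat_def index_less_mult)
    also have "\<dots> = (\<Sum>z<m * n. of_bool (i = z) * of_bool (j = z))"
      unfolding sum_lessThan_mult by (rule sum.swap)
    also have "\<dots> = of_bool (i = j)" using ij by (subst sum_of_bool) auto
    finally show "(\<Sum>a\<in>{x}. \<Sum>r<n * m. swap_mat m n $$ (r, i) * cnj (swap_mat m n $$ (r, j))) = of_bool (i = j)"
      by simp
  qed (auto simp: swap_channel_def swap_mat_def)
qed

section \<open>Kraus families and CPTP maps\<close>

lemma kraus_psd:
  assumes K: "kraus m n \<Lambda> I K" and \<rho>: "psd m \<rho>"
  shows "psd n (app \<Lambda> \<rho>)"
  unfolding psd_def
proof (intro conjI ballI)
  have \<rho>c: "\<rho> \<in> carrier_mat m m" using \<rho> by (simp add: psd_def)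
  show c: "app \<Lambda> \<rho> \<in> carrier_mat n n" by (rule krausD(5)[OF K \<rho>c])
  fix v :: "complex vec" assume v: "v \<in> carrier_vec n"
  \<comment> \<open>\<open>w a\<close> is \<open>v\<close> pulled back by the adjoint of
    \<open>K a\<close>, so the form of the output at \<open>v\<close> is the sum of the forms of
    \<rho> at the vectors \<open>w a\<close>.\<close>
  define w where "w a = vec m (\<lambda>j. \<Sum>s<n. cnj (K a $$ (s, j)) * v $ s)" for a
  let ?T = "\<lambda>a r s i j. K a $$ (r, i) * \<rho> $$ (i, j) * cnj (K a $$ (s, j)) * v $ s * cnj (v $ r)"
  have "(app \<Lambda> \<rho> *\<^sub>v v) \<bullet>c v = (\<Sum>r<n. \<Sum>s<n. \<Sum>a\<in>I. \<Sum>i<m. \<Sum>j<m. ?T a r s i j)"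
    unfolding quadratic_form[OF c v]
    by (intro sum.cong refl) (simp add: krausD(6)[OF K \<rho>c] sum_distrib_right)
  also have "\<dots> = (\<Sum>a\<in>I. \<Sum>r<n. \<Sum>s<n. \<Sum>i<m. \<Sum>j<m. ?T a r s i j)"
    by (rule sum_swap3)
  also have "\<dots> = (\<Sum>a\<in>I. \<Sum>i<m. \<Sum>r<n. \<Sum>s<n. \<Sum>j<m. ?T a r s i j)"
    by (rule sum.cong[OF refl], rule sum_swap3)
  also have "\<dots> = (\<Sum>a\<in>I. \<Sum>i<m. \<Sum>j<m. \<Sum>r<n. \<Sum>s<n. ?T a r s i j)"
    by (rule sum.cong[OF refl], rule sum.cong[OF refl], rule sum_swap3)
  also have "\<dots> = (\<Sum>a\<in>I. \<Sum>i<m. \<Sum>j<m. \<rho> $$ (i, j) * w a $ j * cnj (w a $ i))"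
  proof (intro sum.cong refl)
    fix a i j assume "i \<in> {..<m}" "j \<in> {..<m}"
    then show "(\<Sum>r<n. \<Sum>s<n. ?T a r s i j) = \<rho> $$ (i, j) * w a $ j * cnj (w a $ i)"
      unfolding w_def
      by (subst sum.swap) (simp add: sum_distrib_left sum_distrib_right sum_product mult_ac)
  qed
  also have "\<dots> = (\<Sum>a\<in>I. (\<rho> *\<^sub>v w a) \<bullet>c w a)"
    by (intro sum.cong refl quadratic_form[symmetric] \<rho>c) (simp add: w_def)
  also have "0 \<le> \<dots>" using \<rho> by (intro sum_nonneg) (simp add: psd_def w_def)
  finally show "0 \<le> (app \<Lambda> \<rho> *\<^sub>v v) \<bullet>c v" .
qed

lemma kraus_cptp:
  assumes K: "kraus m n \<Lambda> I K"
  shows "cptp m n \<Lambda>"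
  unfolding cptp_def
proof (intro conjI)
  note dims = krausD(2,3)[OF K]
  show "idim \<Lambda> = m" "odim \<Lambda> = n" by (fact dims)+
  show "linear_channel \<Lambda>"
    unfolding linear_channel_def dims
  proof (intro conjI ballI allI)
    show "app \<Lambda> A \<in> carrier_mat n n" if "A \<in> carrier_mat m m" for A by (rule krausD(5)[OF K that])
    show "app \<Lambda> (A + B) = app \<Lambda> A + app \<Lambda> B" if A: "A \<in> carrier_mat m m" and B: "B \<in> carrier_mat m m" for A B
    proof -
      have AB: "A + B \<in> carrier_mat m m" using A B by auto
      show ?thesis
        using krausD(5)[OF K A] krausD(5)[OF K B] krausD(5)[OF K AB] A B
        by (intro eq_matI) (auto simp: krausD(6)[OF K] distrib_left distrib_right sum.distrib)
    qed
    show "app \<Lambda> (c \<cdot>\<^sub>m A) = c \<cdot>\<^sub>m app \<Lambda> A" if A: "A \<in> carrier_mat m m" for A c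
    proof -
      have AB: "c \<cdot>\<^sub>m A \<in> carrier_mat m m" using A by auto
      show ?thesis
        using krausD(5)[OF K A] krausD(5)[OF K AB] A
        by (intro eq_matI) (auto simp: krausD(6)[OF K] sum_distrib_left mult_ac intro!: sum.cong)
    qed
  qed
  \<comment> \<open>Extension by an identity channel gives a Kraus family again, and Kraus families
    preserve positivity.\<close>
  show "completely_positive \<Lambda>"
    unfolding completely_positive_def dims
    using kraus_psd[OF kraus_tensor[OF kraus_id K]] by blast
  show "trace_preserving \<Lambda>"
    unfolding trace_preserving_def dims
  proof
    fix A :: "complex mat" assume A: "A \<in> carrier_mat m m"
    let ?T = "\<lambda>a r i j. K a $$ (r, i) * A $$ (i, j) * cnj (K a $$ (r, j))"
    have "mtrace (app \<Lambda> A) = (\<Sum>r<n. \<Sum>a\<in>I. \<Sum>i<m. \<Sum>j<m. ?T a r i j)"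
      unfolding mtrace_def using krausD(5)[OF K A] by (intro sum.cong) (auto simp: krausD(6)[OF K A])
    also have "\<dots> = (\<Sum>i<m. \<Sum>r<n. \<Sum>a\<in>I. \<Sum>j<m. ?T a r i j)" by (rule sum_swap3)
    also have "\<dots> = (\<Sum>i<m. \<Sum>j<m. \<Sum>r<n. \<Sum>a\<in>I. ?T a r i j)" by (rule sum.cong[OF refl], rule sum_swap3)
    also have "\<dots> = (\<Sum>i<m. \<Sum>j<m. A $$ (i, j) * of_bool (i = j))"
    proof (intro sum.cong refl)
      fix i j assume "i \<in> {..<m}" "j \<in> {..<m}"
      then have e: "(\<Sum>a\<in>I. \<Sum>r<n. K a $$ (r, i) * cnj (K a $$ (r, j))) = of_bool (i = j)" by (simp add: krausD(7)[OF K])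
      show "(\<Sum>r<n. \<Sum>a\<in>I. ?T a r i j) = A $$ (i, j) * of_bool (i = j)"
        by (subst sum.swap) (simp only: e[symmetric] sum_distrib_left mult_ac)
    qed
    also have "\<dots> = mtrace A" using A by (simp add: mtrace_def sum_of_bool)
    finally show "mtrace (app \<Lambda> A) = mtrace A" .
  qed
qed

text \<open>Linearity is available for two summands at a time, so the proof is an induction on the
  set \<open>S\<close> of entries of \<rho> that are kept while the others are set to 0.\<close>

lemma linear_channel_expand:
  assumes lin: "linear_channel \<Lambda>" and dims: "idim \<Lambda> = m" "odim \<Lambda> = n"
    and \<rho>: "\<rho> \<in> carrier_mat m m" and rs: "r < n" "s < n"
  shows "app \<Lambda> \<rho> $$ (r, s) = (\<Sum>i<m. \<Sum>j<m. \<rho> $$ (i, j) * app \<Lambda> (matrix_unit m i j) $$ (r, s))"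
proof -
  note lin' = lin[unfolded linear_channel_def dims]
  have car: "app \<Lambda> A \<in> carrier_mat n n" if "A \<in> carrier_mat m m" for A using lin' that by blast
  define R where "R S = mat m m (\<lambda>(i, j). if (i, j) \<in> S then \<rho> $$ (i, j) else 0)" for S
  have Rc: "R S \<in> carrier_mat m m" for S by (simp add: R_def)
  have "app \<Lambda> (R S) $$ (r, s) = (\<Sum>(i, j)\<in>S. \<rho> $$ (i, j) * app \<Lambda> (matrix_unit m i j) $$ (r, s))"
    if "S \<subseteq> {..<m} \<times> {..<m}" for S
    using finite_subset[OF that finite_cartesian_product[OF finite_lessThan finite_lessThan]] that
  proof (induction S rule: finite_induct)
    case empty
    \<comment> \<open>The zero matrix is 0 times itself, so homogeneity sends it to zero.\<close>
    have "R {} = 0 \<cdot>\<^sub>m R {}" by (intro eq_matI) (auto simp: R_def)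
    moreover have "app \<Lambda> (0 \<cdot>\<^sub>m R {}) = 0 \<cdot>\<^sub>m app \<Lambda> (R {})" using lin' Rc by blast
    ultimately have "app \<Lambda> (R {}) = 0 \<cdot>\<^sub>m app \<Lambda> (R {})" by metis
    then have "app \<Lambda> (R {}) $$ (r, s) = (0 \<cdot>\<^sub>m app \<Lambda> (R {})) $$ (r, s)" by metis
    then show ?case using car[OF Rc, of "{}"] rs by simp
  next
    case (insert x S)
    obtain i j where x: "x = (i, j)" by force
    have ij: "i < m" "j < m" using insert.prems by (auto simp: x)
    have E: "\<rho> $$ (i, j) \<cdot>\<^sub>m matrix_unit m i j \<in> carrier_mat m m" by simp
    have "R (insert x S) = R S + \<rho> $$ (i, j) \<cdot>\<^sub>m matrix_unit m i j"
      using insert.hyps(2) ij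
      by (intro eq_matI) (auto simp: R_def x index_matrix_unit carrier_matD[OF matrix_unit_carrier])
    moreover have "app \<Lambda> (R S + \<rho> $$ (i, j) \<cdot>\<^sub>m matrix_unit m i j) =
        app \<Lambda> (R S) + app \<Lambda> (\<rho> $$ (i, j) \<cdot>\<^sub>m matrix_unit m i j)" using lin' Rc E by blast
    moreover have "app \<Lambda> (\<rho> $$ (i, j) \<cdot>\<^sub>m matrix_unit m i j) = \<rho> $$ (i, j) \<cdot>\<^sub>m app \<Lambda> (matrix_unit m i j)"
      using lin' matrix_unit_carrier by blast
    ultimately have "app \<Lambda> (R (insert x S)) $$ (r, s) =
        app \<Lambda> (R S) $$ (r, s) + \<rho> $$ (i, j) * app \<Lambda> (matrix_unit m i j) $$ (r, s)"
      using car[OF Rc, of S] car[OF matrix_unit_carrier[of m i j]] rs by simp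
    then show ?case using insert by (simp add: x)
  qed
  from this[OF subset_refl] have "app \<Lambda> (R ({..<m} \<times> {..<m})) $$ (r, s) =
      (\<Sum>i<m. \<Sum>j<m. \<rho> $$ (i, j) * app \<Lambda> (matrix_unit m i j) $$ (r, s))"
    by (simp only: sum.cartesian_product' prod.case)
  moreover have "R ({..<m} \<times> {..<m}) = \<rho>" using \<rho> by (intro eq_matI) (auto simp: R_def)
  ultimately show ?thesis by simp
qed

text \<open>The Kraus operators are read off a square root of the Choi matrix.\<close>

lemma cptp_kraus:
  assumes "cptp m n \<Lambda>"
  shows "\<exists>N K. kraus m n \<Lambda> {..<N::nat} K"
proof -
  have dims: "idim \<Lambda> = m" "odim \<Lambda> = n" and lin: "linear_channel \<Lambda>" and cp: "completely_positive \<Lambda>"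
    and tp: "trace_preserving \<Lambda>" using assms by (auto simp: cptp_def)
  have car: "app \<Lambda> A \<in> carrier_mat n n" if "A \<in> carrier_mat m m" for A
    using lin that unfolding linear_channel_def dims by blast
  \<comment> \<open>The unnormalised maximally entangled vector as a one-column matrix: the entry at
    \<open>i * m + k\<close> is 1 exactly for \<open>i = k\<close>. Hence \<open>C\<close> is the
    Choi matrix of \<Lambda>.\<close>
  define G :: "complex mat" where "G = mat (m * m) 1 (\<lambda>(p, _). of_bool (p div m = p mod m))"
  have G: "G \<in> carrier_mat (m * m) 1" by (simp add: G_def)
  have \<Omega>: "(G * G\<^sup>\<dagger>) $$ (i * m + k, j * m + l) = of_bool (i = k) * of_bool (j = l)"
    if "i < m" "j < m" "k < m" "l < m" for i j k l
    using that by (subst mult_dagger_index[OF G G]) (auto simp: G_def index_less_mult)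
  define C where "C = app (id_channel m \<otimes>\<^sub>c \<Lambda>) (G * G\<^sup>\<dagger>)"
  have Cij: "C $$ (i * n + r, j * n + s) = app \<Lambda> (matrix_unit m i j) $$ (r, s)"
    if i: "i < m" "j < m" and r: "r < n" "s < n" for i j r s
  proof -
    have "C $$ (i * n + r, j * n + s) = (\<Sum>i'<m. \<Sum>j'<m. \<Sum>k<m. \<Sum>l<m. (G * G\<^sup>\<dagger>) $$ (i' * m + k, j' * m + l) *
         (matrix_unit m i' j' \<otimes>\<^sub>m app \<Lambda> (matrix_unit m k l)) $$ (i * n + r, j * n + s))"
      using i r by (simp add: C_def tensor_channel_def id_channel_def dims index_less_mult del: index_mult_mat(1))
    also have "\<dots> = (\<Sum>i'<m. \<Sum>j'<m. \<Sum>k<m. \<Sum>l<m. of_bool (i' = k) * of_bool (j' = l) *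
         (of_bool (i = i') * of_bool (j = j') * app \<Lambda> (matrix_unit m k l) $$ (r, s)))"
      using i r by (intro sum.cong refl)
        (simp add: \<Omega> index_tensor'[OF matrix_unit_carrier car[OF matrix_unit_carrier]] index_matrix_unit)
    also have "\<dots> = (\<Sum>i'<m. of_bool (i = i') * (\<Sum>j'<m. of_bool (j = j') * (\<Sum>k<m. of_bool (i' = k) * (\<Sum>l<m. of_bool (j' = l) *
         app \<Lambda> (matrix_unit m k l) $$ (r, s)))))"
      by (simp only: sum_distrib_left mult_ac)
    also have "\<dots> = app \<Lambda> (matrix_unit m i j) $$ (r, s)"
      using i by (simp only: sum_of_bool finite_lessThan lessThan_iff)
    finally show ?thesis .
  qed
  have "psd (m * n) C"
    unfolding C_def using cp psd_mult_dagger(1)[OF G] by (auto simp: completely_positive_def dims)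
  then obtain B where B: "psd (m * n) B" "B * B = C" using psd_sqrt_ex by blast
  have Bc: "B \<in> carrier_mat (m * n) (m * n)" using B(1) by (simp add: psd_def)
  \<comment> \<open>Each column of the root is reshaped into an operator, with \<open>i\<close> the
    input digit and \<open>r\<close> the output digit of its index.\<close>
  define K where "K a = mat n m (\<lambda>(r, i). B $$ (i * n + r, a))" for a
  have E: "app \<Lambda> (matrix_unit m i j) $$ (r, s) = (\<Sum>a<m * n. K a $$ (r, i) * cnj (K a $$ (s, j)))"
    if "i < m" "j < m" "r < n" "s < n" for i j r s
  proof -
    have "C $$ (i * n + r, j * n + s) = (\<Sum>a<m * n. B $$ (i * n + r, a) * cnj (B $$ (j * n + s, a)))"
      using mult_dagger_index[OF Bc Bc, of "i * n + r" "j * n + s"] that psd_hermitian[OF B(1)]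
      by (simp add: B(2) index_less_mult)
    then show ?thesis using that by (simp add: Cij K_def)
  qed
  have "kraus m n \<Lambda> {..<m * n} K"
    unfolding kraus_def
  proof (intro conjI ballI allI impI)
    fix \<rho> :: "complex mat" and r s assume \<rho>: "\<rho> \<in> carrier_mat m m" and rs: "r < n" "s < n"
    have "app \<Lambda> \<rho> $$ (r, s) = (\<Sum>i<m. \<Sum>j<m. \<Sum>a<m * n. K a $$ (r, i) * \<rho> $$ (i, j) * cnj (K a $$ (s, j)))"
      unfolding linear_channel_expand[OF lin dims \<rho> rs] using rs
      by (intro sum.cong refl) (simp add: E sum_distrib_left mult_ac)
    also have "\<dots> = (\<Sum>a<m * n. \<Sum>i<m. \<Sum>j<m. K a $$ (r, i) * \<rho> $$ (i, j) * cnj (K a $$ (s, j)))"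
      by (rule sum_swap3)
    finally show "app \<Lambda> \<rho> $$ (r, s) = (\<Sum>a<m * n. \<Sum>i<m. \<Sum>j<m. K a $$ (r, i) * \<rho> $$ (i, j) * cnj (K a $$ (s, j)))" .
  next
    fix i j assume ij: "i < m" "j < m"
    have "(\<Sum>a<m * n. \<Sum>r<n. K a $$ (r, i) * cnj (K a $$ (r, j))) = (\<Sum>r<n. app \<Lambda> (matrix_unit m i j) $$ (r, r))"
      using ij by (subst sum.swap) (simp add: E)
    also have "\<dots> = mtrace (app \<Lambda> (matrix_unit m i j))"
      using car[OF matrix_unit_carrier, of i j] by (simp add: mtrace_def)
    also have "\<dots> = mtrace (matrix_unit m i j)" using tp by (simp add: trace_preserving_def dims)
    also have "\<dots> = (\<Sum>k<m. of_bool (k = i) * of_bool (k = j))"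
      using ij by (auto simp: mtrace_def carrier_matD[OF matrix_unit_carrier] index_matrix_unit intro!: sum.cong)
    also have "\<dots> = of_bool (i = j)" using ij by (simp only: sum_of_bool finite_lessThan lessThan_iff)
    finally show "(\<Sum>a<m * n. \<Sum>r<n. K a $$ (r, i) * cnj (K a $$ (r, j))) = of_bool (i = j)" .
  qed (use dims car in \<open>auto simp: K_def\<close>)
  then show ?thesis by blast
qed

section \<open>Runs and their purifications\<close>

lemma kraus_reindex:
  assumes K: "kraus m n \<Lambda> I K" and h: "bij_betw h I' I" and K': "\<And>a. a \<in> I' \<Longrightarrow> K' a = K (h a)"
  shows "kraus m n \<Lambda> I' K'"
proof -
  have "finite I'" using bij_betw_finite[OF h] krausD(1)[OF K] by simp
  moreover have "K' a \<in> carrier_mat n m" if "a \<in> I'" for a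
    using krausD(4)[OF K] K'[OF that] bij_betwE[OF h] that by auto
  ultimately have *: "finite I'" "\<And>a. a \<in> I' \<Longrightarrow> K' a \<in> carrier_mat n m" by auto
  have "(\<Sum>a\<in>I'. g (K' a)) = (\<Sum>a\<in>I. g (K a))" for g :: "complex mat \<Rightarrow> complex"
    using sum.reindex_bij_betw[OF h, of "\<lambda>a. g (K a)"] K' by simp
  from this[of "\<lambda>M. \<Sum>i<m. \<Sum>j<m. M $$ (r, i) * \<rho> $$ (i, j) * cnj (M $$ (s, j))" for r s and \<rho> :: "complex mat"]
    this[of "\<lambda>M. \<Sum>r<n. M $$ (r, i) * cnj (M $$ (r, j))" for i j] *
  show ?thesis using K unfolding kraus_def by simp
qed

text \<open>Both bracketings split an index into the same three digits.\<close>

lemma tensor_assoc: "A \<otimes>\<^sub>m B \<otimes>\<^sub>m C = A \<otimes>\<^sub>m (B \<otimes>\<^sub>m C)"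
proof (intro eq_matI)
  fix i j assume "i < dim_row (A \<otimes>\<^sub>m (B \<otimes>\<^sub>m C))" "j < dim_col (A \<otimes>\<^sub>m (B \<otimes>\<^sub>m C))"
  then have ij: "i < dim_row A * dim_row B * dim_row C" "j < dim_col A * dim_col B * dim_col C"
    by (simp_all add: mult.assoc)
  have pos: "0 < dim_row B" "0 < dim_row C" "0 < dim_col B" "0 < dim_col C"
    using ij by (auto intro!: gr0I)
  have d: "x div (b * c) = x div c div b" "x mod (b * c) div c = x div c mod b" "x mod (b * c) mod c = x mod c"
    if "c > 0" for x b c :: nat
    using that by (simp_all add: div_mult2_eq mod_mult2_eq mult.commute[of b c])
  have "(A \<otimes>\<^sub>m B \<otimes>\<^sub>m C) $$ (i, j) = A $$ (i div dim_row C div dim_row B, j div dim_col C div dim_col B)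
      * B $$ (i div dim_row C mod dim_row B, j div dim_col C mod dim_col B) * C $$ (i mod dim_row C, j mod dim_col C)"
    using ij by (simp add: index_tensor less_mult_imp_div_less)
  also have "\<dots> = (A \<otimes>\<^sub>m (B \<otimes>\<^sub>m C)) $$ (i, j)"
    using ij pos by (simp add: index_tensor mult.assoc d)
  finally show "(A \<otimes>\<^sub>m B \<otimes>\<^sub>m C) $$ (i, j) = (A \<otimes>\<^sub>m (B \<otimes>\<^sub>m C)) $$ (i, j)" .
qed (simp_all add: mult.assoc)

lemma one_tensor_one: "1\<^sub>m m \<otimes>\<^sub>m 1\<^sub>m n = (1\<^sub>m (m * n) :: complex mat)"
proof (intro eq_matI)
  fix i j assume "i < dim_row (1\<^sub>m (m * n) :: complex mat)" "j < dim_col (1\<^sub>m (m * n) :: complex mat)"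
  then have ij: "i < m * n" "j < m * n" by auto
  then have "n > 0" by (cases n) auto
  have "i = j" if "i div n = j div n" "i mod n = j mod n" using that by (metis div_mod_decomp)
  then show "(1\<^sub>m m \<otimes>\<^sub>m 1\<^sub>m n) $$ (i, j) = (1\<^sub>m (m * n) :: complex mat) $$ (i, j)"
    using ij \<open>n > 0\<close> by (auto simp: index_tensor less_mult_imp_div_less)
qed auto

text \<open>Slicing by a basis bra: \<open>block d e M\<close> is
  \<open>(\<langle>e| \<otimes> 1) M\<close> for a first register with a remainder of dimension
  \<open>d\<close>, and \<open>coblock d n f M\<close> is \<open>(1 \<otimes> \<langle>f|) M\<close>
  for a last register of dimension \<open>n\<close>. Slices extract what belongs to one state of an
  environment.\<close>

definition block :: "nat \<Rightarrow> nat \<Rightarrow> complex mat \<Rightarrow> complex mat" where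
  "block d e M = mat d (dim_col M) (\<lambda>(c, j). M $$ (e * d + c, j))"

definition coblock :: "nat \<Rightarrow> nat \<Rightarrow> nat \<Rightarrow> complex mat \<Rightarrow> complex mat" where
  "coblock d n f M = mat d (dim_col M) (\<lambda>(c, j). M $$ (c * n + f, j))"

lemma block_carrier [intro]: "M \<in> carrier_mat n m \<Longrightarrow> block d e M \<in> carrier_mat d m"
  by (simp add: block_def)

lemma coblock_carrier [intro]: "M \<in> carrier_mat n m \<Longrightarrow> coblock d k f M \<in> carrier_mat d m"
  by (simp add: coblock_def)

lemma block_mult:
  assumes "X \<in> carrier_mat (n * d) k" "M \<in> carrier_mat k l" "e < n"
  shows "block d e (X * M) = block d e X * M"
proof (intro eq_matI)
  fix i j assume "i < dim_row (block d e X * M)" "j < dim_col (block d e X * M)"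
  then have ij: "i < d" "j < l" using assms by (auto simp: block_def)
  then show "block d e (X * M) $$ (i, j) = (block d e X * M) $$ (i, j)"
    using assms by (simp add: block_def index_mult_sum index_less_mult del: index_mult_mat(1))
qed (use assms in \<open>auto simp: block_def\<close>)

lemma coblock_mult:
  assumes "X \<in> carrier_mat (d * n) k" "M \<in> carrier_mat k l" "f < n"
  shows "coblock d n f (X * M) = coblock d n f X * M"
proof (intro eq_matI)
  fix i j assume "i < dim_row (coblock d n f X * M)" "j < dim_col (coblock d n f X * M)"
  then have ij: "i < d" "j < l" using assms by (auto simp: coblock_def)
  then show "coblock d n f (X * M) $$ (i, j) = (coblock d n f X * M) $$ (i, j)"
    using assms by (simp add: coblock_def index_mult_sum index_less_mult del: index_mult_mat(1))
qed (use assms in \<open>auto simp: coblock_def\<close>)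

text \<open>The slice and \<open>Y\<close> act on different tensor factors and therefore
  commute.\<close>

lemma block_one_tensor_mult:
  assumes "Y \<in> carrier_mat d' d" "M \<in> carrier_mat (n * d) l" "e < n"
  shows "block d' e ((1\<^sub>m n \<otimes>\<^sub>m Y) * M) = Y * block d e M"
proof (intro eq_matI)
  fix i j assume "i < dim_row (Y * block d e M)" "j < dim_col (Y * block d e M)"
  then have ij: "i < d'" "j < l" using assms by (auto simp: block_def)
  have "((1\<^sub>m n \<otimes>\<^sub>m Y) * M) $$ (e * d' + i, j) =
      (\<Sum>e'<n. \<Sum>k<d. (1\<^sub>m n \<otimes>\<^sub>m Y) $$ (e * d' + i, e' * d + k) * M $$ (e' * d + k, j))"
    using assms ij by (subst index_mult_sum) (auto simp: index_less_mult sum_lessThan_mult)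
  also have "\<dots> = (\<Sum>e'<n. of_bool (e = e') * (\<Sum>k<d. Y $$ (i, k) * M $$ (e' * d + k, j)))"
    unfolding sum_distrib_left using assms ij
    by (intro sum.cong refl) (simp add: index_tensor'[OF one_carrier_mat assms(1)])
  also have "\<dots> = (\<Sum>k<d. Y $$ (i, k) * M $$ (e * d + k, j))"
    using assms(3) by (simp only: sum_of_bool finite_lessThan lessThan_iff)
  also have "\<dots> = (Y * block d e M) $$ (i, j)"
    using assms ij by (subst index_mult_sum) (auto simp: block_def)
  finally show "block d' e ((1\<^sub>m n \<otimes>\<^sub>m Y) * M) $$ (i, j) = (Y * block d e M) $$ (i, j)"
    using assms ij by (simp add: block_def)
qed (use assms in \<open>auto simp: block_def\<close>)

lemma coblock_tensor_one_mult:
  assumes "Y \<in> carrier_mat d' d" "M \<in> carrier_mat (d * n) l" "f < n"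
  shows "coblock d' n f ((Y \<otimes>\<^sub>m 1\<^sub>m n) * M) = Y * coblock d n f M"
proof (intro eq_matI)
  fix i j assume "i < dim_row (Y * coblock d n f M)" "j < dim_col (Y * coblock d n f M)"
  then have ij: "i < d'" "j < l" using assms by (auto simp: coblock_def)
  have "((Y \<otimes>\<^sub>m 1\<^sub>m n) * M) $$ (i * n + f, j) =
      (\<Sum>k<d. \<Sum>f'<n. (Y \<otimes>\<^sub>m 1\<^sub>m n) $$ (i * n + f, k * n + f') * M $$ (k * n + f', j))"
    using assms ij by (subst index_mult_sum) (auto simp: index_less_mult sum_lessThan_mult)
  also have "\<dots> = (\<Sum>k<d. \<Sum>f'<n. of_bool (f = f') * (Y $$ (i, k) * M $$ (k * n + f', j)))"
    using assms ij by (intro sum.cong refl) (simp add: index_tensor'[OF assms(1) one_carrier_mat])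
  also have "\<dots> = (\<Sum>k<d. Y $$ (i, k) * M $$ (k * n + f, j))"
    using assms(3) by (simp only: sum_of_bool finite_lessThan lessThan_iff)
  also have "\<dots> = (Y * coblock d n f M) $$ (i, j)"
    using assms ij by (subst index_mult_sum) (auto simp: coblock_def)
  finally show "coblock d' n f ((Y \<otimes>\<^sub>m 1\<^sub>m n) * M) $$ (i, j) = (Y * coblock d n f M) $$ (i, j)"
    using assms ij by (simp add: coblock_def)
qed (use assms in \<open>auto simp: coblock_def\<close>)

text \<open>Slicing two adjacent registers in turn is slicing their composite. One more step of a
  protocol lengthens a history by a digit in this way.\<close>

lemma block_block: "a < n \<Longrightarrow> block d a (block (n * d) e M) = block d (e * n + a) M"
  by (intro eq_matI) (simp_all add: block_def index_less_mult add_mult_distrib mult.assoc add.assoc)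

lemma coblock_coblock: "b < n \<Longrightarrow> coblock d n b (coblock (d * n) k f M) = coblock d (n * k) (b * k + f) M"
  by (intro eq_matI) (simp_all add: coblock_def index_less_mult add_mult_distrib mult.assoc add.assoc)

lemma block_tensor:
  assumes "S \<in> carrier_mat (N * n) m" "L \<in> carrier_mat p q" "a < N"
  shows "block (n * p) a (S \<otimes>\<^sub>m L) = block n a S \<otimes>\<^sub>m L"
proof (intro eq_matI)
  fix i j assume "i < dim_row (block n a S \<otimes>\<^sub>m L)" "j < dim_col (block n a S \<otimes>\<^sub>m L)"
  then have ij: "i < n * p" "j < m * q" using assms by (auto simp: block_def)
  then have "p > 0" "q > 0" by (auto intro!: gr0I)
  have "a * (n * p) + i < N * n * p" using index_less_mult[OF assms(3) ij(1)] by (simp add: mult.assoc)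
  moreover have "(a * (n * p) + i) div p = a * n + i div p" "(a * (n * p) + i) mod p = i mod p"
    using \<open>p > 0\<close> by (simp_all add: mult.assoc[symmetric])
  ultimately show "block (n * p) a (S \<otimes>\<^sub>m L) $$ (i, j) = (block n a S \<otimes>\<^sub>m L) $$ (i, j)"
    using ij assms \<open>p > 0\<close> \<open>q > 0\<close> by (simp add: block_def index_tensor less_mult_imp_div_less)
qed (use assms in \<open>auto simp: block_def\<close>)

lemma coblock_tensor:
  assumes "S \<in> carrier_mat (n * N) m" "L \<in> carrier_mat p q" "b < N"
  shows "coblock (p * n) N b (L \<otimes>\<^sub>m S) = L \<otimes>\<^sub>m coblock n N b S"
proof (intro eq_matI)
  fix i j assume "i < dim_row (L \<otimes>\<^sub>m coblock n N b S)" "j < dim_col (L \<otimes>\<^sub>m coblock n N b S)"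
  then have ij: "i < p * n" "j < q * m" using assms by (auto simp: coblock_def)
  then have "n > 0" "m > 0" by (auto intro!: gr0I)
  have 1: "i * N + b < p * (n * N)" using index_less_mult[OF ij(1) assms(3)] by (simp add: mult.assoc)
  have N: "N > 0" using assms(3) by simp
  have 2: "(i * N + b) div (n * N) = i div n"
    using assms(3) N by (simp add: mult.commute[of n N] div_mult2_eq)
  have 3: "(i * N + b) mod (n * N) = (i mod n) * N + b"
    using assms(3) N by (simp add: mult.commute[of n N] mod_mult2_eq)
  show "coblock (p * n) N b (L \<otimes>\<^sub>m S) $$ (i, j) = (L \<otimes>\<^sub>m coblock n N b S) $$ (i, j)"
    using ij assms \<open>n > 0\<close> \<open>m > 0\<close> 1 by (simp add: coblock_def index_tensor less_mult_imp_div_less 2 3)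
qed (use assms in \<open>auto simp: coblock_def\<close>)

section \<open>Isometries and Stinespring dilations\<close>

definition iso_channel :: "complex mat \<Rightarrow> channel" where
  "iso_channel V = \<lparr>idim = dim_col V, odim = dim_row V, app = (\<lambda>\<rho>. V * \<rho> * V\<^sup>\<dagger>)\<rparr>"

lemma kraus_iso: "V\<^sup>\<dagger> * V = 1\<^sub>m (dim_col V) \<Longrightarrow> kraus (dim_col V) (dim_row V) (iso_channel V) {x} (\<lambda>_. V)"
  by (rule kraus_single) (auto simp: iso_channel_def)

text \<open>Stinespring dilations of a Kraus family, with the environment register first respectively last.\<close>

definition stack :: "nat \<Rightarrow> nat \<Rightarrow> nat \<Rightarrow> (nat \<Rightarrow> complex mat) \<Rightarrow> complex mat" where
  "stack m n N K = mat (N * n) m (\<lambda>(r, i). K (r div n) $$ (r mod n, i))"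

definition costack :: "nat \<Rightarrow> nat \<Rightarrow> nat \<Rightarrow> (nat \<Rightarrow> complex mat) \<Rightarrow> complex mat" where
  "costack m n N K = mat (n * N) m (\<lambda>(r, i). K (r mod N) $$ (r div N, i))"

lemma stack_carrier [simp]: "stack m n N K \<in> carrier_mat (N * n) m" "dim_row (stack m n N K) = N * n"
    "dim_col (stack m n N K) = m"
  by (simp_all add: stack_def)

lemma costack_carrier [simp]: "costack m n N K \<in> carrier_mat (n * N) m" "dim_row (costack m n N K) = n * N"
    "dim_col (costack m n N K) = m"
  by (simp_all add: costack_def)

text \<open>The completeness relation of the family is exactly the isometry property of the stacked
  matrix, and slicing the environment returns the family.\<close>

lemma kraus_stack:
  assumes K: "kraus m n \<Lambda> {..<N} K"
  shows "kraus m (N * n) (iso_channel (stack m n N K)) {x} (\<lambda>_. stack m n N K)"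
    and "a < N \<Longrightarrow> block n a (stack m n N K) = K a"
proof -
  have "(stack m n N K)\<^sup>\<dagger> * stack m n N K = 1\<^sub>m m"
  proof (intro eq_matI)
    fix i j assume "i < dim_row (1\<^sub>m m :: complex mat)" "j < dim_col (1\<^sub>m m :: complex mat)"
    then have ij: "i < m" "j < m" by auto
    have "((stack m n N K)\<^sup>\<dagger> * stack m n N K) $$ (i, j) = (\<Sum>a<N. \<Sum>r<n. K a $$ (r, j) * cnj (K a $$ (r, i)))"
      using ij by (subst index_mult_sum) (auto simp: sum_lessThan_mult stack_def index_less_mult mult.commute intro!: sum.cong)
    then show "((stack m n N K)\<^sup>\<dagger> * stack m n N K) $$ (i, j) = 1\<^sub>m m $$ (i, j)"
      using krausD(7)[OF K ij(2,1)] ij by auto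
  qed auto
  from kraus_iso[of "stack m n N K"] this
  show "kraus m (N * n) (iso_channel (stack m n N K)) {x} (\<lambda>_. stack m n N K)" by simp
  show "a < N \<Longrightarrow> block n a (stack m n N K) = K a"
    using krausD(4)[OF K, of a] by (intro eq_matI) (auto simp: block_def stack_def index_less_mult)
qed

lemma kraus_costack:
  assumes K: "kraus m n \<Lambda> {..<N} K"
  shows "kraus m (n * N) (iso_channel (costack m n N K)) {x} (\<lambda>_. costack m n N K)"
    and "a < N \<Longrightarrow> coblock n N a (costack m n N K) = K a"
proof -
  have "(costack m n N K)\<^sup>\<dagger> * costack m n N K = 1\<^sub>m m"
  proof (intro eq_matI)
    fix i j assume "i < dim_row (1\<^sub>m m :: complex mat)" "j < dim_col (1\<^sub>m m :: complex mat)"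
    then have ij: "i < m" "j < m" by auto
    have "((costack m n N K)\<^sup>\<dagger> * costack m n N K) $$ (i, j) = (\<Sum>r<n. \<Sum>a<N. K a $$ (r, j) * cnj (K a $$ (r, i)))"
      using ij by (subst index_mult_sum) (auto simp: sum_lessThan_mult costack_def index_less_mult mult.commute[of "cnj _"] intro!: sum.cong)
    also have "\<dots> = (\<Sum>a<N. \<Sum>r<n. K a $$ (r, j) * cnj (K a $$ (r, i)))" by (rule sum.swap)
    finally show "((costack m n N K)\<^sup>\<dagger> * costack m n N K) $$ (i, j) = 1\<^sub>m m $$ (i, j)"
      using krausD(7)[OF K ij(2,1)] ij by auto
  qed auto
  from kraus_iso[of "costack m n N K"] this
  show "kraus m (n * N) (iso_channel (costack m n N K)) {x} (\<lambda>_. costack m n N K)" by simp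
  show "a < N \<Longrightarrow> coblock n N a (costack m n N K) = K a"
    using krausD(4)[OF K, of a] by (intro eq_matI) (auto simp: coblock_def costack_def index_less_mult)
qed

section \<open>Kraus operators of a run, indexed by the histories of both parties\<close>

definition alice_kraus :: "protocol \<Rightarrow> party \<Rightarrow> (nat \<Rightarrow> nat) \<Rightarrow> (nat \<Rightarrow> nat \<Rightarrow> complex mat) \<Rightarrow> bool" where
  "alice_kraus \<pi> A N K \<longleftrightarrow> (\<forall>i<steps \<pi>. kraus (memory A i * to_alice \<pi> i)
     (memory A (Suc i) * to_bob \<pi> (Suc i)) (local_op A i) {..<N i} (K i))"

definition bob_kraus :: "protocol \<Rightarrow> party \<Rightarrow> (nat \<Rightarrow> nat) \<Rightarrow> (nat \<Rightarrow> nat \<Rightarrow> complex mat) \<Rightarrow> bool" where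
  "bob_kraus \<pi> B N K \<longleftrightarrow> (\<forall>i<steps \<pi>. kraus (to_bob \<pi> i * memory B i)
     (to_alice \<pi> (Suc i) * memory B (Suc i)) (local_op B i) {..<N i} (K i))"

lemma alice_behaviour_kraus:
  assumes "alice_behaviour \<pi> d A"
  shows "\<exists>N K. alice_kraus \<pi> A N K"
proof -
  have "\<exists>N K. kraus (memory A i * to_alice \<pi> i) (memory A (Suc i) * to_bob \<pi> (Suc i)) (local_op A i) {..<N::nat} K" if "i < steps \<pi>" for i
    using assms that unfolding alice_behaviour_def by - (rule cptp_kraus, auto)
  then have "\<exists>N K. i < steps \<pi> \<longrightarrow> kraus (memory A i * to_alice \<pi> i) (memory A (Suc i) * to_bob \<pi> (Suc i)) (local_op A i) {..<N::nat} K" for i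
    by (cases "i < steps \<pi>") auto
  then have "\<exists>(N :: nat \<Rightarrow> nat) K. \<forall>i. i < steps \<pi> \<longrightarrow> kraus (memory A i * to_alice \<pi> i) (memory A (Suc i) * to_bob \<pi> (Suc i)) (local_op A i) {..<N i} (K i)"
    by metis
  then show ?thesis unfolding alice_kraus_def by blast
qed

lemma bob_behaviour_kraus:
  assumes "bob_behaviour \<pi> d B"
  shows "\<exists>N K. bob_kraus \<pi> B N K"
proof -
  have "\<exists>N K. kraus (to_bob \<pi> i * memory B i) (to_alice \<pi> (Suc i) * memory B (Suc i)) (local_op B i) {..<N::nat} K" if "i < steps \<pi>" for i
    using assms that unfolding bob_behaviour_def by - (rule cptp_kraus, auto)
  then have "\<exists>N K. i < steps \<pi> \<longrightarrow> kraus (to_bob \<pi> i * memory B i) (to_alice \<pi> (Suc i) * memory B (Suc i)) (local_op B i) {..<N::nat} K" for i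
    by (cases "i < steps \<pi>") auto
  then have "\<exists>(N :: nat \<Rightarrow> nat) K. \<forall>i. i < steps \<pi> \<longrightarrow> kraus (to_bob \<pi> i * memory B i) (to_alice \<pi> (Suc i) * memory B (Suc i)) (local_op B i) {..<N i} (K i)"
    by metis
  then show ?thesis unfolding bob_kraus_def by blast
qed

text \<open>The number of Kraus histories of length \<open>i\<close>, which is also the dimension of
  a register that stores them.\<close>

definition env :: "(nat \<Rightarrow> nat) \<Rightarrow> nat \<Rightarrow> nat" where
  "env N i = (\<Prod>j<i. N j)"

lemma env_simps [simp]: "env N 0 = 1" "env N (Suc i) = env N i * N i"
  by (simp_all add: env_def)

definition joint_dim :: "protocol \<Rightarrow> party \<Rightarrow> party \<Rightarrow> nat \<Rightarrow> nat" where
  "joint_dim \<pi> A B i = memory A i * to_alice \<pi> i * (to_bob \<pi> i * memory B i)"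

definition exchange_mat :: "protocol \<Rightarrow> party \<Rightarrow> party \<Rightarrow> nat \<Rightarrow> complex mat" where
  "exchange_mat \<pi> A B i = 1\<^sub>m (memory A (Suc i)) \<otimes>\<^sub>m swap_mat (to_bob \<pi> (Suc i)) (to_alice \<pi> (Suc i))
     \<otimes>\<^sub>m 1\<^sub>m (memory B (Suc i))"

text \<open>The Kraus operator for the histories \<open>e\<close> of Alice and \<open>f\<close> of Bob. The most recent Kraus index is
  the last digit of \<open>e\<close> but the first digit of \<open>f\<close>, as the environments sit at the two ends.\<close>

fun run_kraus :: "protocol \<Rightarrow> party \<Rightarrow> party \<Rightarrow> (nat \<Rightarrow> nat) \<Rightarrow> (nat \<Rightarrow> nat \<Rightarrow> complex mat) \<Rightarrow>
    (nat \<Rightarrow> nat) \<Rightarrow> (nat \<Rightarrow> nat \<Rightarrow> complex mat) \<Rightarrow> nat \<Rightarrow> nat \<Rightarrow> nat \<Rightarrow> complex mat" where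
  "run_kraus \<pi> A B NA KA NB KB 0 e f = 1\<^sub>m (memory A 0 * memory B 0)"
| "run_kraus \<pi> A B NA KA NB KB (Suc i) e f =
     exchange_mat \<pi> A B i * (KA i (e mod NA i) \<otimes>\<^sub>m KB i (f div env NB i)) *
     run_kraus \<pi> A B NA KA NB KB i (e div NA i) (f mod env NB i)"

lemma kraus_exchange:
  "kraus (memory A (Suc i) * to_bob \<pi> (Suc i) * (to_alice \<pi> (Suc i) * memory B (Suc i))) (joint_dim \<pi> A B (Suc i))
    (id_channel (memory A (Suc i)) \<otimes>\<^sub>c swap_channel (to_bob \<pi> (Suc i)) (to_alice \<pi> (Suc i))
        \<otimes>\<^sub>c id_channel (memory B (Suc i))) {(((), ()), ())} (\<lambda>_. exchange_mat \<pi> A B i)"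
proof -
  have "kraus (memory A (Suc i) * (to_bob \<pi> (Suc i) * to_alice \<pi> (Suc i)) * memory B (Suc i))
    (memory A (Suc i) * (to_alice \<pi> (Suc i) * to_bob \<pi> (Suc i)) * memory B (Suc i))
    (id_channel (memory A (Suc i)) \<otimes>\<^sub>c swap_channel (to_bob \<pi> (Suc i)) (to_alice \<pi> (Suc i))
        \<otimes>\<^sub>c id_channel (memory B (Suc i))) (({()} \<times> {()}) \<times> {()})
    (\<lambda>(a, b). (case a of (a, b) \<Rightarrow> 1\<^sub>m (memory A (Suc i)) \<otimes>\<^sub>m swap_mat (to_bob \<pi> (Suc i)) (to_alice \<pi> (Suc i)))
        \<otimes>\<^sub>m 1\<^sub>m (memory B (Suc i)))"
    by (rule kraus_tensor[OF kraus_tensor[OF kraus_id kraus_swap] kraus_id])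
  then show ?thesis by (simp add: exchange_mat_def joint_dim_def mult.assoc case_prod_unfold)
qed

lemma kraus_run:
  assumes init: "to_alice \<pi> 0 = 1" "to_bob \<pi> 0 = 1"
    and A: "alice_kraus \<pi> A NA KA" and B: "bob_kraus \<pi> B NB KB" and i: "i \<le> steps \<pi>"
  shows "kraus (memory A 0 * memory B 0) (joint_dim \<pi> A B i) (run \<pi> A B i)
    ({..<env NA i} \<times> {..<env NB i}) (\<lambda>(e, f). run_kraus \<pi> A B NA KA NB KB i e f)"
  using i
proof (induction i)
  case 0
  have "kraus (memory A 0 * memory B 0) (joint_dim \<pi> A B 0) (run \<pi> A B 0) {(0::nat, 0::nat)} (\<lambda>_. 1\<^sub>m (memory A 0 * memory B 0))"
    using kraus_id[of "memory A 0 * memory B 0"] by (simp add: joint_dim_def init)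
  then show ?case by (rule kraus_reindex[where h = id]) (auto simp: lessThan_Suc)
next
  case (Suc i)
  let ?EA = "env NA i" and ?EB = "env NB i"
  have i: "i < steps \<pi>" using Suc.prems by simp
  have KA: "kraus (memory A i * to_alice \<pi> i) (memory A (Suc i) * to_bob \<pi> (Suc i)) (local_op A i) {..<NA i} (KA i)"
    using A i by (simp add: alice_kraus_def)
  have KB: "kraus (to_bob \<pi> i * memory B i) (to_alice \<pi> (Suc i) * memory B (Suc i)) (local_op B i) {..<NB i} (KB i)"
    using B i by (simp add: bob_kraus_def)
  have IH: "kraus (memory A 0 * memory B 0) (memory A i * to_alice \<pi> i * (to_bob \<pi> i * memory B i)) (run \<pi> A B i)
    ({..<?EA} \<times> {..<?EB}) (\<lambda>(e, f). run_kraus \<pi> A B NA KA NB KB i e f)"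
    using Suc.IH Suc.prems by (simp add: joint_dim_def)
  note K = kraus_comp[OF IH kraus_comp[OF kraus_tensor[OF KA KB] kraus_exchange]]
  \<comment> \<open>\<open>h\<close> splits the newest digit off both histories, the last digit of
    \<open>e\<close> and the first one of \<open>f\<close>. The unit values index the one-element
    Kraus family of the message exchange.\<close>
  define h where "h = (\<lambda>(e, f). ((e div NA i, f mod ?EB), ((e mod NA i, f div ?EB), (((), ()), ()))))"
  define h' where "h' = (\<lambda>((e, f), ((a, b), _ :: (unit \<times> unit) \<times> unit)). (e * NA i + a, b * ?EB + f))"
  have "bij_betw h ({..<env NA (Suc i)} \<times> {..<env NB (Suc i)})
    (({..<?EA} \<times> {..<?EB}) \<times> (({..<NA i} \<times> {..<NB i}) \<times> {(((), ()), ())}))"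
  proof (rule bij_betw_byWitness[where f' = h'])
    have pos: "0 < NA i" "0 < NB i" "0 < ?EB" if "e < env NA (Suc i)" "f < env NB (Suc i)" for e f
      using that by (auto intro!: gr0I)
    show "\<forall>x\<in>{..<env NA (Suc i)} \<times> {..<env NB (Suc i)}. h' (h x) = x" by (auto simp: h_def h'_def div_mult_mod_eq)
    show "\<forall>y\<in>({..<?EA} \<times> {..<?EB}) \<times> (({..<NA i} \<times> {..<NB i}) \<times> {(((), ()), ())}). h (h' y) = y"
    proof -
      have "(a * n + b) div n = a" "(a * n + b) mod n = b" if "b < n" for a b n :: nat
        using that by simp_all
      then show ?thesis by (auto simp: h_def h'_def simp del: div_mult_self3 mod_mult_self3)
    qed
    show "h ` ({..<env NA (Suc i)} \<times> {..<env NB (Suc i)}) \<subseteq> ({..<?EA} \<times> {..<?EB}) \<times> (({..<NA i} \<times> {..<NB i}) \<times> {(((), ()), ())})"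
      using pos by (auto simp: h_def less_mult_imp_div_less mult.commute[of ?EB])
    show "h' ` (({..<?EA} \<times> {..<?EB}) \<times> (({..<NA i} \<times> {..<NB i}) \<times> {(((), ()), ())})) \<subseteq> {..<env NA (Suc i)} \<times> {..<env NB (Suc i)}"
      using index_less_mult by (auto simp: h'_def mult.commute[of ?EB "NB i"])
  qed
  from kraus_reindex[OF K this, of "\<lambda>(e, f). run_kraus \<pi> A B NA KA NB KB (Suc i) e f"]
  show ?case by (auto simp: h_def)
qed

section \<open>Parties that keep the environments of their local operations\<close>

definition purified_alice :: "protocol \<Rightarrow> party \<Rightarrow> (nat \<Rightarrow> nat) \<Rightarrow> (nat \<Rightarrow> nat \<Rightarrow> complex mat) \<Rightarrow> party" where
  "purified_alice \<pi> A N K = \<lparr>memory = (\<lambda>i. env N i * memory A i),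
     local_op = (\<lambda>i. id_channel (env N i) \<otimes>\<^sub>c iso_channel
       (stack (memory A i * to_alice \<pi> i) (memory A (Suc i) * to_bob \<pi> (Suc i)) (N i) (K i)))\<rparr>"

text \<open>\<open>costack\<close> leaves the new environment register directly behind the memory
  and hence in front of the older ones, whereas Alice's \<open>stack\<close> puts hers behind the
  older ones. All environments thus stay at the outer ends of the joint state, away from the
  messages.\<close>

definition purified_bob :: "protocol \<Rightarrow> party \<Rightarrow> (nat \<Rightarrow> nat) \<Rightarrow> (nat \<Rightarrow> nat \<Rightarrow> complex mat) \<Rightarrow> party" where
  "purified_bob \<pi> B N K = \<lparr>memory = (\<lambda>i. memory B i * env N i),
     local_op = (\<lambda>i. iso_channel
       (costack (to_bob \<pi> i * memory B i) (to_alice \<pi> (Suc i) * memory B (Suc i)) (N i) (K i)) \<otimes>\<^sub>c id_channel (env N i))\<rparr>"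

abbreviation alice_isometry :: "protocol \<Rightarrow> party \<Rightarrow> (nat \<Rightarrow> nat) \<Rightarrow> (nat \<Rightarrow> nat \<Rightarrow> complex mat) \<Rightarrow> nat \<Rightarrow> complex mat" where
  "alice_isometry \<pi> A N K i \<equiv> 1\<^sub>m (env N i) \<otimes>\<^sub>m
     stack (memory A i * to_alice \<pi> i) (memory A (Suc i) * to_bob \<pi> (Suc i)) (N i) (K i)"

abbreviation bob_isometry :: "protocol \<Rightarrow> party \<Rightarrow> (nat \<Rightarrow> nat) \<Rightarrow> (nat \<Rightarrow> nat \<Rightarrow> complex mat) \<Rightarrow> nat \<Rightarrow> complex mat" where
  "bob_isometry \<pi> B N K i \<equiv>
     costack (to_bob \<pi> i * memory B i) (to_alice \<pi> (Suc i) * memory B (Suc i)) (N i) (K i) \<otimes>\<^sub>m 1\<^sub>m (env N i)"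

lemma purified_memory [simp]:
  "memory (purified_alice \<pi> A N K) i = env N i * memory A i"
  "memory (purified_bob \<pi> B N K) i = memory B i * env N i"
  by (simp_all add: purified_alice_def purified_bob_def)

text \<open>An isometry is a Kraus family with one member, so a purified party has only the history
  0; this is the meaning of \<open>\<lambda>_. 1\<close>.\<close>

lemma purified_alice_kraus:
  assumes "alice_kraus \<pi> A N K"
  shows "alice_kraus \<pi> (purified_alice \<pi> A N K) (\<lambda>_. 1) (\<lambda>i _. alice_isometry \<pi> A N K i)"
  unfolding alice_kraus_def
proof (intro allI impI)
  fix i assume "i < steps \<pi>"
  then have K: "kraus (memory A i * to_alice \<pi> i) (memory A (Suc i) * to_bob \<pi> (Suc i)) (local_op A i) {..<N i} (K i)"
    using assms by (simp add: alice_kraus_def)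
  have b: "bij_betw (\<lambda>_::nat. ((), ())) {..<1} ({()} \<times> {()})" by (auto simp: bij_betw_def inj_on_def lessThan_Suc)
  from kraus_reindex[OF kraus_tensor[OF kraus_id[of "env N i"] kraus_stack(1)[OF K]] b, of "\<lambda>_. alice_isometry \<pi> A N K i"]
  show "kraus (memory (purified_alice \<pi> A N K) i * to_alice \<pi> i)
      (memory (purified_alice \<pi> A N K) (Suc i) * to_bob \<pi> (Suc i)) (local_op (purified_alice \<pi> A N K) i) {..<1::nat}
      (\<lambda>_. alice_isometry \<pi> A N K i)"
    by (simp add: purified_alice_def mult.assoc)
qed

lemma purified_bob_kraus:
  assumes "bob_kraus \<pi> B N K"
  shows "bob_kraus \<pi> (purified_bob \<pi> B N K) (\<lambda>_. 1) (\<lambda>i _. bob_isometry \<pi> B N K i)"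
  unfolding bob_kraus_def
proof (intro allI impI)
  fix i assume "i < steps \<pi>"
  then have K: "kraus (to_bob \<pi> i * memory B i) (to_alice \<pi> (Suc i) * memory B (Suc i)) (local_op B i) {..<N i} (K i)"
    using assms by (simp add: bob_kraus_def)
  have b: "bij_betw (\<lambda>_::nat. ((), ())) {..<1} ({()} \<times> {()})" by (auto simp: bij_betw_def inj_on_def lessThan_Suc)
  from kraus_reindex[OF kraus_tensor[OF kraus_costack(1)[OF K] kraus_id[of "env N i"]] b, of "\<lambda>_. bob_isometry \<pi> B N K i"]
  show "kraus (to_bob \<pi> i * memory (purified_bob \<pi> B N K) i)
      (to_alice \<pi> (Suc i) * memory (purified_bob \<pi> B N K) (Suc i)) (local_op (purified_bob \<pi> B N K) i) {..<1::nat}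
      (\<lambda>_. bob_isometry \<pi> B N K i)"
    by (simp add: purified_bob_def mult_ac)
qed

lemma alice_kraus_behaviour: "alice_kraus \<pi> A N K \<Longrightarrow> alice_behaviour \<pi> (memory A 0) A"
  unfolding alice_kraus_def alice_behaviour_def by (metis kraus_cptp)

lemma bob_kraus_behaviour: "bob_kraus \<pi> B N K \<Longrightarrow> bob_behaviour \<pi> (memory B 0) B"
  unfolding bob_kraus_def bob_behaviour_def by (metis kraus_cptp)

lemma env_one [simp]: "env (\<lambda>_. Suc 0) i = 1"
  by (simp add: env_def)

lemma exchange_mat_carrier:
  "exchange_mat \<pi> A B i \<in> carrier_mat (joint_dim \<pi> A B (Suc i))
     (memory A (Suc i) * to_bob \<pi> (Suc i) * (to_alice \<pi> (Suc i) * memory B (Suc i)))"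
  using krausD(4)[OF kraus_exchange, of "(((), ()), ())"] by simp

text \<open>Purification only postpones reading the Kraus indices. Later steps act as the identity
  on the environment collected so far, so slicing by \<open>e\<close> at the end selects the same
  operators as the history \<open>e\<close> does on the way.\<close>

lemma run_purified_alice:
  assumes init: "to_alice \<pi> 0 = 1" "to_bob \<pi> 0 = 1"
    and A: "alice_kraus \<pi> A NA KA" and B: "bob_kraus \<pi> B NB KB"
    and i: "i \<le> steps \<pi>" and e: "e < env NA i" and f: "f < env NB i"
  shows "block (joint_dim \<pi> A B i) e
    (run_kraus \<pi> (purified_alice \<pi> A NA KA) B (\<lambda>_. 1) (\<lambda>i _. alice_isometry \<pi> A NA KA i) NB KB i 0 f) =
    run_kraus \<pi> A B NA KA NB KB i e f"
  using i e f
proof (induction i arbitrary: e f)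
  case 0
  then show ?case
    by (intro eq_matI) (auto simp: block_def joint_dim_def init)
next
  case (Suc i)
  define E N where EN: "E = env NA i" "N = NA i"
  \<comment> \<open>\<open>a\<close> is Alice's Kraus index in the current step and
    \<open>e'\<close> her earlier history; \<open>b\<close> and \<open>f'\<close> play these roles
    for Bob.\<close>
  define e' a where ea: "e' = e div N" "a = e mod N"
  define f' b where fb: "f' = f mod env NB i" "b = f div env NB i"
  have i: "i < steps \<pi>" "i \<le> steps \<pi>" using Suc.prems by auto
  have pos: "N > 0" "env NB i > 0" using Suc.prems by (auto intro!: gr0I simp: EN)
  have bounds: "e' < E" "a < N" "f' < env NB i" "b < NB i" and e: "e = e' * N + a"
    using Suc.prems pos by (auto simp: ea fb EN less_mult_imp_div_less mult.commute)
  let ?A = "purified_alice \<pi> A NA KA"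
  let ?R = "run_kraus \<pi> ?A B (\<lambda>_. 1) (\<lambda>i _. alice_isometry \<pi> A NA KA i) NB KB i 0 f'"
  define c c' nA nB where c: "c = joint_dim \<pi> A B i" "c' = joint_dim \<pi> A B (Suc i)"
    "nA = memory A (Suc i) * to_bob \<pi> (Suc i)" "nB = to_alice \<pi> (Suc i) * memory B (Suc i)"
  have KA: "kraus (memory A i * to_alice \<pi> i) nA (local_op A i) {..<N} (KA i)"
    using A i by (simp add: alice_kraus_def EN c)
  have KB: "kraus (to_bob \<pi> i * memory B i) nB (local_op B i) {..<NB i} (KB i)"
    using B i by (simp add: bob_kraus_def c)
  define S where "S = stack (memory A i * to_alice \<pi> i) nA N (KA i)"
  have S: "S \<in> carrier_mat (N * nA) (memory A i * to_alice \<pi> i)" by (simp add: S_def)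
  have L: "KB i b \<in> carrier_mat nB (to_bob \<pi> i * memory B i)" using krausD(4)[OF KB] bounds by simp
  have SL: "S \<otimes>\<^sub>m KB i b \<in> carrier_mat (N * (nA * nB)) c"
    using tensor_carrier[OF S L] by (simp add: c joint_dim_def mult.assoc)
  have R: "?R \<in> carrier_mat (E * c) (memory A 0 * memory B 0)"
    using krausD(4)[OF kraus_run[OF init purified_alice_kraus[OF A] B i(2)], of "(0, f')"] bounds
    by (simp add: c joint_dim_def EN mult.assoc)
  have X: "exchange_mat \<pi> A B i \<in> carrier_mat c' (nA * nB)"
    using exchange_mat_carrier[of \<pi> A B i] by (simp add: c)
  \<comment> \<open>The exchange of messages touches neither the old environment, of dimension
    \<open>E\<close>, nor the new one, of dimension \<open>N\<close>.\<close>
  have X': "exchange_mat \<pi> ?A B i = 1\<^sub>m E \<otimes>\<^sub>m (1\<^sub>m N \<otimes>\<^sub>m exchange_mat \<pi> A B i)"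
    by (simp add: exchange_mat_def EN one_tensor_one[symmetric] tensor_assoc)
  have X1: "1\<^sub>m N \<otimes>\<^sub>m exchange_mat \<pi> A B i \<in> carrier_mat (N * c') (N * (nA * nB))"
    by (rule tensor_carrier[OF one_carrier_mat X])
  define Z where "Z = (S \<otimes>\<^sub>m KB i b) * block c e' ?R"
  have bR: "block c e' ?R \<in> carrier_mat c (memory A 0 * memory B 0)" by (rule block_carrier[OF R])
  have Z: "Z \<in> carrier_mat (N * (nA * nB)) (memory A 0 * memory B 0)"
    unfolding Z_def by (rule mult_carrier_mat[OF SL bR])
  define Y where "Y = (1\<^sub>m E \<otimes>\<^sub>m (S \<otimes>\<^sub>m KB i b)) * ?R"
  have Y: "Y \<in> carrier_mat (E * (N * (nA * nB))) (memory A 0 * memory B 0)"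
    unfolding Y_def by (rule mult_carrier_mat[OF tensor_carrier[OF one_carrier_mat SL] R])
  have "run_kraus \<pi> ?A B (\<lambda>_. 1) (\<lambda>i _. alice_isometry \<pi> A NA KA i) NB KB (Suc i) 0 f =
      (1\<^sub>m E \<otimes>\<^sub>m (1\<^sub>m N \<otimes>\<^sub>m exchange_mat \<pi> A B i)) * Y"
    unfolding Y_def using R carrier_matD[OF tensor_carrier[OF one_carrier_mat[of E] SL]]
      carrier_matD[OF tensor_carrier[OF one_carrier_mat[of E] X1]]
    by (simp add: X' mult_assoc_dim fb S_def EN c tensor_assoc del: dim_tensor)
  \<comment> \<open>The slice by \<open>e\<close> is taken in two stages, the old environment first.
    Each stage then moves inwards past the factors that do not touch its register.\<close>
  then have "block c' e (run_kraus \<pi> ?A B (\<lambda>_. 1) (\<lambda>i _. alice_isometry \<pi> A NA KA i) NB KB (Suc i) 0 f) =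
      block c' a (block (N * c') e' ((1\<^sub>m E \<otimes>\<^sub>m (1\<^sub>m N \<otimes>\<^sub>m exchange_mat \<pi> A B i)) * Y))"
    using bounds by (simp add: block_block e)
  also have "block (N * c') e' ((1\<^sub>m E \<otimes>\<^sub>m (1\<^sub>m N \<otimes>\<^sub>m exchange_mat \<pi> A B i)) * Y) =
      (1\<^sub>m N \<otimes>\<^sub>m exchange_mat \<pi> A B i) * block (N * (nA * nB)) e' Y"
    by (rule block_one_tensor_mult[OF X1 Y bounds(1)])
  also have "block (N * (nA * nB)) e' Y = Z"
    unfolding Y_def Z_def by (rule block_one_tensor_mult[OF SL R bounds(1)])
  also have "block c' a ((1\<^sub>m N \<otimes>\<^sub>m exchange_mat \<pi> A B i) * Z) = exchange_mat \<pi> A B i * block (nA * nB) a Z"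
    by (rule block_one_tensor_mult[OF X Z bounds(2)])
  also have "block (nA * nB) a Z = block (nA * nB) a (S \<otimes>\<^sub>m KB i b) * block c e' ?R"
    unfolding Z_def by (rule block_mult[OF SL bR bounds(2)])
  also have "block (nA * nB) a (S \<otimes>\<^sub>m KB i b) = KA i a \<otimes>\<^sub>m KB i b"
    unfolding block_tensor[OF S L bounds(2)] using kraus_stack(2)[OF KA bounds(2)] by (simp add: S_def)
  also have "block c e' ?R = run_kraus \<pi> A B NA KA NB KB i e' f'"
    unfolding c using Suc.IH[OF i(2), of e' f'] bounds by (simp add: EN)
  also have "exchange_mat \<pi> A B i * ((KA i a \<otimes>\<^sub>m KB i b) * run_kraus \<pi> A B NA KA NB KB i e' f') =
      run_kraus \<pi> A B NA KA NB KB (Suc i) e f"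
    using krausD(4)[OF KA, of a] L X bounds krausD(4)[OF kraus_run[OF init A B i(2)], of "(e', f')"]
    by (simp add: ea fb EN mult_assoc_dim c joint_dim_def mult.assoc)
  finally show ?case by (simp add: c)
qed

text \<open>The mirror image of \<open>run_purified_alice\<close> with slices of last registers. The
  old environment is the outermost register here too, so \<open>f'\<close> is sliced before
  \<open>b\<close>, although \<open>b\<close> is the leading digit of \<open>f\<close>.\<close>

lemma run_purified_bob:
  assumes init: "to_alice \<pi> 0 = 1" "to_bob \<pi> 0 = 1"
    and A: "alice_kraus \<pi> A NA KA" and B: "bob_kraus \<pi> B NB KB"
    and i: "i \<le> steps \<pi>" and e: "e < env NA i" and f: "f < env NB i"
  shows "coblock (joint_dim \<pi> A B i) (env NB i) f
    (run_kraus \<pi> A (purified_bob \<pi> B NB KB) NA KA (\<lambda>_. 1) (\<lambda>i _. bob_isometry \<pi> B NB KB i) i e 0) =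
    run_kraus \<pi> A B NA KA NB KB i e f"
  using i e f
proof (induction i arbitrary: e f)
  case 0
  then show ?case
    by (intro eq_matI) (auto simp: coblock_def joint_dim_def init)
next
  case (Suc i)
  define E N where EN: "E = env NB i" "N = NB i"
  define e' a where ea: "e' = e div NA i" "a = e mod NA i"
  define f' b where fb: "f' = f mod E" "b = f div E"
  have i: "i < steps \<pi>" "i \<le> steps \<pi>" using Suc.prems by auto
  have pos: "NA i > 0" "E > 0" using Suc.prems by (auto intro!: gr0I simp: EN)
  have bounds: "e' < env NA i" "a < NA i" "f' < E" "b < N" and f: "f = b * E + f'"
    using Suc.prems pos by (auto simp: ea fb EN less_mult_imp_div_less mult.commute)
  let ?B = "purified_bob \<pi> B NB KB"
  let ?R = "run_kraus \<pi> A ?B NA KA (\<lambda>_. 1) (\<lambda>i _. bob_isometry \<pi> B NB KB i) i e' 0"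
  define c c' nA nB where c: "c = joint_dim \<pi> A B i" "c' = joint_dim \<pi> A B (Suc i)"
    "nA = memory A (Suc i) * to_bob \<pi> (Suc i)" "nB = to_alice \<pi> (Suc i) * memory B (Suc i)"
  have KA: "kraus (memory A i * to_alice \<pi> i) nA (local_op A i) {..<NA i} (KA i)"
    using A i by (simp add: alice_kraus_def c)
  have KB: "kraus (to_bob \<pi> i * memory B i) nB (local_op B i) {..<N} (KB i)"
    using B i by (simp add: bob_kraus_def c EN)
  define S where "S = costack (to_bob \<pi> i * memory B i) nB N (KB i)"
  have S: "S \<in> carrier_mat (nB * N) (to_bob \<pi> i * memory B i)" by (simp add: S_def)
  have L: "KA i a \<in> carrier_mat nA (memory A i * to_alice \<pi> i)" using krausD(4)[OF KA] bounds by simp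
  have LS: "KA i a \<otimes>\<^sub>m S \<in> carrier_mat (nA * nB * N) c"
    using tensor_carrier[OF L S] by (simp add: c joint_dim_def mult.assoc)
  have R: "?R \<in> carrier_mat (c * E) (memory A 0 * memory B 0)"
    using krausD(4)[OF kraus_run[OF init A purified_bob_kraus[OF B] i(2)], of "(e', 0)"] bounds
    by (simp add: c joint_dim_def EN mult.assoc)
  have X: "exchange_mat \<pi> A B i \<in> carrier_mat c' (nA * nB)"
    using exchange_mat_carrier[of \<pi> A B i] by (simp add: c)
  have X': "exchange_mat \<pi> A ?B i = exchange_mat \<pi> A B i \<otimes>\<^sub>m 1\<^sub>m N \<otimes>\<^sub>m 1\<^sub>m E"
    by (simp add: exchange_mat_def EN one_tensor_one[symmetric] tensor_assoc mult.commute[of "env NB i"])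
  have X1: "exchange_mat \<pi> A B i \<otimes>\<^sub>m 1\<^sub>m N \<in> carrier_mat (c' * N) (nA * nB * N)"
    by (rule tensor_carrier[OF X one_carrier_mat])
  define Z where "Z = (KA i a \<otimes>\<^sub>m S) * coblock c E f' ?R"
  have bR: "coblock c E f' ?R \<in> carrier_mat c (memory A 0 * memory B 0)" by (rule coblock_carrier[OF R])
  have Z: "Z \<in> carrier_mat (nA * nB * N) (memory A 0 * memory B 0)"
    unfolding Z_def by (rule mult_carrier_mat[OF LS bR])
  define Y where "Y = ((KA i a \<otimes>\<^sub>m S) \<otimes>\<^sub>m 1\<^sub>m E) * ?R"
  have Y: "Y \<in> carrier_mat (nA * nB * N * E) (memory A 0 * memory B 0)"
    unfolding Y_def by (rule mult_carrier_mat[OF tensor_carrier[OF LS one_carrier_mat] R])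
  have "run_kraus \<pi> A ?B NA KA (\<lambda>_. 1) (\<lambda>i _. bob_isometry \<pi> B NB KB i) (Suc i) e 0 =
      (exchange_mat \<pi> A B i \<otimes>\<^sub>m 1\<^sub>m N \<otimes>\<^sub>m 1\<^sub>m E) * Y"
    unfolding Y_def using R carrier_matD[OF tensor_carrier[OF LS one_carrier_mat[of E]]]
      carrier_matD[OF tensor_carrier[OF X1 one_carrier_mat[of E]]]
    by (simp add: X' mult_assoc_dim ea S_def EN c tensor_assoc del: dim_tensor)
  then have "coblock c' (N * E) f (run_kraus \<pi> A ?B NA KA (\<lambda>_. 1) (\<lambda>i _. bob_isometry \<pi> B NB KB i) (Suc i) e 0) =
      coblock c' N b (coblock (c' * N) E f' ((exchange_mat \<pi> A B i \<otimes>\<^sub>m 1\<^sub>m N \<otimes>\<^sub>m 1\<^sub>m E) * Y))"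
    using bounds by (simp add: coblock_coblock f)
  also have "coblock (c' * N) E f' ((exchange_mat \<pi> A B i \<otimes>\<^sub>m 1\<^sub>m N \<otimes>\<^sub>m 1\<^sub>m E) * Y) =
      (exchange_mat \<pi> A B i \<otimes>\<^sub>m 1\<^sub>m N) * coblock (nA * nB * N) E f' Y"
    by (rule coblock_tensor_one_mult[OF X1 Y bounds(3)])
  also have "coblock (nA * nB * N) E f' Y = Z"
    unfolding Y_def Z_def by (rule coblock_tensor_one_mult[OF LS R bounds(3)])
  also have "coblock c' N b ((exchange_mat \<pi> A B i \<otimes>\<^sub>m 1\<^sub>m N) * Z) = exchange_mat \<pi> A B i * coblock (nA * nB) N b Z"
    by (rule coblock_tensor_one_mult[OF X Z bounds(4)])
  also have "coblock (nA * nB) N b Z = coblock (nA * nB) N b (KA i a \<otimes>\<^sub>m S) * coblock c E f' ?R"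
    unfolding Z_def by (rule coblock_mult[OF LS bR bounds(4)])
  also have "coblock (nA * nB) N b (KA i a \<otimes>\<^sub>m S) = KA i a \<otimes>\<^sub>m KB i b"
    unfolding coblock_tensor[OF S L bounds(4)] using kraus_costack(2)[OF KB bounds(4)] by (simp add: S_def)
  also have "coblock c E f' ?R = run_kraus \<pi> A B NA KA NB KB i e' f'"
    unfolding c EN using Suc.IH[OF i(2), of e' f'] bounds by (simp add: EN)
  also have "exchange_mat \<pi> A B i * ((KA i a \<otimes>\<^sub>m KB i b) * run_kraus \<pi> A B NA KA NB KB i e' f') =
      run_kraus \<pi> A B NA KA NB KB (Suc i) e f"
    using krausD(4)[OF KB, of b] L X bounds krausD(4)[OF kraus_run[OF init A B i(2)], of "(e', f')"]
    by (simp add: ea fb EN mult_assoc_dim c joint_dim_def mult.assoc)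
  finally show ?case by (simp add: c EN mult.commute)
qed

section \<open>Purified inputs and ideal executions\<close>

definition bidx :: "'a::finite \<Rightarrow> nat" where
  "bidx = to_nat_on (UNIV :: 'a set)"

text \<open>The position of the entry 1 in \<open>ket u \<otimes>\<^sub>v ket v\<close>.\<close>

definition pidx :: "'u::finite \<Rightarrow> 'v::finite \<Rightarrow> nat" where
  "pidx u v = bidx u * CARD('v) + bidx v"

lemma bij_bidx: "bij_betw (bidx :: 'a::finite \<Rightarrow> nat) UNIV {..<CARD('a)}"
  unfolding bidx_def by (rule to_nat_on_finite) simp

lemma bidx_less [simp]: "bidx (a :: 'a::finite) < CARD('a)"
  using bij_betwE[OF bij_bidx] by blast

lemma bidx_inject [simp]: "bidx a = bidx b \<longleftrightarrow> a = b"
  using bij_bidx by (auto simp: bij_betw_def inj_def)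

lemma sum_bidx: "(\<Sum>i<CARD('a::finite). g i) = (\<Sum>a\<in>UNIV. g (bidx (a :: 'a)))"
  using sum.reindex_bij_betw[OF bij_bidx[where ?'a = 'a], of g] by simp

lemma pidx_less [simp]: "pidx (u :: 'u::finite) (v :: 'v::finite) < CARD('u) * CARD('v)"
  unfolding pidx_def by (intro index_less_mult) simp_all

lemma pidx_div_mod [simp]:
  "pidx (u :: 'u::finite) (v :: 'v::finite) div CARD('v) = bidx u" "pidx u v mod CARD('v) = bidx v"
  by (simp_all add: pidx_def)

lemma pidx_inject [simp]: "pidx u v = pidx u' v' \<longleftrightarrow> u = u' \<and> v = v'"
  by (metis bidx_inject pidx_div_mod)

lemma sum_pidx: "(\<Sum>i<CARD('u::finite) * CARD('v::finite). g i) = (\<Sum>u\<in>UNIV. \<Sum>v\<in>UNIV. g (pidx (u :: 'u) (v :: 'v)))"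
  by (simp add: sum_lessThan_mult sum_bidx pidx_def)

lemma dim_ket [simp]: "dim_vec (ket (a :: 'a::finite)) = CARD('a)"
  by (simp add: ket_def)

lemma index_ket [simp]: "i < CARD('a) \<Longrightarrow> ket (a :: 'a::finite) $ i = of_bool (i = bidx a)"
  using bidx_less[of a] unfolding bidx_def by (simp add: ket_def)

lemma dim_tensor_vec [simp]: "dim_vec (v \<otimes>\<^sub>v w) = dim_vec v * dim_vec w"
  by (simp add: tensor_vec_def)

lemma index_tensor_ket:
  assumes "i < CARD('u) * CARD('v)"
  shows "(ket (u :: 'u::finite) \<otimes>\<^sub>v ket (v :: 'v::finite)) $ i = of_bool (i = pidx u v)"
proof -
  have "i = pidx u v \<longleftrightarrow> i div CARD('v) = bidx u \<and> i mod CARD('v) = bidx v"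
    by (metis div_mult_mod_eq pidx_def pidx_div_mod)
  then show ?thesis using assms by (simp add: tensor_vec_def less_mult_imp_div_less)
qed

section \<open>The canonical purification and the fidelity of two channels applied to it\<close>

lemma purification_vec_index:
  fixes p :: "('u::finite \<times> 'v::finite) pmf"
  assumes "r < CARD('u) * CARD('v)"
  shows "purification_vec p $ (r * (CARD('u) * CARD('v)) + pidx u v) = of_bool (r = pidx u v) * sqrt (pmf p (u, v))"
proof -
  let ?D = "CARD('u) * CARD('v)"
  have "r * ?D + pidx u v < ?D * ?D" by (intro index_less_mult assms) simp
  moreover have "((ket u' \<otimes>\<^sub>v ket v') \<otimes>\<^sub>v (ket u' \<otimes>\<^sub>v ket v')) $ (r * ?D + pidx u v) =
      of_bool (r = pidx u' v') * of_bool (u' = u \<and> v' = v)" for u' :: 'u and v' :: 'v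
    using calculation assms unfolding tensor_vec_def[of "ket u' \<otimes>\<^sub>v ket v'"]
    by (auto simp: index_tensor_ket)
  ultimately have "purification_vec p $ (r * ?D + pidx u v) =
      (\<Sum>u'\<in>UNIV. \<Sum>v'\<in>UNIV. of_bool (u' = u) * (of_bool (v' = v) * (of_bool (r = pidx u' v') * complex_of_real (sqrt (pmf p (u', v'))))))"
    by (simp add: purification_vec_def of_bool_conj mult_ac)
  also have "\<dots> = of_bool (r = pidx u v) * sqrt (pmf p (u, v))"
    by (simp add: sum_of_bool flip: sum_distrib_left)
  finally show ?thesis .
qed

lemma dim_purification_vec [simp]:
  "dim_vec (purification_vec (p :: ('u::finite \<times> 'v::finite) pmf)) = CARD('u) * CARD('v) * (CARD('u) * CARD('v))"
  by (simp add: purification_vec_def)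

text \<open>The reference register carries a copy of the input, so fixing its value to
  \<open>pidx u v\<close> leaves only this input column of \<open>K\<close>, weighted by its
  amplitude.\<close>

lemma one_tensor_purification:
  fixes p :: "('u::finite \<times> 'v::finite) pmf"
  defines "D \<equiv> CARD('u) * CARD('v)"
  assumes K: "K \<in> carrier_mat n D" and x: "x < n"
  shows "(\<Sum>q<D * D. (1\<^sub>m D \<otimes>\<^sub>m K) $$ (pidx u v * n + x, q) * purification_vec p $ q) =
    sqrt (pmf p (u, v)) * K $$ (x, pidx (u :: 'u) (v :: 'v))"
proof -
  have r: "pidx u v < D" by (simp add: D_def)
  have "(\<Sum>q<D * D. (1\<^sub>m D \<otimes>\<^sub>m K) $$ (pidx u v * n + x, q) * purification_vec p $ q) =
      (\<Sum>i<D. \<Sum>j<D. of_bool (pidx u v = i) * (K $$ (x, j) * purification_vec p $ (i * D + j)))"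
    unfolding sum_lessThan_mult using r x
    by (intro sum.cong refl) (simp add: index_tensor'[OF one_carrier_mat K])
  also have "\<dots> = (\<Sum>j<D. K $$ (x, j) * purification_vec p $ (pidx u v * D + j))"
    using r by (simp only: sum_distrib_left[symmetric] sum_of_bool finite_lessThan lessThan_iff)
  also have "\<dots> = (\<Sum>u'\<in>UNIV. \<Sum>v'\<in>UNIV. of_bool (u' = u) * (of_bool (v' = v) * (K $$ (x, pidx u' v') * sqrt (pmf p (u', v')))))"
    unfolding D_def sum_pidx by (intro sum.cong refl) (auto simp: purification_vec_index)
  also have "\<dots> = sqrt (pmf p (u, v)) * K $$ (x, pidx u v)"
    by (simp add: sum_of_bool flip: sum_distrib_left)
  finally show ?thesis .
qed

lemma kraus_purified_input:
  fixes p :: "('u::finite \<times> 'v::finite) pmf"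
  assumes K: "kraus (CARD('u) * CARD('v)) n \<Lambda> I K" and x: "x < n" "y < n"
  shows "app (id_channel (CARD('u) * CARD('v)) \<otimes>\<^sub>c \<Lambda>) (purified_input p) $$ (pidx u v * n + x, pidx u' v' * n + y) =
    (\<Sum>a\<in>I. (sqrt (pmf p (u, v)) * K a $$ (x, pidx (u :: 'u) (v :: 'v))) *
      cnj (sqrt (pmf p (u', v')) * K a $$ (y, pidx (u' :: 'u) (v' :: 'v))))"
proof -
  define D where "D = CARD('u) * CARD('v)"
  have K: "kraus D n \<Lambda> I K" using K by (simp add: D_def)
  let ?\<psi> = "purification_vec p"
  have \<rho>: "purified_input p \<in> carrier_mat (D * D) (D * D)" by (simp add: purified_input_def ketbra_def D_def)
  have \<rho>': "purified_input p $$ (i, j) = ?\<psi> $ i * cnj (?\<psi> $ j)" if "i < D * D" "j < D * D" for i j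
    using that by (simp add: purified_input_def ketbra_def D_def)
  have "app (id_channel D \<otimes>\<^sub>c \<Lambda>) (purified_input p) $$ (pidx u v * n + x, pidx u' v' * n + y) =
    (\<Sum>a\<in>I. \<Sum>i<D * D. \<Sum>j<D * D. (1\<^sub>m D \<otimes>\<^sub>m K a) $$ (pidx u v * n + x, i) * purified_input p $$ (i, j) *
        cnj ((1\<^sub>m D \<otimes>\<^sub>m K a) $$ (pidx u' v' * n + y, j)))"
  proof -
    have "pidx u v * n + x < D * n" "pidx u' v' * n + y < D * n" using x by (auto intro!: index_less_mult simp: D_def)
    from krausD(6)[OF kraus_tensor[OF kraus_id[of D "()"] K] \<rho> this]
    show ?thesis by (simp only: sum.cartesian_product' prod.case) simp
  qed
  also have "\<dots> = (\<Sum>a\<in>I. (\<Sum>i<D * D. (1\<^sub>m D \<otimes>\<^sub>m K a) $$ (pidx u v * n + x, i) * ?\<psi> $ i) *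
       cnj (\<Sum>j<D * D. (1\<^sub>m D \<otimes>\<^sub>m K a) $$ (pidx u' v' * n + y, j) * ?\<psi> $ j))"
    by (intro sum.cong refl) (simp add: \<rho>' sum_product mult_ac)
  also have "\<dots> = (\<Sum>a\<in>I. (sqrt (pmf p (u, v)) * K a $$ (x, pidx u v)) * cnj (sqrt (pmf p (u', v')) * K a $$ (y, pidx u' v')))"
    using krausD(4)[OF K] x unfolding D_def by (intro sum.cong refl) (simp only: one_tensor_purification)
  finally show ?thesis by (simp add: D_def)
qed

text \<open>Neither channel touches the reference register, which holds a copy of the input. The
  overlap is therefore a \<open>p\<close>-average of overlaps for single inputs, while a single
  \<open>W\<close> serves all inputs because it acts on Kraus indices alone.\<close>

lemma uhlmann_purified:
  fixes p :: "('u::finite \<times> 'v::finite) pmf"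
  assumes K: "kraus (CARD('u) * CARD('v)) n \<Lambda> I K" and L: "kraus (CARD('u) * CARD('v)) n \<Gamma> J L"
  defines "F \<equiv> fidelity (app (id_channel (CARD('u) * CARD('v)) \<otimes>\<^sub>c \<Lambda>) (purified_input p))
     (app (id_channel (CARD('u) * CARD('v)) \<otimes>\<^sub>c \<Gamma>) (purified_input p))"
  shows "0 \<le> F"
    and "\<exists>W. (\<forall>g. (\<Sum>b\<in>J. (cmod (\<Sum>a\<in>I. g a * W a b))\<^sup>2) \<le> (\<Sum>a\<in>I. (cmod (g a))\<^sup>2)) \<and>
      F = Re (\<Sum>u\<in>UNIV. \<Sum>v\<in>UNIV. pmf p (u, v) * (\<Sum>x<n. \<Sum>b\<in>J.
        (\<Sum>a\<in>I. K a $$ (x, pidx (u :: 'u) (v :: 'v)) * W a b) * cnj (L b $$ (x, pidx u v))))"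
proof -
  define D where "D = CARD('u) * CARD('v)"
  let ?\<psi> = "purification_vec p"
  define s where "s r = ?\<psi> $ (r * D + r)" for r
  have s: "s (pidx u v) = sqrt (pmf p (u, v))" for u :: 'u and v :: 'v
    using purification_vec_index[of "pidx u v" p u v] by (simp add: s_def D_def)
  \<comment> \<open>In the index \<open>z\<close> the digit \<open>z div n\<close> is the reference
    value, which also selects the input column, and \<open>z mod n\<close> is the output.\<close>
  define m where "m a z = s (z div n) * K a $$ (z mod n, z div n)" for a z
  define k where "k b z = s (z div n) * L b $$ (z mod n, z div n)" for b z
  have surj: "\<exists>(u :: 'u) (v :: 'v) x. x < n \<and> z = pidx u v * n + x" if z: "z < D * n" for z
  proof -
    have n: "n > 0" using z by (cases n) auto
    have "z div n div CARD('v) < CARD('u)" "z div n mod CARD('v) < CARD('v)"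
      using z n by (auto simp: D_def less_mult_imp_div_less)
    then obtain u :: 'u and v :: 'v where "bidx u = z div n div CARD('v)" "bidx v = z div n mod CARD('v)"
      using bij_bidx[where 'a = 'u] bij_bidx[where 'a = 'v] unfolding bij_betw_def by (metis imageE lessThan_iff)
    then have "pidx u v = z div n" by (simp add: pidx_def)
    then have "z = pidx u v * n + z mod n" by simp
    then show ?thesis using n by (metis mod_less_divisor)
  qed
  have idC: "kraus D D (id_channel D) {()} (\<lambda>_. 1\<^sub>m D)" by (rule kraus_id)
  have in_c: "purified_input p \<in> carrier_mat (D * D) (D * D)" by (simp add: purified_input_def ketbra_def D_def)
  have car: "app (id_channel D \<otimes>\<^sub>c \<Lambda>) (purified_input p) \<in> carrier_mat (D * n) (D * n)"
    "app (id_channel D \<otimes>\<^sub>c \<Gamma>) (purified_input p) \<in> carrier_mat (D * n) (D * n)"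
    using krausD(5)[OF kraus_tensor[OF idC K[folded D_def]] in_c] krausD(5)[OF kraus_tensor[OF idC L[folded D_def]] in_c]
    by simp_all
  have rho: "app (id_channel D \<otimes>\<^sub>c \<Lambda>) (purified_input p) $$ (z, z') = (\<Sum>a\<in>I. m a z * cnj (m a z'))"
    "app (id_channel D \<otimes>\<^sub>c \<Gamma>) (purified_input p) $$ (z, z') = (\<Sum>b\<in>J. k b z * cnj (k b z'))"
    if zz: "z < D * n" "z' < D * n" for z z'
  proof -
    obtain u v x u' v' x' where z: "x < n" "z = pidx (u :: 'u) (v :: 'v) * n + x" "x' < n" "z' = pidx (u' :: 'u) (v' :: 'v) * n + x'"
      using surj[OF zz(1)] surj[OF zz(2)] by blast
    show "app (id_channel D \<otimes>\<^sub>c \<Lambda>) (purified_input p) $$ (z, z') = (\<Sum>a\<in>I. m a z * cnj (m a z'))"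
      using kraus_purified_input[OF K z(1,3), of p u v u' v'] z by (simp add: D_def m_def s)
    show "app (id_channel D \<otimes>\<^sub>c \<Gamma>) (purified_input p) $$ (z, z') = (\<Sum>b\<in>J. k b z * cnj (k b z'))"
      using kraus_purified_input[OF L z(1,3), of p u v u' v'] z by (simp add: D_def k_def s)
  qed
  note U = uhlmann_family[OF krausD(1)[OF K] krausD(1)[OF L] car rho]
  show "0 \<le> F" using U(1) by (simp add: F_def D_def)
  obtain W where W: "\<And>g. (\<Sum>b\<in>J. (cmod (\<Sum>a\<in>I. g a * W a b))\<^sup>2) \<le> (\<Sum>a\<in>I. (cmod (g a))\<^sup>2)"
    and F: "F = Re (\<Sum>z<D * n. \<Sum>b\<in>J. (\<Sum>a\<in>I. m a z * W a b) * cnj (k b z))"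
    using U(2) unfolding F_def D_def by blast
  have "(\<Sum>z<D * n. \<Sum>b\<in>J. (\<Sum>a\<in>I. m a z * W a b) * cnj (k b z)) =
      (\<Sum>u\<in>UNIV. \<Sum>v\<in>UNIV. \<Sum>x<n. \<Sum>b\<in>J. (\<Sum>a\<in>I. m a (pidx (u :: 'u) (v :: 'v) * n + x) * W a b) * cnj (k b (pidx u v * n + x)))"
    unfolding sum_lessThan_mult[where m = D] unfolding D_def sum_pidx ..
  also have "\<dots> = (\<Sum>u\<in>UNIV. \<Sum>v\<in>UNIV. pmf p (u, v) * (\<Sum>x<n. \<Sum>b\<in>J.
        (\<Sum>a\<in>I. K a $$ (x, pidx (u :: 'u) (v :: 'v)) * W a b) * cnj (L b $$ (x, pidx u v))))"
  proof (intro sum.cong refl)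
    fix u :: 'u and v :: 'v
    have "(\<Sum>a\<in>I. m a (pidx u v * n + x) * W a b) * cnj (k b (pidx u v * n + x)) =
      pmf p (u, v) * ((\<Sum>a\<in>I. K a $$ (x, pidx u v) * W a b) * cnj (L b $$ (x, pidx u v)))" if "x < n" for x b
    proof -
      have "(\<Sum>a\<in>I. m a (pidx u v * n + x) * W a b) = sqrt (pmf p (u, v)) * (\<Sum>a\<in>I. K a $$ (x, pidx u v) * W a b)"
        using that by (simp add: m_def s sum_distrib_left mult.assoc)
      moreover have "complex_of_real (sqrt (pmf p (u, v))) * complex_of_real (sqrt (pmf p (u, v))) = pmf p (u, v)"
        by (simp flip: of_real_mult)
      ultimately show ?thesis using that by (simp add: k_def s mult_ac)
    qed
    then show "(\<Sum>x<n. \<Sum>b\<in>J. (\<Sum>a\<in>I. m a (pidx u v * n + x) * W a b) * cnj (k b (pidx u v * n + x))) =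
      pmf p (u, v) * (\<Sum>x<n. \<Sum>b\<in>J. (\<Sum>a\<in>I. K a $$ (x, pidx u v) * W a b) * cnj (L b $$ (x, pidx u v)))"
      unfolding sum_distrib_left by (intro sum.cong refl) auto
  qed
  finally show "\<exists>W. (\<forall>g. (\<Sum>b\<in>J. (cmod (\<Sum>a\<in>I. g a * W a b))\<^sup>2) \<le> (\<Sum>a\<in>I. (cmod (g a))\<^sup>2)) \<and>
      F = Re (\<Sum>u\<in>UNIV. \<Sum>v\<in>UNIV. pmf p (u, v) * (\<Sum>x<n. \<Sum>b\<in>J.
        (\<Sum>a\<in>I. K a $$ (x, pidx (u :: 'u) (v :: 'v)) * W a b) * cnj (L b $$ (x, pidx u v))))"
    using W F by (intro exI[of _ W]) simp
qed

text \<open>For \<open>F \<le> 1\<close> this follows from \<open>F\<^sup>2 \<le> F\<close>; for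
  larger \<open>F\<close> it is immediate.\<close>

lemma eps_close_fidelity:
  assumes "eps_close \<epsilon> \<rho> \<sigma>" "0 \<le> \<epsilon>" "0 \<le> fidelity \<rho> \<sigma>"
  shows "1 - \<epsilon>\<^sup>2 \<le> fidelity \<rho> \<sigma>"
proof -
  let ?F = "fidelity \<rho> \<sigma>"
  have "1 - ?F\<^sup>2 \<le> \<epsilon>\<^sup>2"
    using assms unfolding eps_close_def by (meson sqrt_le_D)
  show ?thesis
  proof (cases "?F \<le> 1")
    case True
    then have "?F\<^sup>2 \<le> ?F" using assms(3) by (simp add: power2_eq_square mult_left_le)
    then show ?thesis using \<open>1 - ?F\<^sup>2 \<le> \<epsilon>\<^sup>2\<close> by simp
  next
    case False
    then show ?thesis by (smt (verit) zero_le_power2)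
  qed
qed

text \<open>The Stinespring isometry preserves the norm of the vector with coefficients
  \<open>h\<close>.\<close>

lemma kraus_norm:
  assumes K: "kraus m n \<Lambda> I K"
  shows "(\<Sum>b\<in>I. \<Sum>y<n. (cmod (\<Sum>i<m. K b $$ (y, i) * h i))\<^sup>2) = (\<Sum>i<m. (cmod (h i))\<^sup>2)"
proof -
  let ?T = "\<lambda>b y i j. K b $$ (y, i) * h i * cnj (K b $$ (y, j) * h j)"
  have "complex_of_real (\<Sum>b\<in>I. \<Sum>y<n. (cmod (\<Sum>i<m. K b $$ (y, i) * h i))\<^sup>2) =
      (\<Sum>b\<in>I. \<Sum>y<n. \<Sum>i<m. \<Sum>j<m. ?T b y i j)"
    unfolding of_real_sum complex_norm_square cnj_sum sum_product ..
  also have "\<dots> = (\<Sum>i<m. \<Sum>b\<in>I. \<Sum>y<n. \<Sum>j<m. ?T b y i j)" by (rule sum_swap3)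
  also have "\<dots> = (\<Sum>i<m. \<Sum>j<m. \<Sum>b\<in>I. \<Sum>y<n. ?T b y i j)" by (rule sum.cong[OF refl], rule sum_swap3)
  also have "\<dots> = (\<Sum>i<m. \<Sum>j<m. (h i * cnj (h j)) * of_bool (i = j))"
  proof (intro sum.cong refl)
    fix i j assume "i \<in> {..<m}" "j \<in> {..<m}"
    then have e: "(\<Sum>a\<in>I. \<Sum>r<n. K a $$ (r, i) * cnj (K a $$ (r, j))) = of_bool (i = j)" by (simp add: krausD(7)[OF K])
    show "(\<Sum>b\<in>I. \<Sum>y<n. ?T b y i j) = (h i * cnj (h j)) * of_bool (i = j)"
      by (simp only: e[symmetric] sum_distrib_left mult_ac complex_cnj_mult)
  qed
  also have "\<dots> = complex_of_real (\<Sum>i<m. (cmod (h i))\<^sup>2)"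
    unfolding of_real_sum complex_norm_square by (intro sum.cong refl) (simp add: sum_of_bool)
  finally show ?thesis by (simp only: of_real_eq_iff)
qed

lemma kraus_column_norm:
  assumes K: "kraus m n \<Lambda> I K" and i: "i < m"
  shows "(\<Sum>b\<in>I. \<Sum>y<n. (cmod (K b $$ (y, i)))\<^sup>2) = 1"
proof -
  have "(\<Sum>j<m. K b $$ (y, j) * of_bool (j = i)) = K b $$ (y, i)" for b y
    using i by (subst sum_of_bool) auto
  moreover have "(\<Sum>j<m. (cmod (of_bool (j = i)))\<^sup>2) = (\<Sum>j<m. if j = i then 1 else 0)"
    by (intro sum.cong) auto
  ultimately show ?thesis using kraus_norm[OF K, of "\<lambda>j. of_bool (j = i)"] i by simp
qed

section \<open>The ideal functionality and executions with a simulator\<close>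

definition functionality_kraus :: "('u::finite \<Rightarrow> 'v::finite \<Rightarrow> 'z::finite) \<Rightarrow> 'u \<times> 'v \<Rightarrow> complex mat" where
  "functionality_kraus f = (\<lambda>(u, v). mat (CARD('z) * CARD('z)) (CARD('u) * CARD('v))
     (\<lambda>(r, i). of_bool (r = pidx (f u v) (f u v)) * of_bool (i = pidx u v)))"

lemma kraus_functionality:
  fixes f :: "'u::finite \<Rightarrow> 'v::finite \<Rightarrow> 'z::finite"
  shows "kraus (CARD('u) * CARD('v)) (CARD('z) * CARD('z)) (ideal_functionality f) UNIV (functionality_kraus f)"
  unfolding kraus_def
proof (intro conjI ballI allI impI)
  let ?D = "CARD('u) * CARD('v)" and ?Z = "CARD('z) * CARD('z)"
  fix \<rho> :: "complex mat" and r s assume \<rho>: "\<rho> \<in> carrier_mat ?D ?D" and rs: "r < ?Z" "s < ?Z"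
  have q: "(\<rho> *\<^sub>v (ket u \<otimes>\<^sub>v ket v)) \<bullet>c (ket u \<otimes>\<^sub>v ket v) = \<rho> $$ (pidx u v, pidx u v)" for u :: 'u and v :: 'v
  proof -
    have "(\<rho> *\<^sub>v (ket u \<otimes>\<^sub>v ket v)) \<bullet>c (ket u \<otimes>\<^sub>v ket v) =
        (\<Sum>i<?D. \<Sum>j<?D. \<rho> $$ (i, j) * (ket u \<otimes>\<^sub>v ket v) $ j * cnj ((ket u \<otimes>\<^sub>v ket v) $ i))"
      by (rule quadratic_form[OF \<rho>]) (intro carrier_vecI, simp)
    also have "\<dots> =
        (\<Sum>i<?D. of_bool (i = pidx u v) * (\<Sum>j<?D. of_bool (j = pidx u v) * \<rho> $$ (i, j)))"
      unfolding sum_distrib_left by (intro sum.cong refl) (auto simp: index_tensor_ket)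
    finally show ?thesis by (simp add: sum_of_bool)
  qed
  have t: "(ketbra (ket z) (ket z) \<otimes>\<^sub>m ketbra (ket z) (ket z)) $$ (r, s) = of_bool (r = pidx z z) * of_bool (s = pidx z z)" for z :: 'z
  proof -
    have "r = pidx z z \<longleftrightarrow> r div CARD('z) = bidx z \<and> r mod CARD('z) = bidx z" for r
      by (metis div_mult_mod_eq pidx_def pidx_div_mod)
    moreover have "ketbra (ket z) (ket z) \<in> carrier_mat CARD('z) CARD('z)" by (simp add: ketbra_def)
    ultimately show ?thesis using rs
      by (subst index_tensor) (auto simp: ketbra_def less_mult_imp_div_less)
  qed
  have "app (ideal_functionality f) \<rho> $$ (r, s) = (\<Sum>u\<in>UNIV. \<Sum>v\<in>UNIV. \<rho> $$ (pidx u v, pidx u v) *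
      (of_bool (r = pidx (f u v) (f u v)) * of_bool (s = pidx (f u v) (f u v))))"
    using rs by (simp add: ideal_functionality_def q t)
  also have "\<dots> = (\<Sum>u\<in>UNIV. \<Sum>v\<in>UNIV. \<Sum>i<?D. \<Sum>j<?D. functionality_kraus f (u, v) $$ (r, i) * \<rho> $$ (i, j) *
      cnj (functionality_kraus f (u, v) $$ (s, j)))"
  proof (intro sum.cong refl)
    fix u :: 'u and v :: 'v
    have "(\<Sum>i<?D. \<Sum>j<?D. functionality_kraus f (u, v) $$ (r, i) * \<rho> $$ (i, j) *
      cnj (functionality_kraus f (u, v) $$ (s, j))) =
      (\<Sum>i<?D. of_bool (i = pidx u v) * (\<Sum>j<?D. of_bool (j = pidx u v) *
        (of_bool (r = pidx (f u v) (f u v)) * of_bool (s = pidx (f u v) (f u v)) * \<rho> $$ (i, j))))"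
      unfolding sum_distrib_left using rs
      by (intro sum.cong refl) (simp add: functionality_kraus_def mult_ac)
    also have "\<dots> = \<rho> $$ (pidx u v, pidx u v) * (of_bool (r = pidx (f u v) (f u v)) * of_bool (s = pidx (f u v) (f u v)))"
      by (simp only: sum_of_bool finite_lessThan lessThan_iff pidx_less mult_ac)
    finally show "\<rho> $$ (pidx u v, pidx u v) * (of_bool (r = pidx (f u v) (f u v)) * of_bool (s = pidx (f u v) (f u v))) =
      (\<Sum>i<?D. \<Sum>j<?D. functionality_kraus f (u, v) $$ (r, i) * \<rho> $$ (i, j) *
      cnj (functionality_kraus f (u, v) $$ (s, j)))" by simp
  qed
  finally show "app (ideal_functionality f) \<rho> $$ (r, s) = (\<Sum>a\<in>UNIV. \<Sum>i<?D. \<Sum>j<?D.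
      functionality_kraus f a $$ (r, i) * \<rho> $$ (i, j) * cnj (functionality_kraus f a $$ (s, j)))"
    by (simp only: UNIV_Times_UNIV[symmetric] sum.cartesian_product')
next
  let ?D = "CARD('u) * CARD('v)" and ?Z = "CARD('z) * CARD('z)"
  fix i j assume ij: "i < ?D" "j < ?D"
  have "(\<Sum>r<?Z. functionality_kraus f (u, v) $$ (r, i) * cnj (functionality_kraus f (u, v) $$ (r, j))) =
      of_bool (i = pidx u v) * of_bool (j = pidx u v)" for u v
  proof -
    have "(\<Sum>r<?Z. functionality_kraus f (u, v) $$ (r, i) * cnj (functionality_kraus f (u, v) $$ (r, j))) =
      (\<Sum>r<?Z. of_bool (r = pidx (f u v) (f u v)) * (of_bool (i = pidx u v) * of_bool (j = pidx u v)))"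
      using ij by (intro sum.cong refl) (simp add: functionality_kraus_def)
    then show ?thesis by (simp only: sum_of_bool finite_lessThan lessThan_iff pidx_less)
  qed
  then have "(\<Sum>a\<in>UNIV. \<Sum>r<?Z. functionality_kraus f a $$ (r, i) * cnj (functionality_kraus f a $$ (r, j))) =
      (\<Sum>u\<in>UNIV. \<Sum>v\<in>UNIV. of_bool (i = pidx (u :: 'u) (v :: 'v)) * of_bool (j = pidx u v))"
    by (simp only: UNIV_Times_UNIV[symmetric] sum.cartesian_product')
  also have "\<dots> = (\<Sum>z<?D. of_bool (i = z) * of_bool (j = z))" unfolding sum_pidx ..
  also have "\<dots> = of_bool (i = j)" using ij by (subst sum_of_bool) auto
  finally show "(\<Sum>a\<in>UNIV. \<Sum>r<?Z. functionality_kraus f a $$ (r, i) * cnj (functionality_kraus f a $$ (r, j))) = of_bool (i = j)" .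
qed (auto simp: ideal_functionality_def functionality_kraus_def)

text \<open>In the Kraus index \<open>(a, (u, w), b)\<close> the value \<open>w\<close> is the input that the simulator submits for Bob.
  Its distribution \<open>L\<close> does not depend on Alice's input.\<close>

lemma kraus_ideal_execution:
  fixes f :: "'u::finite \<Rightarrow> 'v::finite \<Rightarrow> 'z::finite"
  assumes \<Lambda>1: "cptp CARD('v) (CARD('v) * k) \<Lambda>1" and \<Lambda>2: "cptp (CARD('z) * k) d \<Lambda>2"
  shows "\<exists>(J :: (nat \<times> ('u \<times> 'v) \<times> nat) set) R (L :: 'v \<Rightarrow> 'v \<Rightarrow> real).
    kraus (CARD('u) * CARD('v)) (CARD('z) * d) (ideal_execution f k \<Lambda>1 \<Lambda>2) J R \<and>
    (\<forall>j\<in>J. \<forall>u (v :: 'v) z y. y < d \<longrightarrow> R j $$ (bidx z * d + y, pidx u v) \<noteq> 0 \<longrightarrow> z = f u (snd (fst (snd j)))) \<and>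
    (\<forall>(u :: 'u) v w. (\<Sum>z\<in>(UNIV :: 'z set). \<Sum>y<d. \<Sum>j\<in>J. of_bool (snd (fst (snd j)) = w) * (cmod (R j $$ (bidx z * d + y, pidx u v)))\<^sup>2) = L v w)"
proof -
  obtain N1 K1 where K1: "kraus CARD('v) (CARD('v) * k) \<Lambda>1 {..<N1::nat} K1" using cptp_kraus[OF \<Lambda>1] by blast
  obtain N2 K2 where K2: "kraus (CARD('z) * k) d \<Lambda>2 {..<N2::nat} K2" using cptp_kraus[OF \<Lambda>2] by blast
  define J where "J = {..<N1} \<times> (UNIV :: ('u \<times> 'v) set) \<times> {..<N2}"
  define R where "R = (\<lambda>(a, x, b). (1\<^sub>m CARD('z) \<otimes>\<^sub>m K2 b) * (functionality_kraus f x \<otimes>\<^sub>m 1\<^sub>m k) * (1\<^sub>m CARD('u) \<otimes>\<^sub>m K1 a))"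
  \<comment> \<open>The probability that the first simulator map, applied to \<open>v\<close>, hands
    \<open>w\<close> to the functionality. Alice's input does not occur in it.\<close>
  define L where "L v w = (\<Sum>a<N1. \<Sum>\<kappa><k. (cmod (K1 a $$ (bidx w * k + \<kappa>, bidx v)))\<^sup>2)" for v w :: 'v
  have F: "functionality_kraus f x \<in> carrier_mat (CARD('z) * CARD('z)) (CARD('u) * CARD('v))" for x
    by (cases x) (simp add: functionality_kraus_def)
  have KR: "kraus (CARD('u) * CARD('v)) (CARD('z) * d) (ideal_execution f k \<Lambda>1 \<Lambda>2) J R"
  proof -
    have a: "kraus (CARD('u) * CARD('v)) (CARD('u) * CARD('v) * k) (id_channel CARD('u) \<otimes>\<^sub>c \<Lambda>1) ({()} \<times> {..<N1})
        (\<lambda>(_, a). 1\<^sub>m CARD('u) \<otimes>\<^sub>m K1 a)"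
      using kraus_tensor[OF kraus_id[of "CARD('u)" "()"] K1] by (simp add: mult.assoc)
    have b: "kraus (CARD('u) * CARD('v) * k) (CARD('z) * (CARD('z) * k)) (ideal_functionality f \<otimes>\<^sub>c id_channel k) (UNIV \<times> {()})
        (\<lambda>(x, _). functionality_kraus f x \<otimes>\<^sub>m 1\<^sub>m k)"
      using kraus_tensor[OF kraus_functionality[of f] kraus_id[of k "()"]] by (simp add: mult.assoc)
    have c: "kraus (CARD('z) * (CARD('z) * k)) (CARD('z) * d) (id_channel CARD('z) \<otimes>\<^sub>c \<Lambda>2) ({()} \<times> {..<N2})
        (\<lambda>(_, b). 1\<^sub>m CARD('z) \<otimes>\<^sub>m K2 b)"
      by (rule kraus_tensor[OF kraus_id K2])
    define h where "h = (\<lambda>(a::nat, x :: 'u \<times> 'v, b::nat). (((), a), ((x, ()), ((), b))))"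
    have h: "bij_betw h J (({()} \<times> {..<N1}) \<times> ((UNIV \<times> {()}) \<times> ({()} \<times> {..<N2})))"
      by (rule bij_betw_byWitness[where f' = "\<lambda>((_, a), ((x, _), (_, b))). (a, x, b)"]) (auto simp: h_def J_def)
    show ?thesis unfolding ideal_execution_def
      by (rule kraus_reindex[OF kraus_comp[OF a kraus_comp[OF b c]] h]) (auto simp: h_def R_def)
  qed
  \<comment> \<open>Here \<open>s\<close> is the pair of outputs of the functionality and \<kappa>
    the state of the simulator's auxiliary register.\<close>
  have T: "((functionality_kraus f (u, w) \<otimes>\<^sub>m 1\<^sub>m k) * (1\<^sub>m CARD('u) \<otimes>\<^sub>m K1 a)) $$ (s * k + \<kappa>, pidx u' v) =
      of_bool (s = pidx (f u w) (f u w)) * of_bool (u = u') * K1 a $$ (bidx w * k + \<kappa>, bidx v)"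
    if "a < N1" "s < CARD('z) * CARD('z)" "\<kappa> < k" for u u' :: 'u and v w :: 'v and a s \<kappa>
  proof -
    have Ka: "K1 a \<in> carrier_mat (CARD('v) * k) CARD('v)" using krausD(4)[OF K1] that(1) by simp
    have "((functionality_kraus f (u, w) \<otimes>\<^sub>m 1\<^sub>m k) * (1\<^sub>m CARD('u) \<otimes>\<^sub>m K1 a)) $$ (s * k + \<kappa>, pidx u' v) =
      (\<Sum>q<CARD('u) * CARD('v) * k. (functionality_kraus f (u, w) \<otimes>\<^sub>m 1\<^sub>m k) $$ (s * k + \<kappa>, q) * (1\<^sub>m CARD('u) \<otimes>\<^sub>m K1 a) $$ (q, pidx u' v))"
      using carrier_matD[OF F[of "(u, w)"]] carrier_matD[OF Ka] that index_less_mult[OF that(2,3)]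
      by (subst index_mult_sum) (auto simp: index_less_mult mult.assoc)
    also have "\<dots> = (\<Sum>u1\<in>UNIV. \<Sum>w1\<in>UNIV. \<Sum>\<kappa>1<k. (functionality_kraus f (u, w) \<otimes>\<^sub>m 1\<^sub>m k) $$ (s * k + \<kappa>, pidx u1 w1 * k + \<kappa>1) *
         (1\<^sub>m CARD('u) \<otimes>\<^sub>m K1 a) $$ (bidx (u1 :: 'u) * (CARD('v) * k) + (bidx (w1 :: 'v) * k + \<kappa>1), bidx u' * CARD('v) + bidx v))"
      unfolding sum_lessThan_mult[where n = k] sum_pidx by (simp add: pidx_def add_mult_distrib mult.assoc add.assoc)
    also have "\<dots> = (\<Sum>u1\<in>UNIV. of_bool (u1 = u) * (\<Sum>w1\<in>UNIV. of_bool (w1 = w) * (\<Sum>\<kappa>1<k. of_bool (\<kappa> = \<kappa>1) *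
         (of_bool (s = pidx (f u w) (f u w)) * of_bool (u1 = u') * K1 a $$ (bidx w1 * k + \<kappa>1, bidx v)))))"
      unfolding sum_distrib_left
    proof (intro sum.cong refl)
      fix u1 :: 'u and w1 :: 'v and \<kappa>1 assume "\<kappa>1 \<in> {..<k}"
      then have k1: "\<kappa>1 < k" by simp
      have 1: "(functionality_kraus f (u, w) \<otimes>\<^sub>m 1\<^sub>m k) $$ (s * k + \<kappa>, pidx u1 w1 * k + \<kappa>1) =
          of_bool (s = pidx (f u w) (f u w)) * (of_bool (u1 = u) * of_bool (w1 = w)) * of_bool (\<kappa> = \<kappa>1)"
        using that k1 by (subst index_tensor'[OF F one_carrier_mat]) (auto simp: functionality_kraus_def)
      have 2: "(1\<^sub>m CARD('u) \<otimes>\<^sub>m K1 a) $$ (bidx u1 * (CARD('v) * k) + (bidx w1 * k + \<kappa>1), bidx u' * CARD('v) + bidx v) =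
          of_bool (u1 = u') * K1 a $$ (bidx w1 * k + \<kappa>1, bidx v)"
        using k1 by (subst index_tensor'[OF one_carrier_mat Ka]) (auto simp: index_less_mult)
      show "(functionality_kraus f (u, w) \<otimes>\<^sub>m 1\<^sub>m k) $$ (s * k + \<kappa>, pidx u1 w1 * k + \<kappa>1) *
         (1\<^sub>m CARD('u) \<otimes>\<^sub>m K1 a) $$ (bidx u1 * (CARD('v) * k) + (bidx w1 * k + \<kappa>1), bidx u' * CARD('v) + bidx v) =
        of_bool (u1 = u) * (of_bool (w1 = w) * (of_bool (\<kappa> = \<kappa>1) *
         (of_bool (s = pidx (f u w) (f u w)) * of_bool (u1 = u') * K1 a $$ (bidx w1 * k + \<kappa>1, bidx v))))"
        unfolding 1 2 by (simp only: mult_ac)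
    qed
    also have "\<dots> = of_bool (s = pidx (f u w) (f u w)) * of_bool (u = u') * K1 a $$ (bidx w * k + \<kappa>, bidx v)"
      using that(3) by (simp only: sum_of_bool finite_lessThan finite_UNIV lessThan_iff UNIV_I finite)
    finally show ?thesis .
  qed
  have Rj: "R (a, (u, w), b) $$ (bidx z * d + y, pidx u' v) =
      of_bool (z = f u w) * of_bool (u = u') * (\<Sum>\<kappa><k. K2 b $$ (y, bidx (f u w) * k + \<kappa>) * K1 a $$ (bidx w * k + \<kappa>, bidx v))"
    if a: "a < N1" and b: "b < N2" and y: "y < d" for u u' :: 'u and v w :: 'v and a b y and z :: 'z
  proof -
    have Ka: "K1 a \<in> carrier_mat (CARD('v) * k) CARD('v)" using krausD(4)[OF K1] a by simp
    have Kb: "K2 b \<in> carrier_mat d (CARD('z) * k)" using krausD(4)[OF K2] b by simp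
    note dims = carrier_matD[OF F[of "(u, w)"]] carrier_matD[OF Ka] carrier_matD[OF Kb]
    let ?T = "(functionality_kraus f (u, w) \<otimes>\<^sub>m 1\<^sub>m k) * (1\<^sub>m CARD('u) \<otimes>\<^sub>m K1 a)"
    have "R (a, (u, w), b) $$ (bidx z * d + y, pidx u' v) = ((1\<^sub>m CARD('z) \<otimes>\<^sub>m K2 b) * ?T) $$ (bidx z * d + y, pidx u' v)"
      by (simp add: R_def mult_assoc_dim dims mult.assoc)
    also have "\<dots> = (\<Sum>q<CARD('z) * CARD('z) * k. (1\<^sub>m CARD('z) \<otimes>\<^sub>m K2 b) $$ (bidx z * d + y, q) * ?T $$ (q, pidx u' v))"
      using y by (subst index_mult_sum) (auto simp: dims index_less_mult mult.assoc simp del: index_mult_mat(1))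
    also have "\<dots> = (\<Sum>z1\<in>UNIV. \<Sum>z2\<in>UNIV. \<Sum>\<kappa><k. (1\<^sub>m CARD('z) \<otimes>\<^sub>m K2 b) $$ (bidx z * d + y, bidx (z1 :: 'z) * (CARD('z) * k) + (bidx (z2 :: 'z) * k + \<kappa>)) *
         ?T $$ (pidx z1 z2 * k + \<kappa>, pidx u' v))"
      unfolding sum_lessThan_mult[where n = k] sum_pidx by (simp add: pidx_def add_mult_distrib mult.assoc add.assoc)
    also have "\<dots> = (\<Sum>z1\<in>UNIV. of_bool (z1 = f u w) * (\<Sum>z2\<in>UNIV. of_bool (z2 = f u w) * (\<Sum>\<kappa><k. of_bool (z = z1) * of_bool (u = u') *
         (K2 b $$ (y, bidx z2 * k + \<kappa>) * K1 a $$ (bidx w * k + \<kappa>, bidx v)))))"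
      unfolding sum_distrib_left
    proof (intro sum.cong refl)
      fix z1 z2 :: 'z and \<kappa> assume "\<kappa> \<in> {..<k}"
      then have k: "\<kappa> < k" by simp
      have 1: "(1\<^sub>m CARD('z) \<otimes>\<^sub>m K2 b) $$ (bidx z * d + y, bidx z1 * (CARD('z) * k) + (bidx z2 * k + \<kappa>)) =
          of_bool (z = z1) * K2 b $$ (y, bidx z2 * k + \<kappa>)"
        using y k by (subst index_tensor'[OF one_carrier_mat Kb]) (auto simp: index_less_mult)
      have 2: "?T $$ (pidx z1 z2 * k + \<kappa>, pidx u' v) = of_bool (z1 = f u w) * of_bool (z2 = f u w) * of_bool (u = u') * K1 a $$ (bidx w * k + \<kappa>, bidx v)"
        by (subst T[OF a _ k]) (auto simp: pidx_inject)
      show "(1\<^sub>m CARD('z) \<otimes>\<^sub>m K2 b) $$ (bidx z * d + y, bidx z1 * (CARD('z) * k) + (bidx z2 * k + \<kappa>)) *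
         ?T $$ (pidx z1 z2 * k + \<kappa>, pidx u' v) =
         of_bool (z1 = f u w) * (of_bool (z2 = f u w) * (of_bool (z = z1) * of_bool (u = u') *
         (K2 b $$ (y, bidx z2 * k + \<kappa>) * K1 a $$ (bidx w * k + \<kappa>, bidx v))))"
        unfolding 1 2 by (simp only: mult_ac)
    qed
    also have "\<dots> = of_bool (z = f u w) * of_bool (u = u') * (\<Sum>\<kappa><k. K2 b $$ (y, bidx (f u w) * k + \<kappa>) * K1 a $$ (bidx w * k + \<kappa>, bidx v))"
      by (simp only: sum_of_bool finite UNIV_I) (simp only: sum_distrib_left)
    finally show ?thesis .
  qed
  have "\<forall>j\<in>J. \<forall>u (v :: 'v) z y. y < d \<longrightarrow> R j $$ (bidx z * d + y, pidx u v) \<noteq> 0 \<longrightarrow> z = f u (snd (fst (snd j)))"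
  proof (intro ballI allI impI)
    fix j and u :: 'u and v :: 'v and z :: 'z and y assume j: "j \<in> J" and y: "y < d" and nz: "R j $$ (bidx z * d + y, pidx u v) \<noteq> 0"
    obtain a u1 w b where ab: "j = (a, (u1, w), b)" "a < N1" "b < N2" using j by (auto simp: J_def)
    show "z = f u (snd (fst (snd j)))" using nz unfolding ab(1) Rj[OF ab(2,3) y] by (auto split: if_splits)
  qed
  moreover have "(\<Sum>z\<in>(UNIV :: 'z set). \<Sum>y<d. \<Sum>j\<in>J. of_bool (snd (fst (snd j)) = w) * (cmod (R j $$ (bidx z * d + y, pidx u v)))\<^sup>2) = L v w"
    for u :: 'u and v w :: 'v
  proof -
    \<comment> \<open>\<open>g a\<close> is the vector entering the second simulator map when
      \<open>w\<close> was submitted: \<open>|f u w>\<close> tensored with the part of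
      \<open>K1 a\<close> that belongs to \<open>w\<close>. Since that map preserves norms, it drops
      out of the probability.\<close>
    define g where "g a i = (if i div k = bidx (f u w) then K1 a $$ (bidx w * k + i mod k, bidx v) else 0)" for a i
    define G where "G a b y = (cmod (\<Sum>\<kappa><k. K2 b $$ (y, bidx (f u w) * k + \<kappa>) * K1 a $$ (bidx w * k + \<kappa>, bidx v)))\<^sup>2" for a b y
    have "(\<Sum>j\<in>J. of_bool (snd (fst (snd j)) = w) * (cmod (R j $$ (bidx z * d + y, pidx u v)))\<^sup>2) =
        of_bool (z = f u w) * (\<Sum>a<N1. \<Sum>b<N2. G a b y)" if y: "y < d" for z :: 'z and y
    proof -
      have "(\<Sum>j\<in>J. of_bool (snd (fst (snd j)) = w) * (cmod (R j $$ (bidx z * d + y, pidx u v)))\<^sup>2) =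
        (\<Sum>a<N1. \<Sum>u1\<in>UNIV. \<Sum>w1\<in>UNIV. \<Sum>b<N2. if w1 = w then if u1 = u then of_bool (z = f u w) * G a b y else 0 else 0)"
        unfolding J_def UNIV_Times_UNIV[symmetric] sum.cartesian_product' using y
        by (intro sum.cong refl) (auto simp: Rj G_def)
      also have "\<dots> = (\<Sum>a<N1. \<Sum>b<N2. of_bool (z = f u w) * G a b y)"
      proof (intro sum.cong refl)
        fix a
        have "(\<Sum>b<N2. if w1 = w then if u1 = u then of_bool (z = f u w) * G a b y else 0 else 0) =
           (if w1 = w then if u1 = u then (\<Sum>b<N2. of_bool (z = f u w) * G a b y) else 0 else 0)" for w1 u1 by simp
        then show "(\<Sum>u1\<in>UNIV. \<Sum>w1\<in>UNIV. \<Sum>b<N2. if w1 = w then if u1 = u then of_bool (z = f u w) * G a b y else 0 else 0) =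
          (\<Sum>b<N2. of_bool (z = f u w) * G a b y)" by (simp only: sum.delta finite UNIV_I if_True)
      qed
      finally show ?thesis by (simp only: sum_distrib_left)
    qed
    note inner = this
    have "(\<Sum>z\<in>(UNIV :: 'z set). \<Sum>y<d. \<Sum>j\<in>J. of_bool (snd (fst (snd j)) = w) * (cmod (R j $$ (bidx z * d + y, pidx u v)))\<^sup>2) =
        (\<Sum>z\<in>UNIV. of_bool (z = f u w) * (\<Sum>y<d. \<Sum>a<N1. \<Sum>b<N2. G a b y))"
    proof (rule sum.cong[OF refl])
      fix z :: 'z
      show "(\<Sum>y<d. \<Sum>j\<in>J. of_bool (snd (fst (snd j)) = w) * (cmod (R j $$ (bidx z * d + y, pidx u v)))\<^sup>2) =
        of_bool (z = f u w) * (\<Sum>y<d. \<Sum>a<N1. \<Sum>b<N2. G a b y)"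
        unfolding sum_distrib_left[of "of_bool (z = f u w)" _ "{..<d}"]
        by (rule sum.cong[OF refl]) (simp only: lessThan_iff inner)
    qed
    also have "\<dots> = (\<Sum>y<d. \<Sum>a<N1. \<Sum>b<N2. G a b y)"
      by (simp add: of_bool_def mult_delta_left)
    also have "\<dots> = (\<Sum>a<N1. \<Sum>b<N2. \<Sum>y<d. G a b y)" by (rule sum_swap3[symmetric])
    also have "\<dots> = L v w"
      unfolding L_def
    proof (rule sum.cong[OF refl])
      fix a assume "a \<in> {..<N1}"
      have gs: "(\<Sum>i<CARD('z) * k. H i (g a i)) = (\<Sum>\<kappa><k. H (bidx (f u w) * k + \<kappa>) (K1 a $$ (bidx w * k + \<kappa>, bidx v)))"
        if "\<And>i. H i 0 = 0" for H :: "nat \<Rightarrow> complex \<Rightarrow> 'x::comm_monoid_add"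
      proof -
        have "(\<Sum>i<CARD('z) * k. H i (g a i)) = (\<Sum>z\<in>UNIV. \<Sum>\<kappa><k. if z = f u w then
           H (bidx (f u w) * k + \<kappa>) (K1 a $$ (bidx w * k + \<kappa>, bidx v)) else 0)"
          unfolding sum_lessThan_mult sum_bidx by (intro sum.cong refl) (auto simp: g_def that)
        also have "\<dots> = (\<Sum>\<kappa><k. \<Sum>z\<in>UNIV. if z = f u w then
           H (bidx (f u w) * k + \<kappa>) (K1 a $$ (bidx w * k + \<kappa>, bidx v)) else 0)" by (rule sum.swap)
        finally show ?thesis by simp
      qed
      show "(\<Sum>b<N2. \<Sum>y<d. G a b y) = (\<Sum>\<kappa><k. (cmod (K1 a $$ (bidx w * k + \<kappa>, bidx v)))\<^sup>2)"
        using kraus_norm[OF K2, of "g a"] gs[of "\<lambda>i x. (cmod x)\<^sup>2"] gs[of "\<lambda>i x. K2 b $$ (y, i) * x" for b y]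
        by (simp add: G_def)
    qed
    finally show ?thesis .
  qed
  ultimately show ?thesis using KR by blast
qed

section \<open>Closeness, minimax and dilations of a protocol\<close>

text \<open>The first bound expands the square: \<open>1 + 1 - 2 * (1 - \<epsilon>\<^sup>2)\<close>.
  The second factors \<open>|b|\<^sup>2 - |a|\<^sup>2\<close> into a difference and a sum and
  applies Cauchy-Schwarz, and so is only linear in \<epsilon>. The weights of \<open>a\<close> and
  \<open>b\<close> may sum to less than 1 because a contraction can shorten amplitudes.\<close>

lemma weighted_closeness:
  fixes a b :: "'i \<Rightarrow> complex" and \<omega> :: "'i \<Rightarrow> real"
  assumes \<omega>: "\<And>i. i \<in> \<Omega> \<Longrightarrow> 0 \<le> \<omega> i" and a: "(\<Sum>i\<in>\<Omega>. \<omega> i * (cmod (a i))\<^sup>2) \<le> 1"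
    and b: "(\<Sum>i\<in>\<Omega>. \<omega> i * (cmod (b i))\<^sup>2) \<le> 1" and \<epsilon>: "0 \<le> \<epsilon>"
    and ab: "1 - \<epsilon>\<^sup>2 \<le> Re (\<Sum>i\<in>\<Omega>. of_real (\<omega> i) * (a i * cnj (b i)))"
  shows "(\<Sum>i\<in>\<Omega>. \<omega> i * (cmod (b i - a i))\<^sup>2) \<le> 2 * \<epsilon>\<^sup>2"
    and "(\<Sum>i\<in>\<Omega>. \<omega> i * \<bar>(cmod (b i))\<^sup>2 - (cmod (a i))\<^sup>2\<bar>) \<le> 3 * \<epsilon>"
proof -
  have "(cmod (b i - a i))\<^sup>2 = (cmod (b i))\<^sup>2 + (cmod (a i))\<^sup>2 - 2 * Re (a i * cnj (b i))" for i
    by (simp only: cmod_power2) (simp add: power2_eq_square algebra_simps)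
  then have "(\<Sum>i\<in>\<Omega>. \<omega> i * (cmod (b i - a i))\<^sup>2) = (\<Sum>i\<in>\<Omega>. \<omega> i * (cmod (b i))\<^sup>2) +
      (\<Sum>i\<in>\<Omega>. \<omega> i * (cmod (a i))\<^sup>2) - 2 * (\<Sum>i\<in>\<Omega>. \<omega> i * Re (a i * cnj (b i)))"
    by (simp only: right_diff_distrib distrib_left sum.distrib sum_subtractf sum_distrib_left mult.left_commute[of _ 2])
  also have "(\<Sum>i\<in>\<Omega>. \<omega> i * Re (a i * cnj (b i))) = Re (\<Sum>i\<in>\<Omega>. of_real (\<omega> i) * (a i * cnj (b i)))"
    by (simp only: Re_sum Re_complex_of_real times_complex.sel Im_complex_of_real) simp
  finally show *: "(\<Sum>i\<in>\<Omega>. \<omega> i * (cmod (b i - a i))\<^sup>2) \<le> 2 * \<epsilon>\<^sup>2" using a b ab by linarith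
  define d where "d i = sqrt (\<omega> i) * cmod (b i - a i)" for i
  define s where "s i = sqrt (\<omega> i) * (cmod (b i) + cmod (a i))" for i
  have d2: "(d i)\<^sup>2 = \<omega> i * (cmod (b i - a i))\<^sup>2" if "i \<in> \<Omega>" for i
    using \<omega>[OF that] by (simp add: d_def power_mult_distrib)
  have s2: "(s i)\<^sup>2 \<le> 2 * (\<omega> i * (cmod (b i))\<^sup>2) + 2 * (\<omega> i * (cmod (a i))\<^sup>2)" if "i \<in> \<Omega>" for i
  proof -
    have "(cmod (b i) + cmod (a i))\<^sup>2 \<le> 2 * (cmod (b i))\<^sup>2 + 2 * (cmod (a i))\<^sup>2"
      using zero_le_power2[of "cmod (b i) - cmod (a i)"] by (simp add: power2_sum power2_diff)
    moreover have "(s i)\<^sup>2 = \<omega> i * (cmod (b i) + cmod (a i))\<^sup>2"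
      using \<omega>[OF that] unfolding s_def power_mult_distrib by simp
    ultimately show ?thesis
      using mult_left_mono[OF _ \<omega>[OF that]] by (metis (no_types, lifting) distrib_left mult.left_commute)
  qed
  have "\<omega> i * \<bar>(cmod (b i))\<^sup>2 - (cmod (a i))\<^sup>2\<bar> \<le> d i * s i" if "i \<in> \<Omega>" for i
  proof -
    have "\<bar>(cmod (b i))\<^sup>2 - (cmod (a i))\<^sup>2\<bar> = \<bar>cmod (b i) - cmod (a i)\<bar> * (cmod (b i) + cmod (a i))"
      by (simp add: power2_eq_square square_diff_square_factored abs_mult mult.commute)
    also have "\<dots> \<le> cmod (b i - a i) * (cmod (b i) + cmod (a i))"
      by (intro mult_right_mono norm_triangle_ineq3) simp
    finally have "\<omega> i * \<bar>(cmod (b i))\<^sup>2 - (cmod (a i))\<^sup>2\<bar> \<le> \<omega> i * (cmod (b i - a i) * (cmod (b i) + cmod (a i)))"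
      using \<omega>[OF that] by (rule mult_left_mono)
    also have "\<dots> = d i * s i" using \<omega>[OF that] by (simp add: d_def s_def mult_ac flip: power2_eq_square)
    finally show ?thesis .
  qed
  then have 1: "(\<Sum>i\<in>\<Omega>. \<omega> i * \<bar>(cmod (b i))\<^sup>2 - (cmod (a i))\<^sup>2\<bar>) \<le> (\<Sum>i\<in>\<Omega>. d i * s i)" by (rule sum_mono)
  have D: "(\<Sum>i\<in>\<Omega>. (d i)\<^sup>2) \<le> 2 * \<epsilon>\<^sup>2" using * d2 by simp
  have S: "(\<Sum>i\<in>\<Omega>. (s i)\<^sup>2) \<le> 4"
  proof -
    have "(\<Sum>i\<in>\<Omega>. (s i)\<^sup>2) \<le> (\<Sum>i\<in>\<Omega>. 2 * (\<omega> i * (cmod (b i))\<^sup>2) + 2 * (\<omega> i * (cmod (a i))\<^sup>2))"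
      by (rule sum_mono[OF s2])
    then show ?thesis using a b by (simp add: sum.distrib flip: sum_distrib_left)
  qed
  have "(\<Sum>i\<in>\<Omega>. d i * s i)\<^sup>2 \<le> 2 * \<epsilon>\<^sup>2 * 4"
    by (rule order.trans[OF Cauchy_Schwarz_ineq_sum mult_mono[OF D S]]) (simp_all add: sum_nonneg)
  \<comment> \<open>The root of 8 is rounded up to 3.\<close>
  also have "\<dots> \<le> (3 * \<epsilon>)\<^sup>2" using zero_le_power2[of \<epsilon>] by (simp add: power_mult_distrib)
  finally have "(\<Sum>i\<in>\<Omega>. d i * s i)\<^sup>2 \<le> (3 * \<epsilon>)\<^sup>2" .
  then have "(\<Sum>i\<in>\<Omega>. d i * s i) \<le> 3 * \<epsilon>" by (rule power2_le_imp_le) (use \<epsilon> in simp)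
  with 1 show "(\<Sum>i\<in>\<Omega>. \<omega> i * \<bar>(cmod (b i))\<^sup>2 - (cmod (a i))\<^sup>2\<bar>) \<le> 3 * \<epsilon>" by simp
qed

text \<open>Only points with \<open>b i \<noteq> 0\<close>, hence in \<open>G\<close>, contribute to
  the overlap, and there \<open>2 * Re (a * cnj b)\<close> is at most
  \<open>|a|\<^sup>2 + |b|\<^sup>2\<close>. The loss stays quadratic in \<epsilon>, unlike a
  comparison of probabilities by \<open>weighted_closeness\<close>.\<close>

lemma weighted_support:
  fixes a b :: "'i \<Rightarrow> complex" and \<omega> :: "'i \<Rightarrow> real"
  assumes \<omega>: "\<And>i. i \<in> \<Omega> \<Longrightarrow> 0 \<le> \<omega> i" and b: "(\<Sum>i\<in>\<Omega>. \<omega> i * (cmod (b i))\<^sup>2) \<le> 1"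
    and ab: "1 - \<epsilon>\<^sup>2 \<le> Re (\<Sum>i\<in>\<Omega>. of_real (\<omega> i) * (a i * cnj (b i)))"
    and supp: "\<And>i. i \<in> \<Omega> \<Longrightarrow> b i \<noteq> 0 \<Longrightarrow> G i"
  shows "1 - 2 * \<epsilon>\<^sup>2 \<le> (\<Sum>i\<in>\<Omega>. \<omega> i * (of_bool (G i) * (cmod (a i))\<^sup>2))"
proof -
  have t: "2 * Re (a i * cnj (b i)) \<le> of_bool (G i) * (cmod (a i))\<^sup>2 + (cmod (b i))\<^sup>2" if "i \<in> \<Omega>" for i
  proof (cases "b i = 0")
    case False
    have "0 \<le> (cmod (a i - b i))\<^sup>2" by simp
    also have "(cmod (a i - b i))\<^sup>2 = (cmod (a i))\<^sup>2 + (cmod (b i))\<^sup>2 - 2 * Re (a i * cnj (b i))"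
      by (simp only: cmod_power2) (simp add: power2_eq_square algebra_simps)
    finally show ?thesis using supp[OF that False] by simp
  qed simp
  have "Re (\<Sum>i\<in>\<Omega>. of_real (\<omega> i) * (a i * cnj (b i))) = (\<Sum>i\<in>\<Omega>. \<omega> i * Re (a i * cnj (b i)))"
    by (simp only: Re_sum Re_complex_of_real times_complex.sel Im_complex_of_real) simp
  then have "2 * Re (\<Sum>i\<in>\<Omega>. of_real (\<omega> i) * (a i * cnj (b i))) = (\<Sum>i\<in>\<Omega>. \<omega> i * (2 * Re (a i * cnj (b i))))"
    by (simp add: sum_distrib_left mult_ac)
  also have "\<dots> \<le> (\<Sum>i\<in>\<Omega>. \<omega> i * (of_bool (G i) * (cmod (a i))\<^sup>2 + (cmod (b i))\<^sup>2))"
    by (intro sum_mono mult_left_mono t \<omega>)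
  also have "\<dots> = (\<Sum>i\<in>\<Omega>. \<omega> i * (of_bool (G i) * (cmod (a i))\<^sup>2)) + (\<Sum>i\<in>\<Omega>. \<omega> i * (cmod (b i))\<^sup>2)"
    by (simp add: distrib_left sum.distrib)
  finally show ?thesis using ab b by linarith
qed

section \<open>Finitely supported distributions and the minimax theorem\<close>

lemma pmf_of_weights:
  assumes "finite A" "\<And>x. x \<in> A \<Longrightarrow> 0 \<le> w x" "(\<Sum>x\<in>A. w x) = (1 :: real)"
  shows "\<exists>p. set_pmf p \<subseteq> A \<and> (\<forall>x\<in>A. pmf p x = w x)"
proof -
  define g where "g x = (if x \<in> A then w x else 0)" for x
  have g0: "0 \<le> g x" for x using assms(2) by (simp add: g_def)
  have "(\<integral>\<^sup>+x. ennreal (g x) \<partial>count_space UNIV) = (\<Sum>x\<in>A. ennreal (g x))"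
    by (rule nn_integral_count_space') (use assms(1) in \<open>auto simp: g_def\<close>)
  also have "\<dots> = ennreal (\<Sum>x\<in>A. g x)" using g0 by (simp add: sum_ennreal)
  also have "(\<Sum>x\<in>A. g x) = 1" using assms(3) by (simp add: g_def)
  finally have g1: "(\<integral>\<^sup>+x. ennreal (g x) \<partial>count_space UNIV) = 1" by simp
  have p: "pmf (embed_pmf g) x = g x" for x by (rule pmf_embed_pmf[OF g0 g1])
  show ?thesis
  proof (intro exI[of _ "embed_pmf g"] conjI ballI)
    show "set_pmf (embed_pmf g) \<subseteq> A" by (auto simp: set_pmf_eq p g_def)
    show "pmf (embed_pmf g) x = w x" if "x \<in> A" for x using that by (simp add: p g_def)
  qed
qed

text \<open>If the convex hull of the payoff vectors missed the orthant above \<open>t'\<close>, a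
  hyperplane would separate them. Its normal is nonnegative because the orthant is unbounded
  upwards, and normalised it is a distribution against which no strategy in \<open>P\<close> reaches
  \<open>t\<close>. The separation is not strict, as nothing is known about compactness of the hull;
  the gap \<open>t' < t\<close> makes up for this.\<close>

lemma minimax:
  fixes pay :: "'s \<Rightarrow> 'i::finite \<Rightarrow> real"
  assumes best: "\<And>\<mu>. (\<And>i. 0 \<le> \<mu> i) \<Longrightarrow> (\<Sum>i\<in>UNIV. \<mu> i) = 1 \<Longrightarrow> \<exists>s\<in>P. t \<le> (\<Sum>i\<in>UNIV. \<mu> i * pay s i)"
    and t': "t' < t"
  shows "\<exists>S w. finite S \<and> S \<subseteq> P \<and> (\<forall>s\<in>S. 0 \<le> w s) \<and> (\<Sum>s\<in>S. w s) = 1 \<and>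
    (\<forall>i. t' \<le> (\<Sum>s\<in>S. w s * pay s i))"
proof -
  define V :: "'s \<Rightarrow> (real, 'i) Finite_Cartesian_Product.vec" where "V s = (\<chi> i. pay s i)" for s
  define C where "C = convex hull (V ` P)"
  define O' where "O' = {y :: (real, 'i) Finite_Cartesian_Product.vec. \<forall>i. t' \<le> Finite_Cartesian_Product.vec_nth y i}"
  have in_eq: "inner a y = (\<Sum>i\<in>UNIV. Finite_Cartesian_Product.vec_nth a i * Finite_Cartesian_Product.vec_nth y i)"
    for a y :: "(real, 'i) Finite_Cartesian_Product.vec" by (simp add: inner_vec_def)
  have "C \<inter> O' \<noteq> {}"
  proof
    assume "C \<inter> O' = {}"
    moreover have "P \<noteq> {}"
      using best[of "\<lambda>_. 1 / CARD('i)"] by auto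
    then have "C \<noteq> {}" by (simp add: C_def)
    moreover have "convex O'" unfolding convex_def O'_def
    proof (intro ballI allI impI, simp, intro allI)
      fix x y :: "(real, 'i) Finite_Cartesian_Product.vec" and u v :: real and i
      assume "\<forall>i. t' \<le> Finite_Cartesian_Product.vec_nth x i" "\<forall>i. t' \<le> Finite_Cartesian_Product.vec_nth y i"
        "0 \<le> u" "0 \<le> v" "u + v = 1"
      then have "u * t' + v * t' \<le> u * Finite_Cartesian_Product.vec_nth x i + v * Finite_Cartesian_Product.vec_nth y i"
        by (intro add_mono mult_left_mono) auto
      then show "t' \<le> u * Finite_Cartesian_Product.vec_nth x i + v * Finite_Cartesian_Product.vec_nth y i"
        using \<open>u + v = 1\<close> by (simp flip: distrib_right)
    qed
    moreover have one: "(\<chi> i. t') \<in> O'" by (simp add: O'_def)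
    ultimately obtain a b where a0: "a \<noteq> 0" and aC: "\<forall>x\<in>C. inner a x \<le> b" and aO: "\<forall>x\<in>O'. b \<le> inner a x"
      using separating_hyperplane_sets[of C O'] by (auto simp: C_def convex_convex_hull)
    let ?a = "Finite_Cartesian_Product.vec_nth a"
    have b: "b \<le> t' * (\<Sum>i\<in>UNIV. ?a i)" using aO one by (auto simp: in_eq sum_distrib_left mult.commute)
    have nonneg: "0 \<le> ?a i" for i
    proof (rule ccontr)
      assume "\<not> 0 \<le> ?a i"
      then have neg: "?a i < 0" by simp
      \<comment> \<open>Raising coordinate \<open>i\<close> of the corner of the orthant by
        \<open>c\<close> brings the functional down to exactly \<open>b - 1\<close>.\<close>
      define c where "c = (t' * (\<Sum>i\<in>UNIV. ?a i) - b + 1) / - ?a i"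
      have c: "c \<ge> 0" using neg b by (simp add: c_def divide_nonneg_neg)
      define y :: "(real, 'i) Finite_Cartesian_Product.vec" where "y = (\<chi> j. t' + (if j = i then c else 0))"
      have "y \<in> O'" using c by (simp add: y_def O'_def)
      then have "b \<le> (\<Sum>j\<in>UNIV. ?a j * (t' + (if j = i then c else 0)))" using aO by (auto simp: in_eq y_def)
      also have "\<dots> = t' * (\<Sum>i\<in>UNIV. ?a i) + ?a i * c"
        by (simp add: distrib_left sum.distrib mult_delta_right sum_distrib_left mult.commute)
      also have "?a i * c = - (t' * (\<Sum>i\<in>UNIV. ?a i) - b + 1)" using neg by (simp add: c_def field_simps)
      finally show False by simp
    qed
    define A where "A = (\<Sum>i\<in>UNIV. ?a i)"
    have "A \<noteq> 0"
    proof
      assume "A = 0"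
      then have "?a i = 0" for i using nonneg unfolding A_def by (subst (asm) sum_nonneg_eq_0_iff) auto
      then have "a = 0" by (simp add: Finite_Cartesian_Product.vec_eq_iff)
      then show False using a0 by simp
    qed
    then have A: "A > 0" using nonneg by (simp add: A_def less_le sum_nonneg)
    have "(\<Sum>i\<in>UNIV. ?a i / A) = 1" using A by (simp add: A_def flip: sum_divide_distrib)
    then obtain s where s: "s \<in> P" "t \<le> (\<Sum>i\<in>UNIV. ?a i / A * pay s i)"
      using best[of "\<lambda>i. ?a i / A"] nonneg A by auto
    have "t * A \<le> (\<Sum>i\<in>UNIV. ?a i * pay s i)"
      using s(2) A by (simp add: pos_le_divide_eq flip: sum_divide_distrib)
    also have "\<dots> = inner a (V s)" by (simp add: in_eq V_def)
    also have "\<dots> \<le> b" using aC s(1) by (auto simp: C_def hull_inc)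
    also have "b \<le> t' * A" using b by (simp add: A_def)
    finally show False using t' A by simp
  qed
  then obtain y where yC: "y \<in> convex hull (V ` P)" and yO: "y \<in> O'" by (auto simp: C_def)
  from yC obtain X w where X: "finite X" "X \<subseteq> V ` P" "\<forall>x\<in>X. 0 \<le> w x" "sum w X = 1" "(\<Sum>x\<in>X. w x *\<^sub>R x) = y"
    unfolding convex_hull_explicit by blast
  \<comment> \<open>One strategy is chosen for each payoff vector of the convex combination.\<close>
  obtain S where S: "S \<subseteq> P" "inj_on V S" "V ` S = X" using X(2) unfolding subset_image_inj by blast
  have "finite S" using S X(1) finite_image_iff by blast
  moreover have "(\<Sum>s\<in>S. w (V s)) = 1" using X(4) sum.reindex[OF S(2), of w] by (simp add: S(3))
  moreover have "t' \<le> (\<Sum>s\<in>S. w (V s) * pay s i)" for i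
  proof -
    have "t' \<le> Finite_Cartesian_Product.vec_nth y i" using yO by (simp add: O'_def)
    also have "y = (\<Sum>s\<in>S. w (V s) *\<^sub>R V s)" using X(5) sum.reindex[OF S(2), of "\<lambda>x. w x *\<^sub>R x"] by (simp add: S(3))
    finally show ?thesis by (simp add: V_def)
  qed
  ultimately show ?thesis using S X(3) by (intro exI[of _ S] exI[of _ "\<lambda>s. w (V s)"]) auto
qed

text \<open>One family of amplitudes underlies three executions. In \<open>KB\<close> Bob's history
  is the last digit of the output and Alice's history is the Kraus index; in \<open>KA\<close>
  Alice's history is the leading digit and Bob's is the Kraus index. So the index on which Uhlmann's
  matrix acts in the run against purified Bob is a register of purified Alice.\<close>

lemma protocol_dilations:
  fixes f :: "'u::finite \<Rightarrow> 'v::finite \<Rightarrow> 'z::finite"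
  assumes "protocol_for f \<pi>"
  obtains A' B' EA EB K KA KB where
    "alice_behaviour \<pi> CARD('u) A'" "out_dim \<pi> A' = EA * CARD('z)"
    "bob_behaviour \<pi> CARD('v) B'" "out_dim \<pi> B' = CARD('z) * EB"
    "kraus (CARD('u) * CARD('v)) (CARD('z) * CARD('z)) (execute \<pi> (alice \<pi>) (bob \<pi>)) ({..<EA} \<times> {..<EB}) (\<lambda>(e, f). K e f)"
    "kraus (CARD('u) * CARD('v)) (CARD('z) * (CARD('z) * EB)) (execute \<pi> (alice \<pi>) B') {..<EA} KB"
    "kraus (CARD('u) * CARD('v)) (EA * (CARD('z) * CARD('z))) (execute \<pi> A' (bob \<pi>)) {..<EB} KA"
    "\<And>e f c i. e < EA \<Longrightarrow> f < EB \<Longrightarrow> c < CARD('z) * CARD('z) \<Longrightarrow> i < CARD('u) * CARD('v) \<Longrightarrow>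
      KB e $$ (c * EB + f, i) = K e f $$ (c, i)"
    "\<And>e f c i. e < EA \<Longrightarrow> f < EB \<Longrightarrow> c < CARD('z) * CARD('z) \<Longrightarrow> i < CARD('u) * CARD('v) \<Longrightarrow>
      KA f $$ (e * (CARD('z) * CARD('z)) + c, i) = K e f $$ (c, i)"
proof -
  let ?A = "alice \<pi>" and ?B = "bob \<pi>" and ?Z = "CARD('z)" and ?D = "CARD('u) * CARD('v)"
  define n where "n = steps \<pi>"
  have init: "to_alice \<pi> 0 = 1" "to_bob \<pi> 0 = 1" "to_alice \<pi> n = 1" "to_bob \<pi> n = 1"
    and beh: "alice_behaviour \<pi> CARD('u) ?A" "bob_behaviour \<pi> CARD('v) ?B"
    and out: "memory ?A n = ?Z" "memory ?B n = ?Z"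
    using assms by (simp_all add: protocol_for_def out_dim_def n_def)
  have mem0: "memory ?A 0 = CARD('u)" "memory ?B 0 = CARD('v)"
    using beh by (simp_all add: alice_behaviour_def bob_behaviour_def)
  obtain NA KA0 where A: "alice_kraus \<pi> ?A NA KA0" using alice_behaviour_kraus[OF beh(1)] by blast
  obtain NB KB0 where B: "bob_kraus \<pi> ?B NB KB0" using bob_behaviour_kraus[OF beh(2)] by blast
  define EA EB where "EA = env NA n" "EB = env NB n"
  note E = this
  define A' B' where "A' = purified_alice \<pi> ?A NA KA0" "B' = purified_bob \<pi> ?B NB KB0"
  note AB' = this
  define K where "K e f = run_kraus \<pi> ?A ?B NA KA0 NB KB0 n e f" for e f
  define KB where "KB e = run_kraus \<pi> ?A B' NA KA0 (\<lambda>_. 1) (\<lambda>i _. bob_isometry \<pi> ?B NB KB0 i) n e 0" for e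
  define KA where "KA f = run_kraus \<pi> A' ?B (\<lambda>_. 1) (\<lambda>i _. alice_isometry \<pi> ?A NA KA0 i) NB KB0 n 0 f" for f
  note A' = purified_alice_kraus[OF A, folded AB'] and B' = purified_bob_kraus[OF B, folded AB']
  have mem': "memory A' i = env NA i * memory ?A i" "memory B' i = memory ?B i * env NB i" for i
    by (simp_all add: AB')
  note run = kraus_run[OF init(1,2) _ _ order_refl, folded execute_def]
  have jd: "joint_dim \<pi> ?A ?B n = ?Z * ?Z" "joint_dim \<pi> ?A B' n = ?Z * (?Z * EB)" "joint_dim \<pi> A' ?B n = EA * (?Z * ?Z)"
    by (simp_all add: joint_dim_def init out mem' E mult.assoc)
  have 1: "alice_behaviour \<pi> CARD('u) A'" using alice_kraus_behaviour[OF A'] by (simp add: mem' mem0)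
  have 2: "bob_behaviour \<pi> CARD('v) B'" using bob_kraus_behaviour[OF B'] by (simp add: mem' mem0)
  have 3: "out_dim \<pi> A' = EA * ?Z" "out_dim \<pi> B' = ?Z * EB"
    by (simp_all add: out_dim_def mem' out E flip: n_def)
  have 4: "kraus ?D (?Z * ?Z) (execute \<pi> ?A ?B) ({..<EA} \<times> {..<EB}) (\<lambda>(e, f). K e f)"
    using run[OF A B] unfolding n_def[symmetric] jd mem0 by (simp add: K_def E n_def)
  have 5: "kraus ?D (?Z * (?Z * EB)) (execute \<pi> ?A B') {..<EA} KB"
  proof (rule kraus_reindex[where h = "\<lambda>e. (e, 0)"])
    show "kraus ?D (?Z * (?Z * EB)) (execute \<pi> ?A B') ({..<EA} \<times> {..<1})
      (\<lambda>(e, f). run_kraus \<pi> ?A B' NA KA0 (\<lambda>_. 1) (\<lambda>i _. bob_isometry \<pi> ?B NB KB0 i) n e f)"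
      using run[OF A B'] unfolding n_def[symmetric] jd mem0 mem' by (simp add: mem0 E n_def)
  qed (auto simp: KB_def bij_betw_def inj_on_def)
  have 6: "kraus ?D (EA * (?Z * ?Z)) (execute \<pi> A' ?B) {..<EB} KA"
  proof (rule kraus_reindex[where h = "\<lambda>f. (0, f)"])
    show "kraus ?D (EA * (?Z * ?Z)) (execute \<pi> A' ?B) ({..<1} \<times> {..<EB})
      (\<lambda>(e, f). run_kraus \<pi> A' ?B (\<lambda>_. 1) (\<lambda>i _. alice_isometry \<pi> ?A NA KA0 i) NB KB0 n e f)"
      using run[OF A' B] unfolding n_def[symmetric] jd mem0 mem' by (simp add: mem0 E n_def)
  qed (auto simp: KA_def bij_betw_def inj_on_def)
  have 7: "KB e $$ (c * EB + f, i) = K e f $$ (c, i)"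
    if "e < EA" "f < EB" "c < ?Z * ?Z" "i < ?D" for e f c i
  proof -
    have "coblock (joint_dim \<pi> ?A ?B n) (env NB n) f (KB e) = K e f"
      unfolding KB_def K_def AB' by (rule run_purified_bob[OF init(1,2) A B]) (use that in \<open>auto simp: n_def E\<close>)
    then have "coblock (?Z * ?Z) EB f (KB e) $$ (c, i) = K e f $$ (c, i)" by (simp add: jd E)
    then show ?thesis using that krausD(4)[OF 5, of e] by (simp add: coblock_def)
  qed
  have 8: "KA f $$ (e * (?Z * ?Z) + c, i) = K e f $$ (c, i)"
    if "e < EA" "f < EB" "c < ?Z * ?Z" "i < ?D" for e f c i
  proof -
    have "block (joint_dim \<pi> ?A ?B n) e (KA f) = K e f"
      unfolding KA_def K_def AB' by (rule run_purified_alice[OF init(1,2) A B]) (use that in \<open>auto simp: n_def E\<close>)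
    then have "block (?Z * ?Z) e (KA f) $$ (c, i) = K e f $$ (c, i)" by (simp add: jd)
    then show ?thesis using that krausD(4)[OF 6, of f] by (simp add: block_def)
  qed
  show thesis by (rule that[OF 1 3(1) 2 3(2) 4 5 6 7 8])
qed

section \<open>Guessing the input of Bob\<close>

text \<open>The \<open>W\<close>-part of the measurement may sum to less than the identity; the defect goes to the arbitrary
  outcome \<open>w\<^sub>0\<close>.\<close>

definition guess_mat :: "'b set \<Rightarrow> ('b \<Rightarrow> 'v) \<Rightarrow> (nat \<Rightarrow> 'b \<Rightarrow> complex) \<Rightarrow> 'v \<Rightarrow> nat \<Rightarrow> 'v \<Rightarrow> complex mat" where
  "guess_mat J tag W w\<^sub>0 E w = mat E E (\<lambda>(e', e).
     (\<Sum>b\<in>J. of_bool (tag b = w) * (W e b * cnj (W e' b))) +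
     of_bool (w = w\<^sub>0) * (of_bool (e' = e) - (\<Sum>b\<in>J. W e b * cnj (W e' b))))"

text \<open>The value at \<open>h\<close> of the quadratic form of \<open>guess_mat\<close>, see
  \<open>guess_form\<close>: squared moduli of the coefficients of \<open>h\<close> after applying
  \<open>W\<close>, grouped by tag, with the lost norm credited to \<open>w\<^sub>0\<close>.\<close>

definition guess_weight :: "'b set \<Rightarrow> ('b \<Rightarrow> 'v) \<Rightarrow> (nat \<Rightarrow> 'b \<Rightarrow> complex) \<Rightarrow> 'v \<Rightarrow> nat \<Rightarrow> 'v \<Rightarrow> (nat \<Rightarrow> complex) \<Rightarrow> real" where
  "guess_weight J tag W w\<^sub>0 E w h =
     (\<Sum>b\<in>J. of_bool (tag b = w) * (cmod (\<Sum>e<E. h e * W e b))\<^sup>2) +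
     of_bool (w = w\<^sub>0) * ((\<Sum>e<E. (cmod (h e))\<^sup>2) - (\<Sum>b\<in>J. (cmod (\<Sum>e<E. h e * W e b))\<^sup>2))"

lemma guess_carrier [simp]: "guess_mat J tag W w\<^sub>0 E w \<in> carrier_mat E E"
  by (simp add: guess_mat_def)

text \<open>Expansion of the squared moduli. The factors \<open>x b\<close> cover both the part with
  a given tag and the full sum over \<open>J\<close>.\<close>

lemma gram_form:
  fixes x :: "'b \<Rightarrow> complex" and h :: "nat \<Rightarrow> complex"
  shows "(\<Sum>e'<E. \<Sum>e<E. (\<Sum>b\<in>J. x b * (W e b * cnj (W e' b))) * h e * cnj (h e')) =
    (\<Sum>b\<in>J. x b * of_real ((cmod (\<Sum>e<E. h e * W e b))\<^sup>2))"
proof -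
  have "(\<Sum>e'<E. \<Sum>e<E. (\<Sum>b\<in>J. x b * (W e b * cnj (W e' b))) * h e * cnj (h e')) =
      (\<Sum>e'<E. \<Sum>e<E. \<Sum>b\<in>J. x b * (cnj (h e' * W e' b) * (h e * W e b)))"
    unfolding sum_distrib_right by (intro sum.cong refl) simp
  also have "\<dots> = (\<Sum>b\<in>J. \<Sum>e'<E. \<Sum>e<E. x b * (cnj (h e' * W e' b) * (h e * W e b)))"
    by (rule sum_swap3)
  also have "\<dots> = (\<Sum>b\<in>J. x b * (cnj (\<Sum>e<E. h e * W e b) * (\<Sum>e<E. h e * W e b)))"
    by (simp only: cnj_sum sum_product) (simp only: sum_distrib_left)
  finally show ?thesis unfolding complex_norm_square by (simp only: mult.commute)
qed

lemma guess_form: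
  "(\<Sum>e'<E. \<Sum>e<E. guess_mat J tag W w\<^sub>0 E w $$ (e', e) * h e * cnj (h e')) =
    complex_of_real (guess_weight J tag W w\<^sub>0 E w h)"
proof -
  have "(\<Sum>e'<E. \<Sum>e<E. guess_mat J tag W w\<^sub>0 E w $$ (e', e) * h e * cnj (h e')) =
      (\<Sum>e'<E. \<Sum>e<E. (\<Sum>b\<in>J. of_bool (tag b = w) * (W e b * cnj (W e' b))) * h e * cnj (h e')) +
      of_bool (w = w\<^sub>0) * ((\<Sum>e'<E. \<Sum>e<E. of_bool (e' = e) * (h e * cnj (h e'))) -
        (\<Sum>e'<E. \<Sum>e<E. (\<Sum>b\<in>J. 1 * (W e b * cnj (W e' b))) * h e * cnj (h e')))"
    unfolding sum_distrib_left sum_subtractf[symmetric] sum.distrib[symmetric] right_diff_distrib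
    by (intro sum.cong refl) (simp add: guess_mat_def algebra_simps sum_distrib_left)
  also have "(\<Sum>e'<E. \<Sum>e<E. of_bool (e' = e) * (h e * cnj (h e'))) = (\<Sum>e<E. of_real ((cmod (h e))\<^sup>2))"
    unfolding complex_norm_square by (intro sum.cong refl) (simp only: sum_of_bool finite_lessThan)
  moreover have "complex_of_real (of_bool P) = of_bool P" for P by (cases P) auto
  ultimately show ?thesis unfolding gram_form by (simp add: guess_weight_def)
qed

text \<open>\<open>W\<close> does not increase norms, so the defect is nonnegative. The lower bound
  is an equality except possibly for the outcome that receives the defect.\<close>

lemma guess_weight_nonneg:
  assumes "\<And>g. (\<Sum>b\<in>J. (cmod (\<Sum>e<E. g e * W e b))\<^sup>2) \<le> (\<Sum>e<E. (cmod (g e))\<^sup>2)"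
  shows "0 \<le> guess_weight J tag W w\<^sub>0 E w h"
    and "(\<Sum>b\<in>J. of_bool (tag b = w) * (cmod (\<Sum>e<E. h e * W e b))\<^sup>2) \<le> guess_weight J tag W w\<^sub>0 E w h"
proof -
  show "(\<Sum>b\<in>J. of_bool (tag b = w) * (cmod (\<Sum>e<E. h e * W e b))\<^sup>2) \<le> guess_weight J tag W w\<^sub>0 E w h"
    using assms[of h] by (simp add: guess_weight_def)
  moreover have "0 \<le> (\<Sum>b\<in>J. of_bool (tag b = w) * (cmod (\<Sum>e<E. h e * W e b))\<^sup>2)" by (intro sum_nonneg) simp
  ultimately show "0 \<le> guess_weight J tag W w\<^sub>0 E w h" by linarith
qed

lemma sum_of_bool_tag:
  fixes c :: "'x :: comm_ring_1"
  shows "(\<Sum>w\<in>(UNIV :: 'v::finite set). of_bool (t = w) * c) = c"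
  by (simp add: of_bool_def mult_delta_left)

lemma guess_weight_sum:
  "(\<Sum>w\<in>UNIV. guess_weight J tag W w\<^sub>0 E (w :: 'v::finite) h) = (\<Sum>e<E. (cmod (h e))\<^sup>2)"
proof -
  have "(\<Sum>w\<in>UNIV. \<Sum>b\<in>J. of_bool (tag b = w) * (cmod (\<Sum>e<E. h e * W e b))\<^sup>2) = (\<Sum>b\<in>J. (cmod (\<Sum>e<E. h e * W e b))\<^sup>2)"
    by (subst sum.swap) (simp only: sum_of_bool_tag)
  moreover have "(\<Sum>w\<in>UNIV. of_bool (w = w\<^sub>0) * c) = c" for c :: real
    using sum_of_bool_tag[of w\<^sub>0 c] by (simp add: eq_commute)
  ultimately show ?thesis unfolding guess_weight_def sum.distrib by simp
qed

lemma tensor_one_form: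
  fixes v :: "nat \<Rightarrow> complex"
  assumes G: "G \<in> carrier_mat E E"
  shows "(\<Sum>r<E * n. \<Sum>s<E * n. (G \<otimes>\<^sub>m 1\<^sub>m n) $$ (r, s) * v s * cnj (v r)) =
    (\<Sum>c<n. \<Sum>e'<E. \<Sum>e<E. G $$ (e', e) * v (e * n + c) * cnj (v (e' * n + c)))"
proof -
  have "(\<Sum>r<E * n. \<Sum>s<E * n. (G \<otimes>\<^sub>m 1\<^sub>m n) $$ (r, s) * v s * cnj (v r)) =
      (\<Sum>e'<E. \<Sum>c<n. \<Sum>e<E. \<Sum>c'<n. of_bool (c = c') * (G $$ (e', e) * v (e * n + c') * cnj (v (e' * n + c))))"
    unfolding sum_lessThan_mult by (intro sum.cong refl) (simp add: index_tensor'[OF G one_carrier_mat])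
  also have "\<dots> = (\<Sum>e'<E. \<Sum>c<n. \<Sum>e<E. G $$ (e', e) * v (e * n + c) * cnj (v (e' * n + c)))"
    by (intro sum.cong refl) (simp only: sum_of_bool finite_lessThan)
  also have "\<dots> = (\<Sum>c<n. \<Sum>e'<E. \<Sum>e<E. G $$ (e', e) * v (e * n + c) * cnj (v (e' * n + c)))"
    by (rule sum.swap)
  finally show ?thesis .
qed

lemma mtrace_mult_family:
  assumes X: "X \<in> carrier_mat n n" and \<rho>: "\<rho> \<in> carrier_mat n n"
    and \<rho>v: "\<And>r s. r < n \<Longrightarrow> s < n \<Longrightarrow> \<rho> $$ (s, r) = (\<Sum>f\<in>I. v f s * cnj (v f r))"
  shows "mtrace (X * \<rho>) = (\<Sum>f\<in>I. \<Sum>r<n. \<Sum>s<n. X $$ (r, s) * v f s * cnj (v f r))"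
proof -
  have "mtrace (X * \<rho>) = (\<Sum>r<n. (X * \<rho>) $$ (r, r))"
    using X by (simp add: mtrace_def)
  also have "\<dots> = (\<Sum>r<n. \<Sum>s<n. \<Sum>f\<in>I. X $$ (r, s) * v f s * cnj (v f r))"
  proof (rule sum.cong[OF refl])
    fix r assume "r \<in> {..<n}"
    then show "(X * \<rho>) $$ (r, r) = (\<Sum>s<n. \<Sum>f\<in>I. X $$ (r, s) * v f s * cnj (v f r))"
      using X \<rho> by (subst index_mult_sum) (auto simp: \<rho>v sum_distrib_left mult.assoc)
  qed
  also have "\<dots> = (\<Sum>f\<in>I. \<Sum>r<n. \<Sum>s<n. X $$ (r, s) * v f s * cnj (v f r))" by (rule sum_swap3)
  finally show ?thesis .
qed

text \<open>Positivity is that of \<open>guess_weight\<close>. In the sum over all outcomes the tags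
  exhaust \<open>J\<close>, and the defect completes the identity. The factor
  \<open>1\<^sub>m n\<close> belongs to Alice's regular output, which the measurement leaves
  alone.\<close>

lemma guess_povm:
  fixes tag :: "'b \<Rightarrow> 'v::finite"
  assumes W: "\<And>g. (\<Sum>b\<in>J. (cmod (\<Sum>e<E. g e * W e b))\<^sup>2) \<le> (\<Sum>e<E. (cmod (g e))\<^sup>2)"
  shows "povm (E * n) (\<lambda>w. guess_mat J tag W w\<^sub>0 E w \<otimes>\<^sub>m 1\<^sub>m n)"
  unfolding povm_def
proof (intro conjI allI impI)
  fix w
  have c: "guess_mat J tag W w\<^sub>0 E w \<otimes>\<^sub>m 1\<^sub>m n \<in> carrier_mat (E * n) (E * n)"
    by (intro tensor_carrier guess_carrier one_carrier_mat)
  show "psd (E * n) (guess_mat J tag W w\<^sub>0 E w \<otimes>\<^sub>m 1\<^sub>m n)"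
    unfolding psd_def
  proof (intro conjI ballI c)
    fix v :: "complex vec" assume v: "v \<in> carrier_vec (E * n)"
    have "((guess_mat J tag W w\<^sub>0 E w \<otimes>\<^sub>m 1\<^sub>m n) *\<^sub>v v) \<bullet>c v =
        (\<Sum>c<n. complex_of_real (guess_weight J tag W w\<^sub>0 E w (\<lambda>e. v $ (e * n + c))))"
      unfolding quadratic_form[OF c v] tensor_one_form[OF guess_carrier] guess_form[symmetric] ..
    moreover have "0 \<le> (\<Sum>c<n. guess_weight J tag W w\<^sub>0 E w (\<lambda>e. v $ (e * n + c)))"
      by (intro sum_nonneg guess_weight_nonneg(1)[OF W])
    ultimately show "0 \<le> ((guess_mat J tag W w\<^sub>0 E w \<otimes>\<^sub>m 1\<^sub>m n) *\<^sub>v v) \<bullet>c v"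
      by (simp add: less_eq_complex_def)
  qed
next
  fix i j assume ij: "i < E * n" "j < E * n"
  then have n: "n > 0" by (cases n) auto
  then have b: "i div n < E" "j div n < E" using ij by (auto simp: less_mult_imp_div_less)
  have "(\<Sum>w\<in>UNIV. guess_mat J tag W w\<^sub>0 E w $$ (i div n, j div n)) = of_bool (i div n = j div n)"
  proof -
    have "(\<Sum>w\<in>UNIV. \<Sum>b\<in>J. of_bool (tag b = w) * (W (j div n) b * cnj (W (i div n) b))) =
        (\<Sum>b\<in>J. W (j div n) b * cnj (W (i div n) b))"
      by (subst sum.swap) (simp only: sum_of_bool_tag)
    moreover have "(\<Sum>w\<in>UNIV. of_bool (w = w\<^sub>0) * c) = c" for c :: complex
      using sum_of_bool_tag[of w\<^sub>0 c] by (simp add: eq_commute)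
    ultimately show ?thesis using b by (simp add: guess_mat_def sum.distrib)
  qed
  moreover have "(\<Sum>w\<in>UNIV. (guess_mat J tag W w\<^sub>0 E w \<otimes>\<^sub>m 1\<^sub>m n) $$ (i, j)) =
      (\<Sum>w\<in>UNIV. guess_mat J tag W w\<^sub>0 E w $$ (i div n, j div n)) * of_bool (i mod n = j mod n)"
    unfolding sum_distrib_right using ij n
    by (intro sum.cong refl, subst index_tensor) (auto simp: carrier_matD[OF guess_carrier])
  moreover have "i div n = j div n \<and> i mod n = j mod n \<longleftrightarrow> i = j" by (metis div_mod_decomp)
  ultimately show "(\<Sum>w\<in>UNIV. (guess_mat J tag W w\<^sub>0 E w \<otimes>\<^sub>m 1\<^sub>m n) $$ (i, j)) = 1\<^sub>m (E * n) $$ (i, j)"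
    using ij by auto
qed

definition strategy_prob :: "protocol \<Rightarrow> party \<times> ('v \<Rightarrow> complex mat) \<Rightarrow> 'u::finite \<Rightarrow> 'v::finite \<Rightarrow> 'v \<Rightarrow> real" where
  "strategy_prob \<pi> = (\<lambda>(A, M) u v w. Re (mtrace ((M w \<otimes>\<^sub>m 1\<^sub>m (out_dim \<pi> (bob \<pi>))) *
       app (execute \<pi> A (bob \<pi>)) (ketbra (ket u \<otimes>\<^sub>v ket v) (ket u \<otimes>\<^sub>v ket v)))))"

text \<open>The measurement acts on Alice's environment only, so Bob's Kraus index \<open>f\<close>
  and the pair \<open>c\<close> of both outputs are merely summed over.\<close>

lemma guess_strategy_prob:
  fixes u :: "'u::finite" and v w :: "'v::finite"
  assumes K: "kraus (CARD('u) * CARD('v)) (E * (n * n)) (execute \<pi> A (bob \<pi>)) {..<N::nat} K"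
    and out: "out_dim \<pi> (bob \<pi>) = n"
  shows "strategy_prob \<pi> (A, \<lambda>w. guess_mat J tag W w\<^sub>0 E w \<otimes>\<^sub>m 1\<^sub>m n) u v w =
    (\<Sum>f<N. \<Sum>c<n * n. guess_weight J tag W w\<^sub>0 E w (\<lambda>e. K f $$ (e * (n * n) + c, pidx u v)))"
proof -
  let ?D = "CARD('u) * CARD('v)"
  have "ket u \<otimes>\<^sub>v ket v = unit_vec ?D (pidx u v)"
    by (intro eq_vecI) (auto simp: index_tensor_ket)
  then have kb: "ketbra (ket u \<otimes>\<^sub>v ket v) (ket u \<otimes>\<^sub>v ket v) = matrix_unit ?D (pidx u v) (pidx u v)"
    by (simp add: matrix_unit_def)
  let ?G = "guess_mat J tag W w\<^sub>0 E w"
  have X: "?G \<otimes>\<^sub>m 1\<^sub>m n \<otimes>\<^sub>m 1\<^sub>m n = ?G \<otimes>\<^sub>m 1\<^sub>m (n * n)" by (simp add: tensor_assoc one_tensor_one)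
  have Xc: "?G \<otimes>\<^sub>m 1\<^sub>m (n * n) \<in> carrier_mat (E * (n * n)) (E * (n * n))"
    by (intro tensor_carrier guess_carrier one_carrier_mat)
  have "mtrace ((?G \<otimes>\<^sub>m 1\<^sub>m n \<otimes>\<^sub>m 1\<^sub>m n) * app (execute \<pi> A (bob \<pi>)) (matrix_unit ?D (pidx u v) (pidx u v))) =
      (\<Sum>f<N. \<Sum>r<E * (n * n). \<Sum>s<E * (n * n). (?G \<otimes>\<^sub>m 1\<^sub>m (n * n)) $$ (r, s) * K f $$ (s, pidx u v) * cnj (K f $$ (r, pidx u v)))"
    unfolding X
    by (rule mtrace_mult_family[OF Xc krausD(5)[OF K matrix_unit_carrier]])
      (rule kraus_matrix_unit[OF K pidx_less pidx_less])
  also have "\<dots> = complex_of_real (\<Sum>f<N. \<Sum>c<n * n. guess_weight J tag W w\<^sub>0 E w (\<lambda>e. K f $$ (e * (n * n) + c, pidx u v)))"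
    unfolding tensor_one_form[OF guess_carrier, where v = "\<lambda>s. K f $$ (s, pidx u v)" for f] guess_form of_real_sum ..
  finally show ?thesis by (simp add: strategy_prob_def out kb)
qed

section \<open>The probability of a wrong output in an execution close to the ideal one\<close>

lemma kraus_total_norm:
  assumes K: "kraus m n \<Lambda> I K" and i: "i < m"
  shows "(\<Sum>x<n. \<Sum>a\<in>I. (cmod (K a $$ (x, i)))\<^sup>2) = 1"
  using kraus_column_norm[OF K i] by (subst sum.swap) simp

lemma sum_pmf_pairs:
  fixes p :: "('u::finite \<times> 'v::finite) pmf"
  shows "(\<Sum>u\<in>UNIV. \<Sum>v\<in>UNIV. pmf p (u, v)) = 1"
proof -
  have "(\<Sum>x\<in>UNIV \<times> UNIV. pmf p x) = 1" by (rule sum_pmf_eq_1) auto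
  then show ?thesis by (simp only: sum.cartesian_product')
qed

text \<open>The ideal amplitudes vanish unless Alice's output is \<open>f u v\<close>, so
  \<open>weighted_support\<close> bounds the weight elsewhere. Uhlmann's matrix mixes Kraus indices
  but not outputs, and as a contraction it increases the weight of no output; hence the bound
  carries over to the actual probabilities.\<close>

lemma ideal_fidelity_support:
  fixes f :: "'u::finite \<Rightarrow> 'v::finite \<Rightarrow> 'z::finite" and p :: "('u \<times> 'v) pmf"
  assumes \<epsilon>: "0 \<le> \<epsilon>"
    and K: "kraus (CARD('u) * CARD('v)) (CARD('z) * CARD('z)) \<Lambda> I K"
    and close: "eps_close \<epsilon> (app (id_channel (CARD('u) * CARD('v)) \<otimes>\<^sub>c \<Lambda>) (purified_input p))
       (app (id_channel (CARD('u) * CARD('v)) \<otimes>\<^sub>c ideal_functionality f) (purified_input p))"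
  shows "(\<Sum>u\<in>UNIV. \<Sum>v\<in>UNIV. pmf p (u, v) * (\<Sum>x<CARD('z) * CARD('z).
      of_bool (x div CARD('z) \<noteq> bidx (f u v)) * (\<Sum>a\<in>I. (cmod (K a $$ (x, pidx u v)))\<^sup>2))) \<le> 2 * \<epsilon>\<^sup>2"
proof -
  let ?ZZ = "CARD('z) * CARD('z)"
  note F = kraus_functionality[of f]
  note U = uhlmann_purified[OF K F, of p]
  obtain W where W: "\<And>g. (\<Sum>b\<in>UNIV. (cmod (\<Sum>a\<in>I. g a * W a b))\<^sup>2) \<le> (\<Sum>a\<in>I. (cmod (g a))\<^sup>2)"
    and Fid: "fidelity (app (id_channel (CARD('u) * CARD('v)) \<otimes>\<^sub>c \<Lambda>) (purified_input p))
       (app (id_channel (CARD('u) * CARD('v)) \<otimes>\<^sub>c ideal_functionality f) (purified_input p)) =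
      Re (\<Sum>u\<in>UNIV. \<Sum>v\<in>UNIV. pmf p (u, v) * (\<Sum>x<?ZZ. \<Sum>b\<in>UNIV.
        (\<Sum>a\<in>I. K a $$ (x, pidx u v) * W a b) * cnj (functionality_kraus f b $$ (x, pidx u v))))"
    using U(2) by blast
  define \<Omega> where "\<Omega> = (UNIV :: 'u set) \<times> (UNIV :: 'v set) \<times> {..<?ZZ} \<times> (UNIV :: ('u \<times> 'v) set)"
  define \<omega> where "\<omega> = (\<lambda>(u :: 'u, v :: 'v, x :: nat, b :: 'u \<times> 'v). pmf p (u, v))"
  define a where "a = (\<lambda>(u, v, x, b). \<Sum>a\<in>I. K a $$ (x, pidx (u :: 'u) (v :: 'v)) * W a b)"
  define k where "k = (\<lambda>(u, v, x, b). functionality_kraus f b $$ (x, pidx (u :: 'u) (v :: 'v)))"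
  \<comment> \<open>The leading digit of \<open>x\<close> is Alice's output; Bob's digit is left
    unconstrained.\<close>
  define G where "G = (\<lambda>(u, v, x, b :: 'u \<times> 'v). x div CARD('z) = bidx (f u v))"
  have conv: "(\<Sum>i\<in>\<Omega>. \<omega> i * g i) = (\<Sum>u\<in>UNIV. \<Sum>v\<in>UNIV. pmf p (u, v) * (\<Sum>x<?ZZ. \<Sum>b\<in>UNIV. g (u, v, x, b)))" for g
    unfolding \<Omega>_def sum.cartesian_product' by (simp add: \<omega>_def sum_distrib_left)
  have "1 - 2 * \<epsilon>\<^sup>2 \<le> (\<Sum>i\<in>\<Omega>. \<omega> i * (of_bool (G i) * (cmod (a i))\<^sup>2))"
  proof (rule weighted_support)
    show "0 \<le> \<omega> i" for i by (simp add: \<omega>_def split: prod.split)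
    show "(\<Sum>i\<in>\<Omega>. \<omega> i * (cmod (k i))\<^sup>2) \<le> 1"
    proof -
      have "(\<Sum>x<?ZZ. \<Sum>b\<in>UNIV. (cmod (k (u, v, x, b)))\<^sup>2) = 1" for u v
        using kraus_total_norm[OF F pidx_less[of u v]] by (simp add: k_def)
      then show ?thesis unfolding conv
        by (simp add: sum_pmf_pairs)
    qed
    show "1 - \<epsilon>\<^sup>2 \<le> Re (\<Sum>i\<in>\<Omega>. complex_of_real (\<omega> i) * (a i * cnj (k i)))"
    proof -
      have "(\<Sum>i\<in>\<Omega>. complex_of_real (\<omega> i) * (a i * cnj (k i))) =
        (\<Sum>u\<in>UNIV. \<Sum>v\<in>UNIV. pmf p (u, v) * (\<Sum>x<?ZZ. \<Sum>b\<in>UNIV.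
        (\<Sum>a\<in>I. K a $$ (x, pidx u v) * W a b) * cnj (functionality_kraus f b $$ (x, pidx u v))))"
        unfolding \<Omega>_def sum.cartesian_product' by (simp add: \<omega>_def a_def k_def sum_distrib_left)
      then show ?thesis using eps_close_fidelity[OF close \<epsilon> U(1)] Fid by simp
    qed
    show "G i" if "i \<in> \<Omega>" "k i \<noteq> 0" for i
    proof -
      obtain u v x b b' where i: "i = (u, v, x, (b, b'))" by (metis prod_cases4 surj_pair)
      have x: "x < ?ZZ" using that by (simp add: i \<Omega>_def)
      from that(2) have "x = pidx (f b b') (f b b')" "pidx u v = pidx b b'"
        unfolding i k_def using x by (auto simp: functionality_kraus_def simp del: pidx_inject split: if_splits)
      then show "G i" by (simp add: G_def i)
    qed
  qed
  also have "\<dots> \<le> (\<Sum>u\<in>UNIV. \<Sum>v\<in>UNIV. pmf p (u, v) * (\<Sum>x<?ZZ.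
      of_bool (x div CARD('z) = bidx (f u v)) * (\<Sum>a\<in>I. (cmod (K a $$ (x, pidx u v)))\<^sup>2)))"
    unfolding conv
  proof (intro sum_mono mult_left_mono)
    fix u v x
    have "(\<Sum>b\<in>UNIV. of_bool (G (u, v, x, b)) * (cmod (a (u, v, x, b)))\<^sup>2) =
        of_bool (x div CARD('z) = bidx (f u v)) * (\<Sum>b\<in>UNIV. (cmod (\<Sum>a\<in>I. K a $$ (x, pidx u v) * W a b))\<^sup>2)"
      by (simp only: G_def a_def prod.case sum_distrib_left)
    also have "\<dots> \<le> of_bool (x div CARD('z) = bidx (f u v)) * (\<Sum>a\<in>I. (cmod (K a $$ (x, pidx u v)))\<^sup>2)"
      using W by (intro mult_left_mono) simp_all
    finally show "(\<Sum>b\<in>UNIV. of_bool (G (u, v, x, b)) * (cmod (a (u, v, x, b)))\<^sup>2) \<le>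
        of_bool (x div CARD('z) = bidx (f u v)) * (\<Sum>a\<in>I. (cmod (K a $$ (x, pidx u v)))\<^sup>2)" .
  qed simp
  also have "\<dots> = 1 - (\<Sum>u\<in>UNIV. \<Sum>v\<in>UNIV. pmf p (u, v) * (\<Sum>x<?ZZ.
      of_bool (x div CARD('z) \<noteq> bidx (f u v)) * (\<Sum>a\<in>I. (cmod (K a $$ (x, pidx u v)))\<^sup>2)))"
  proof -
    have "(\<Sum>x<?ZZ. of_bool (x div CARD('z) = bidx (f u v)) * (\<Sum>a\<in>I. (cmod (K a $$ (x, pidx u v)))\<^sup>2)) =
        1 - (\<Sum>x<?ZZ. of_bool (x div CARD('z) \<noteq> bidx (f u v)) * (\<Sum>a\<in>I. (cmod (K a $$ (x, pidx u v)))\<^sup>2))" for u v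
      unfolding kraus_total_norm[OF K pidx_less[of u v], symmetric] sum_subtractf[symmetric]
      by (intro sum.cong refl) simp
    then show ?thesis
      by (simp only: right_diff_distrib sum_subtractf mult_1_right sum_pmf_pairs)
  qed
  finally show ?thesis by simp
qed

text \<open>Membership records that the outcome probabilities are nonnegative and sum to 1, so that
  a mixture of attacks again yields a distribution of outcomes.\<close>

definition attacks :: "('u::finite \<Rightarrow> 'v::finite \<Rightarrow> 'z::finite) \<Rightarrow> protocol \<Rightarrow> (party \<times> ('v \<Rightarrow> complex mat)) set" where
  "attacks f \<pi> = {s. alice_behaviour \<pi> CARD('u) (fst s) \<and> povm (out_dim \<pi> (fst s)) (snd s) \<and>
     (\<forall>(u :: 'u) v. (\<forall>w. 0 \<le> strategy_prob \<pi> s u v w) \<and> (\<Sum>w\<in>UNIV. strategy_prob \<pi> s u v w) = 1)}"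

text \<open>The payoff of a zero-sum game in which the opponent picks Alice's actual input, the
  input \<open>u\<close> at which her guess is tested, and Bob's input.\<close>

definition success :: "('u::finite \<Rightarrow> 'v::finite \<Rightarrow> 'z::finite) \<Rightarrow> protocol \<Rightarrow> party \<times> ('v \<Rightarrow> complex mat) \<Rightarrow> 'u \<times> 'u \<times> 'v \<Rightarrow> real" where
  "success f \<pi> s = (\<lambda>(u\<^sub>0, u, v). \<Sum>w\<in>UNIV. of_bool (f u v = f u w) * strategy_prob \<pi> s u\<^sub>0 v w)"

text \<open>The input distribution \<open>p\<close> mixes the marginals of \<open>\<mu>\<close> on \<open>(u\<^sub>0, v)\<close> and on \<open>(u, v)\<close>. Under the former,
  security makes Alice's guess follow the simulator's distribution \<open>L\<close>; under the latter, correctness makes \<open>L\<close>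
  a good guess. As \<open>L\<close> ignores Alice's input, the two facts combine.\<close>

lemma attack_exists:
  fixes f :: "'u::finite \<Rightarrow> 'v::finite \<Rightarrow> 'z::finite"
  assumes \<epsilon>: "0 \<le> \<epsilon>" and \<pi>: "protocol_for f \<pi>" and cor: "eps_correct \<epsilon> f \<pi>"
    and sec: "eps_secure_against_bob \<epsilon> f \<pi>"
    and \<mu>: "\<And>i. 0 \<le> \<mu> i" "(\<Sum>i\<in>(UNIV :: ('u \<times> 'u \<times> 'v) set). \<mu> i) = 1"
  shows "\<exists>s\<in>attacks f \<pi>. 1 - 22 * \<epsilon> \<le> (\<Sum>i\<in>UNIV. \<mu> i * success f \<pi> s i)"
proof -
  let ?Z = "CARD('z)" and ?D = "CARD('u) * CARD('v)"
  obtain A' EA B' EB K KB KA where A': "alice_behaviour \<pi> CARD('u) A'" "out_dim \<pi> A' = EA * ?Z"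
    and B': "bob_behaviour \<pi> CARD('v) B'" "out_dim \<pi> B' = ?Z * EB"
    and kH: "kraus ?D (?Z * ?Z) (execute \<pi> (alice \<pi>) (bob \<pi>)) ({..<EA} \<times> {..<EB}) (\<lambda>(e, f). K e f)"
    and kB: "kraus ?D (?Z * (?Z * EB)) (execute \<pi> (alice \<pi>) B') {..<EA} KB"
    and kA: "kraus ?D (EA * (?Z * ?Z)) (execute \<pi> A' (bob \<pi>)) {..<EB} KA"
    and KB: "\<And>e f c i. e < EA \<Longrightarrow> f < EB \<Longrightarrow> c < ?Z * ?Z \<Longrightarrow> i < ?D \<Longrightarrow> KB e $$ (c * EB + f, i) = K e f $$ (c, i)"
    and KA: "\<And>e f c i. e < EA \<Longrightarrow> f < EB \<Longrightarrow> c < ?Z * ?Z \<Longrightarrow> i < ?D \<Longrightarrow> KA f $$ (e * (?Z * ?Z) + c, i) = K e f $$ (c, i)"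
    by (rule protocol_dilations[OF \<pi>], rule that)
  define d where "d = ?Z * EB"
  define n where "n = ?Z * d"
  have n: "n = ?Z * ?Z * EB" by (simp add: n_def d_def mult.assoc)
  define pw where "pw = (\<lambda>(u, v). ((\<Sum>u2\<in>UNIV. \<mu> (u, u2, v)) + (\<Sum>u0\<in>UNIV. \<mu> (u0, u, v))) / 2)"
  have \<mu>1: "(\<Sum>u0\<in>UNIV. \<Sum>u\<in>UNIV. \<Sum>v\<in>UNIV. \<mu> (u0, u, v)) = 1"
    using \<mu>(2) by (simp only: UNIV_Times_UNIV[symmetric] sum.cartesian_product')
  have "\<exists>p. set_pmf p \<subseteq> UNIV \<and> (\<forall>x\<in>UNIV. pmf p x = pw x)"
  proof (rule pmf_of_weights)
    show "0 \<le> pw x" for x using \<mu>(1) by (simp add: pw_def sum_nonneg split: prod.split)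
    have "(\<Sum>u\<in>UNIV. \<Sum>v\<in>UNIV. \<Sum>u2\<in>UNIV. \<mu> (u, u2, v)) = 1"
      unfolding \<mu>1[symmetric] by (rule sum.cong[OF refl], rule sum.swap)
    moreover have "(\<Sum>u\<in>UNIV. \<Sum>v\<in>UNIV. \<Sum>u0\<in>UNIV. \<mu> (u0, u, v)) = 1"
      unfolding \<mu>1[symmetric] by (rule sum_swap3)
    moreover have "(\<Sum>x\<in>UNIV. pw x) = (\<Sum>u\<in>UNIV. \<Sum>v\<in>UNIV. pw (u, v))"
      by (simp only: UNIV_Times_UNIV[symmetric] sum.cartesian_product')
    ultimately show "(\<Sum>x\<in>UNIV. pw x) = 1"
      by (simp add: pw_def sum.distrib flip: sum_divide_distrib)
  qed simp
  then obtain p where p: "\<And>u v. pmf p (u, v) = pw (u, v)" by auto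
  \<comment> \<open>Each marginal has weight one half in \<open>p\<close>, so a bound on a
    \<open>p\<close>-average costs a factor 2 for either marginal.\<close>
  have p_le: "(\<Sum>u2\<in>UNIV. \<mu> (u, u2, v)) \<le> 2 * pmf p (u, v)" "(\<Sum>u0\<in>UNIV. \<mu> (u0, u, v)) \<le> 2 * pmf p (u, v)" for u v
    using \<mu>(1) by (simp_all add: p pw_def sum_nonneg)
  have p1: "(\<Sum>u\<in>UNIV. \<Sum>v\<in>UNIV. pmf p (u, v)) = 1"
    by (rule sum_pmf_pairs)
  obtain k \<Lambda>1 \<Lambda>2 where \<Lambda>: "cptp CARD('v) (CARD('v) * k) \<Lambda>1" "cptp (?Z * k) d \<Lambda>2"
    and close: "eps_close \<epsilon> (app (id_channel ?D \<otimes>\<^sub>c execute \<pi> (alice \<pi>) B') (purified_input p))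
      (app (id_channel ?D \<otimes>\<^sub>c ideal_execution f k \<Lambda>1 \<Lambda>2) (purified_input p))"
    using sec B' unfolding eps_secure_against_bob_def d_def by metis
  obtain J :: "(nat \<times> ('u \<times> 'v) \<times> nat) set" and R and L :: "'v \<Rightarrow> 'v \<Rightarrow> real"
    where kR: "kraus ?D n (ideal_execution f k \<Lambda>1 \<Lambda>2) J R"
    and R_supp: "\<And>j u v z y. j \<in> J \<Longrightarrow> y < d \<Longrightarrow> R j $$ (bidx (z :: 'z) * d + y, pidx (u :: 'u) (v :: 'v)) \<noteq> 0 \<Longrightarrow> z = f u (snd (fst (snd j)))"
    and L: "\<And>u v w. (\<Sum>z\<in>(UNIV :: 'z set). \<Sum>y<d. \<Sum>j\<in>J. of_bool (snd (fst (snd j)) = w) *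
      (cmod (R j $$ (bidx z * d + y, pidx (u :: 'u) v)))\<^sup>2) = L v w"
    using kraus_ideal_execution[OF \<Lambda>, of f] unfolding n_def by blast
  define tag where "tag j = snd (fst (snd j))" for j :: "nat \<times> ('u \<times> 'v) \<times> nat"
  have kB: "kraus ?D n (execute \<pi> (alice \<pi>) B') {..<EA} KB" using kB by (simp add: n_def d_def)
  note U = uhlmann_purified[OF kB kR, of p]
  obtain W where W: "\<And>g. (\<Sum>b\<in>J. (cmod (\<Sum>e<EA. g e * W e b))\<^sup>2) \<le> (\<Sum>e<EA. (cmod (g e))\<^sup>2)"
    and Fid: "fidelity (app (id_channel ?D \<otimes>\<^sub>c execute \<pi> (alice \<pi>) B') (purified_input p))
      (app (id_channel ?D \<otimes>\<^sub>c ideal_execution f k \<Lambda>1 \<Lambda>2) (purified_input p)) =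
      Re (\<Sum>u\<in>UNIV. \<Sum>v\<in>UNIV. pmf p (u, v) * (\<Sum>x<n. \<Sum>b\<in>J.
        (\<Sum>e<EA. KB e $$ (x, pidx u v) * W e b) * cnj (R b $$ (x, pidx u v))))"
    using U(2) by blast
  \<comment> \<open>\<open>am\<close> is the real run after Uhlmann's matrix has acted on Alice's
    environment, \<open>re\<close> the simulated run. The index \<open>x\<close> consists of Alice's
    output as leading digit, Bob's output and Bob's environment.\<close>
  define am where "am u v x b = (\<Sum>e<EA. KB e $$ (x, pidx (u :: 'u) (v :: 'v)) * W e b)" for u v x b
  define re where "re u v x b = R b $$ (x, pidx (u :: 'u) (v :: 'v))" for u v x b
  have am_le: "(\<Sum>b\<in>J. (cmod (am u v x b))\<^sup>2) \<le> (\<Sum>e<EA. (cmod (KB e $$ (x, pidx u v)))\<^sup>2)" for u v x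
    unfolding am_def by (rule W)
  have re_supp: "x div d = bidx (f u (tag b))" if "b \<in> J" "x < n" "re u v x b \<noteq> 0" for u v x b
  proof -
    have d: "d > 0" using that(2) by (cases d) (auto simp: n_def)
    then have "x div d < ?Z" using that(2) by (simp add: n_def less_mult_imp_div_less)
    then obtain z :: 'z where z: "bidx z = x div d"
      using bij_bidx[where 'a = 'z] unfolding bij_betw_def by (metis imageE lessThan_iff)
    then have "x = bidx z * d + x mod d" by simp
    then have "z = f u (tag b)" using R_supp[OF that(1), of "x mod d" z u v] that(3) d unfolding re_def tag_def by simp
    then show ?thesis using z by simp
  qed
  have L': "(\<Sum>x<n. \<Sum>b\<in>J. of_bool (tag b = w) * (cmod (re u v x b))\<^sup>2) = L v w" for u v w
    using L[of w u v] by (simp add: n_def sum_lessThan_mult sum_bidx re_def tag_def)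
  have re1: "(\<Sum>x<n. \<Sum>b\<in>J. (cmod (re u v x b))\<^sup>2) = 1" for u v
    unfolding re_def by (rule kraus_total_norm[OF kR pidx_less])
  have am1: "(\<Sum>x<n. \<Sum>b\<in>J. (cmod (am u v x b))\<^sup>2) \<le> 1" for u v
    unfolding kraus_total_norm[OF kB pidx_less[of u v], symmetric] by (intro sum_mono am_le)
  \<comment> \<open>Summing over values \<open>w\<close> and then over the indices with tag
    \<open>w\<close> runs through all of \<open>J\<close> once.\<close>
  have tag_sum: "(\<Sum>w\<in>UNIV. of_bool (P w) * (\<Sum>x<n. \<Sum>b\<in>J. of_bool (tag b = w) * g x b)) =
      (\<Sum>x<n. \<Sum>b\<in>J. of_bool (P (tag b)) * (g x b :: real))" for P g
  proof -
    have "(\<Sum>w\<in>UNIV. of_bool (P w) * (\<Sum>x<n. \<Sum>b\<in>J. of_bool (tag b = w) * g x b)) =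
        (\<Sum>w\<in>UNIV. \<Sum>x<n. \<Sum>b\<in>J. of_bool (tag b = w) * (of_bool (P (tag b)) * g x b))"
      unfolding sum_distrib_left by (intro sum.cong refl) (auto simp: of_bool_def)
    also have "\<dots> = (\<Sum>x<n. \<Sum>b\<in>J. \<Sum>w\<in>UNIV. of_bool (tag b = w) * (of_bool (P (tag b)) * g x b))"
      by (subst sum_swap3[symmetric]) (rule refl)
    finally show ?thesis by (simp only: sum_of_bool_tag)
  qed
  have L1: "(\<Sum>w\<in>UNIV. L v w) = 1" for v
    using tag_sum[of "\<lambda>_. True" "\<lambda>x b. (cmod (re u v x b))\<^sup>2" for u] re1[of _ v] unfolding L' by simp

  define w\<^sub>0 :: 'v where "w\<^sub>0 = undefined"
  define s where "s = (A', \<lambda>w. guess_mat J tag W w\<^sub>0 EA w \<otimes>\<^sub>m 1\<^sub>m ?Z)"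
  define q where "q u v w = (\<Sum>f<EB. \<Sum>c<?Z * ?Z. guess_weight J tag W w\<^sub>0 EA w (\<lambda>e. KA f $$ (e * (?Z * ?Z) + c, pidx u v)))"
    for u :: 'u and v w :: 'v
  have prob: "strategy_prob \<pi> s u v w = q u v w" for u v w
    unfolding s_def q_def
    by (rule guess_strategy_prob[OF kA]) (use \<pi> in \<open>simp add: protocol_for_def\<close>)
  have q0: "0 \<le> q u v w" for u v w
    unfolding q_def by (intro sum_nonneg guess_weight_nonneg(1)[OF W])
  have q1: "(\<Sum>w\<in>UNIV. q u v w) = 1" for u v
  proof -
    have "(\<Sum>w\<in>UNIV. q u v w) = (\<Sum>f<EB. \<Sum>c<?Z * ?Z. \<Sum>e<EA. (cmod (KA f $$ (e * (?Z * ?Z) + c, pidx u v)))\<^sup>2)"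
      unfolding q_def by (subst sum_swap3[symmetric]) (simp only: guess_weight_sum)
    also have "\<dots> = (\<Sum>f<EB. \<Sum>e<EA. \<Sum>c<?Z * ?Z. (cmod (KA f $$ (e * (?Z * ?Z) + c, pidx u v)))\<^sup>2)"
      by (rule sum.cong[OF refl], rule sum.swap)
    also have "\<dots> = 1"
      using kraus_column_norm[OF kA pidx_less[of u v]] by (simp add: sum_lessThan_mult[of _ EA])
    finally show ?thesis .
  qed
  have s: "s \<in> attacks f \<pi>"
    unfolding attacks_def using A' guess_povm[OF W, of ?Z tag w\<^sub>0] by (simp add: prob q0 q1) (simp add: s_def)

  \<comment> \<open>The attack runs against honest Bob, \<open>am\<close> refers to purified Bob. By
    \<open>KA\<close> and \<open>KB\<close> the amplitudes agree, with Bob's history as Kraus index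
    in the former and as last digit of \<open>x\<close> in the latter. The defect makes this an
    inequality.\<close>
  have q_ge: "(\<Sum>x<n. \<Sum>b\<in>J. of_bool (tag b = w) * (cmod (am u v x b))\<^sup>2) \<le> q u v w" for u v w
  proof -
    have "(\<Sum>x<n. \<Sum>b\<in>J. of_bool (tag b = w) * (cmod (am u v x b))\<^sup>2) =
        (\<Sum>c<?Z * ?Z. \<Sum>f<EB. \<Sum>b\<in>J. of_bool (tag b = w) * (cmod (\<Sum>e<EA. KA f $$ (e * (?Z * ?Z) + c, pidx u v) * W e b))\<^sup>2)"
      unfolding n sum_lessThan_mult[of _ "?Z * ?Z" EB]
      by (intro sum.cong refl) (simp add: am_def KB KA)
    also have "\<dots> \<le> (\<Sum>c<?Z * ?Z. \<Sum>f<EB. guess_weight J tag W w\<^sub>0 EA w (\<lambda>e. KA f $$ (e * (?Z * ?Z) + c, pidx u v)))"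
      by (intro sum_mono guess_weight_nonneg(2)[OF W])
    also have "\<dots> = q u v w" unfolding q_def by (rule sum.swap)
    finally show ?thesis .
  qed

  define \<Omega> where "\<Omega> = (UNIV :: 'u set) \<times> (UNIV :: 'v set) \<times> {..<n} \<times> J"
  define \<omega> where "\<omega> = (\<lambda>(u :: 'u, v :: 'v, x :: nat, b :: nat \<times> ('u \<times> 'v) \<times> nat). pmf p (u, v))"
  define a where "a = (\<lambda>(u, v, x, b). am u v x b)"
  define r where "r = (\<lambda>(u, v, x, b). re u v x b)"
  have conv: "(\<Sum>i\<in>\<Omega>. \<omega> i * g i) = (\<Sum>u\<in>UNIV. \<Sum>v\<in>UNIV. pmf p (u, v) * (\<Sum>x<n. \<Sum>b\<in>J. g (u, v, x, b)))" for g
    unfolding \<Omega>_def sum.cartesian_product' by (simp add: \<omega>_def sum_distrib_left)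
  have \<omega>0: "0 \<le> \<omega> i" for i by (simp add: \<omega>_def split: prod.split)
  have a1: "(\<Sum>i\<in>\<Omega>. \<omega> i * (cmod (a i))\<^sup>2) \<le> 1"
  proof -
    have "(\<Sum>i\<in>\<Omega>. \<omega> i * (cmod (a i))\<^sup>2) \<le> (\<Sum>u\<in>UNIV. \<Sum>v\<in>UNIV. pmf p (u, v) * 1)"
      unfolding conv using am1 by (intro sum_mono mult_left_mono) (simp_all add: a_def)
    then show ?thesis using p1 by simp
  qed
  have r1: "(\<Sum>i\<in>\<Omega>. \<omega> i * (cmod (r i))\<^sup>2) \<le> 1"
    unfolding conv by (simp add: r_def re1 p1)
  have ar: "1 - \<epsilon>\<^sup>2 \<le> Re (\<Sum>i\<in>\<Omega>. complex_of_real (\<omega> i) * (a i * cnj (r i)))"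
  proof -
    have "(\<Sum>i\<in>\<Omega>. complex_of_real (\<omega> i) * (a i * cnj (r i))) =
      (\<Sum>u\<in>UNIV. \<Sum>v\<in>UNIV. pmf p (u, v) * (\<Sum>x<n. \<Sum>b\<in>J.
        (\<Sum>e<EA. KB e $$ (x, pidx u v) * W e b) * cnj (R b $$ (x, pidx u v))))"
      unfolding \<Omega>_def sum.cartesian_product' by (simp add: \<omega>_def a_def r_def am_def re_def sum_distrib_left)
    then show ?thesis using eps_close_fidelity[OF close \<epsilon>(1) U(1)] Fid by simp
  qed
  note close1 = weighted_closeness(1)[OF \<omega>0 a1 r1 \<epsilon>(1) ar, unfolded conv a_def r_def prod.case]
  note close2 = weighted_closeness(2)[OF \<omega>0 a1 r1 \<epsilon>(1) ar, unfolded conv a_def r_def prod.case]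

  \<comment> \<open>Only the shortfall below \<open>L\<close> matters; an excess of
    \<open>q\<close>, such as the defect, cannot reduce the success probability.\<close>
  define lack where "lack u v = (\<Sum>w\<in>UNIV. max 0 (L v w - q u v w))" for u v
  have lack: "(\<Sum>u\<in>UNIV. \<Sum>v\<in>UNIV. pmf p (u, v) * lack u v) \<le> 3 * \<epsilon>"
  proof -
    have "lack u v \<le> (\<Sum>x<n. \<Sum>b\<in>J. \<bar>(cmod (re u v x b))\<^sup>2 - (cmod (am u v x b))\<^sup>2\<bar>)" for u v
    proof -
      have "max 0 (L v w - q u v w) \<le> (\<Sum>x<n. \<Sum>b\<in>J. of_bool (tag b = w) * \<bar>(cmod (re u v x b))\<^sup>2 - (cmod (am u v x b))\<^sup>2\<bar>)" for w
      proof (rule max.boundedI)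
        have "L v w - q u v w \<le> (\<Sum>x<n. \<Sum>b\<in>J. of_bool (tag b = w) * ((cmod (re u v x b))\<^sup>2 - (cmod (am u v x b))\<^sup>2))"
          using q_ge[of w u v] by (simp add: L'[of w u v, symmetric] right_diff_distrib sum_subtractf)
        also have "\<dots> \<le> (\<Sum>x<n. \<Sum>b\<in>J. of_bool (tag b = w) * \<bar>(cmod (re u v x b))\<^sup>2 - (cmod (am u v x b))\<^sup>2\<bar>)"
          by (intro sum_mono mult_left_mono) simp_all
        finally show "L v w - q u v w \<le> (\<Sum>x<n. \<Sum>b\<in>J. of_bool (tag b = w) * \<bar>(cmod (re u v x b))\<^sup>2 - (cmod (am u v x b))\<^sup>2\<bar>)" .
      qed (intro sum_nonneg, simp)
      then have "lack u v \<le> (\<Sum>w\<in>UNIV. of_bool True * (\<Sum>x<n. \<Sum>b\<in>J. of_bool (tag b = w) * \<bar>(cmod (re u v x b))\<^sup>2 - (cmod (am u v x b))\<^sup>2\<bar>))"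
        unfolding lack_def by (intro sum_mono) simp
      then show ?thesis unfolding tag_sum by simp
    qed
    then have "(\<Sum>u\<in>UNIV. \<Sum>v\<in>UNIV. pmf p (u, v) * lack u v) \<le> (\<Sum>u\<in>UNIV. \<Sum>v\<in>UNIV. pmf p (u, v) *
        (\<Sum>x<n. \<Sum>b\<in>J. \<bar>(cmod (re u v x b))\<^sup>2 - (cmod (am u v x b))\<^sup>2\<bar>))"
      by (intro sum_mono mult_left_mono) simp_all
    with close2 show ?thesis by linarith
  qed

  define wrong where "wrong u v = (\<Sum>x<?Z * ?Z. of_bool (x div ?Z \<noteq> bidx (f u v)) *
      (\<Sum>i\<in>{..<EA} \<times> {..<EB}. (cmod ((case i of (e, f) \<Rightarrow> K e f) $$ (x, pidx u v)))\<^sup>2))" for u v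
  have wrong: "(\<Sum>u\<in>UNIV. \<Sum>v\<in>UNIV. pmf p (u, v) * wrong u v) \<le> 2 * \<epsilon>\<^sup>2"
    unfolding wrong_def using cor ideal_fidelity_support[OF \<epsilon>(1) kH, of p f] by (auto simp: eps_correct_def)
  \<comment> \<open>Purified Bob's additional register is the last digit, so Alice's output remains
    the leading one and her error probability can be read off the run against purified Bob.\<close>
  have wrong': "wrong u v = (\<Sum>x<n. of_bool (x div d \<noteq> bidx (f u v)) * (\<Sum>e<EA. (cmod (KB e $$ (x, pidx u v)))\<^sup>2))" for u v
  proof -
    have "(\<Sum>x<n. of_bool (x div d \<noteq> bidx (f u v)) * (\<Sum>e<EA. (cmod (KB e $$ (x, pidx u v)))\<^sup>2)) =
      (\<Sum>c<?Z * ?Z. \<Sum>h<EB. of_bool (c div ?Z \<noteq> bidx (f u v)) * (\<Sum>e<EA. (cmod (K e h $$ (c, pidx u v)))\<^sup>2))"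
      unfolding n sum_lessThan_mult[of _ "?Z * ?Z" EB]
    proof (intro sum.cong refl)
      fix c h assume "c \<in> {..<?Z * ?Z}" "h \<in> {..<EB}"
      then have ch: "c < ?Z * ?Z" "h < EB" by auto
      have "(c * EB + h) div d = c div ?Z"
        using ch unfolding d_def mult.commute[of ?Z EB] div_mult2_eq by simp
      then show "of_bool ((c * EB + h) div d \<noteq> bidx (f u v)) * (\<Sum>e<EA. (cmod (KB e $$ (c * EB + h, pidx u v)))\<^sup>2) =
        of_bool (c div ?Z \<noteq> bidx (f u v)) * (\<Sum>e<EA. (cmod (K e h $$ (c, pidx u v)))\<^sup>2)"
        using ch by (simp add: KB)
    qed
    also have "\<dots> = wrong u v"
      unfolding wrong_def sum_distrib_left[symmetric] sum.cartesian_product' prod.case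
      by (subst sum.swap[of _ "{..<EB}"]) (rule refl)
    finally show ?thesis by simp
  qed
  define bad where "bad u v = (\<Sum>w\<in>UNIV. of_bool (f u v \<noteq> f u w) * L v w)" for u v
  have bad: "(\<Sum>u\<in>UNIV. \<Sum>v\<in>UNIV. pmf p (u, v) * bad u v) \<le> 8 * \<epsilon>\<^sup>2"
  proof -
    \<comment> \<open>The simulated run gives Alice the output \<open>f u (tag b)\<close>. Where
      this differs from \<open>f u v\<close>, a nonzero amplitude of \<open>re\<close> sits at a
      wrong output; replacing \<open>re\<close> by \<open>am\<close> leads to the error probability
      of the honest run. With \<open>wrong\<close> and \<open>close1\<close> both bounded by
      \<open>2 * \<epsilon>\<^sup>2\<close>, this gives the 8.\<close>
    have "bad u v \<le> 2 * wrong u v + 2 * (\<Sum>x<n. \<Sum>b\<in>J. (cmod (re u v x b - am u v x b))\<^sup>2)" for u v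
    proof -
      have "bad u v = (\<Sum>x<n. \<Sum>b\<in>J. of_bool (f u v \<noteq> f u (tag b)) * (cmod (re u v x b))\<^sup>2)"
        using tag_sum[of "\<lambda>w. f u v \<noteq> f u w" "\<lambda>x b. (cmod (re u v x b))\<^sup>2"] unfolding bad_def L' .
      also have "\<dots> \<le> (\<Sum>x<n. \<Sum>b\<in>J. 2 * (of_bool (x div d \<noteq> bidx (f u v)) * (cmod (am u v x b))\<^sup>2) + 2 * (cmod (re u v x b - am u v x b))\<^sup>2)"
      proof (intro sum_mono)
        fix x b assume "x \<in> {..<n}" "b \<in> J"
        then have xb: "x < n" "b \<in> J" by auto
        show "of_bool (f u v \<noteq> f u (tag b)) * (cmod (re u v x b))\<^sup>2 \<le>
          2 * (of_bool (x div d \<noteq> bidx (f u v)) * (cmod (am u v x b))\<^sup>2) + 2 * (cmod (re u v x b - am u v x b))\<^sup>2"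
        proof (cases "re u v x b = 0 \<or> f u v = f u (tag b)")
          case False
          then have "x div d \<noteq> bidx (f u v)" using re_supp[OF xb(2,1), of u v] by auto
          moreover have "(cmod (re u v x b))\<^sup>2 \<le> 2 * (cmod (am u v x b))\<^sup>2 + 2 * (cmod (re u v x b - am u v x b))\<^sup>2"
          proof -
            have "cmod (re u v x b) \<le> cmod (am u v x b) + cmod (re u v x b - am u v x b)"
              by (metis add.commute diff_add_cancel norm_triangle_ineq)
            then have "(cmod (re u v x b))\<^sup>2 \<le> (cmod (am u v x b) + cmod (re u v x b - am u v x b))\<^sup>2"
              by (rule power_mono) simp
            also have "\<dots> \<le> 2 * (cmod (am u v x b))\<^sup>2 + 2 * (cmod (re u v x b - am u v x b))\<^sup>2"
              using zero_le_power2[of "cmod (am u v x b) - cmod (re u v x b - am u v x b)"] by (simp add: power2_sum power2_diff)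
            finally show ?thesis .
          qed
          ultimately show ?thesis using False by simp
        qed auto
      qed
      also have "\<dots> = 2 * (\<Sum>x<n. of_bool (x div d \<noteq> bidx (f u v)) * (\<Sum>b\<in>J. (cmod (am u v x b))\<^sup>2)) +
          2 * (\<Sum>x<n. \<Sum>b\<in>J. (cmod (re u v x b - am u v x b))\<^sup>2)"
        by (simp only: sum.distrib sum_distrib_left)
      also have "(\<Sum>x<n. of_bool (x div d \<noteq> bidx (f u v)) * (\<Sum>b\<in>J. (cmod (am u v x b))\<^sup>2)) \<le> wrong u v"
        unfolding wrong' by (intro sum_mono mult_left_mono am_le) simp
      finally show ?thesis by simp
    qed
    then have "(\<Sum>u\<in>UNIV. \<Sum>v\<in>UNIV. pmf p (u, v) * bad u v) \<le> (\<Sum>u\<in>UNIV. \<Sum>v\<in>UNIV. pmf p (u, v) *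
        (2 * wrong u v + 2 * (\<Sum>x<n. \<Sum>b\<in>J. (cmod (re u v x b - am u v x b))\<^sup>2)))"
      by (intro sum_mono mult_left_mono) simp_all
    also have "\<dots> = 2 * (\<Sum>u\<in>UNIV. \<Sum>v\<in>UNIV. pmf p (u, v) * wrong u v) +
        2 * (\<Sum>u\<in>UNIV. \<Sum>v\<in>UNIV. pmf p (u, v) * (\<Sum>x<n. \<Sum>b\<in>J. (cmod (re u v x b - am u v x b))\<^sup>2))"
      by (simp only: distrib_left sum.distrib mult.left_commute[of _ 2] flip: sum_distrib_left)
    finally show ?thesis using wrong close1 by linarith
  qed

  \<comment> \<open>\<open>L v\<close> does not depend on Alice's input, so it can be judged at
    \<open>u\<close> through \<open>bad\<close> and compared with the guess at \<open>u0\<close>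
    through \<open>lack\<close>.\<close>
  have win: "1 - bad u v - lack u0 v \<le> success f \<pi> s (u0, u, v)" for u0 u v
  proof -
    have "1 - bad u v - lack u0 v = (\<Sum>w\<in>UNIV. of_bool (f u v = f u w) * L v w - max 0 (L v w - q u0 v w))"
      unfolding bad_def lack_def L1[of v, symmetric] sum_subtractf[symmetric] by (intro sum.cong refl) auto
    also have "\<dots> \<le> (\<Sum>w\<in>UNIV. of_bool (f u v = f u w) * q u0 v w)"
      by (intro sum_mono) auto
    finally show ?thesis by (simp add: success_def prob)
  qed
  have lack0: "0 \<le> lack u v" for u v unfolding lack_def by (intro sum_nonneg) simp
  have L0: "0 \<le> L v w" for v w unfolding L'[of w undefined v, symmetric] by (intro sum_nonneg) simp
  have bad0: "0 \<le> bad u v" for u v unfolding bad_def using L0 by (intro sum_nonneg) simp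
  \<comment> \<open>\<open>bad\<close> depends on \<open>(u, v)\<close> only, and
    \<open>lack\<close> below on \<open>(u0, v)\<close> only, so each average reduces to one
    marginal of \<mu>.\<close>
  have "(\<Sum>u0\<in>UNIV. \<Sum>u\<in>UNIV. \<Sum>v\<in>UNIV. \<mu> (u0, u, v) * bad u v) = (\<Sum>u\<in>UNIV. \<Sum>v\<in>UNIV. (\<Sum>u0\<in>UNIV. \<mu> (u0, u, v)) * bad u v)"
    unfolding sum_distrib_right by (rule sum_swap3[symmetric])
  also have "\<dots> \<le> (\<Sum>u\<in>UNIV. \<Sum>v\<in>UNIV. (2 * pmf p (u, v)) * bad u v)"
    by (intro sum_mono mult_right_mono p_le bad0)
  also have "\<dots> \<le> 16 * \<epsilon>\<^sup>2" using bad by (simp add: mult.assoc flip: sum_distrib_left)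
  finally have 1: "(\<Sum>u0\<in>UNIV. \<Sum>u\<in>UNIV. \<Sum>v\<in>UNIV. \<mu> (u0, u, v) * bad u v) \<le> 16 * \<epsilon>\<^sup>2" .
  have "(\<Sum>u0\<in>UNIV. \<Sum>u\<in>UNIV. \<Sum>v\<in>UNIV. \<mu> (u0, u, v) * lack u0 v) = (\<Sum>u0\<in>UNIV. \<Sum>v\<in>UNIV. (\<Sum>u\<in>UNIV. \<mu> (u0, u, v)) * lack u0 v)"
    unfolding sum_distrib_right by (rule sum.cong[OF refl], rule sum.swap)
  also have "\<dots> \<le> (\<Sum>u\<in>UNIV. \<Sum>v\<in>UNIV. (2 * pmf p (u, v)) * lack u v)"
    by (intro sum_mono mult_right_mono p_le lack0)
  also have "\<dots> \<le> 6 * \<epsilon>" using lack by (simp add: mult.assoc flip: sum_distrib_left)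
  finally have 2: "(\<Sum>u0\<in>UNIV. \<Sum>u\<in>UNIV. \<Sum>v\<in>UNIV. \<mu> (u0, u, v) * lack u0 v) \<le> 6 * \<epsilon>" .
  have "1 - 16 * \<epsilon>\<^sup>2 - 6 * \<epsilon> \<le> (\<Sum>u0\<in>UNIV. \<Sum>u\<in>UNIV. \<Sum>v\<in>UNIV. \<mu> (u0, u, v)) -
      (\<Sum>u0\<in>UNIV. \<Sum>u\<in>UNIV. \<Sum>v\<in>UNIV. \<mu> (u0, u, v) * bad u v) - (\<Sum>u0\<in>UNIV. \<Sum>u\<in>UNIV. \<Sum>v\<in>UNIV. \<mu> (u0, u, v) * lack u0 v)"
    using 1 2 \<mu>1 by linarith
  also have "\<dots> = (\<Sum>u0\<in>UNIV. \<Sum>u\<in>UNIV. \<Sum>v\<in>UNIV. \<mu> (u0, u, v) * (1 - bad u v - lack u0 v))"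
    by (simp add: right_diff_distrib sum_subtractf)
  also have "\<dots> \<le> (\<Sum>u0\<in>UNIV. \<Sum>u\<in>UNIV. \<Sum>v\<in>UNIV. \<mu> (u0, u, v) * success f \<pi> s (u0, u, v))"
    by (intro sum_mono mult_left_mono win \<mu>(1))
  also have "\<dots> = (\<Sum>i\<in>UNIV. \<mu> i * success f \<pi> s i)"
    by (simp only: UNIV_Times_UNIV[symmetric] sum.cartesian_product')
  finally have *: "1 - 16 * \<epsilon>\<^sup>2 - 6 * \<epsilon> \<le> (\<Sum>i\<in>UNIV. \<mu> i * success f \<pi> s i)" .
  \<comment> \<open>For \<open>\<epsilon> \<le> 1\<close> the quadratic term is absorbed into the
    linear one; for larger \<epsilon> the bound is negative while the payoff is not.\<close>
  have "1 - 22 * \<epsilon> \<le> (\<Sum>i\<in>UNIV. \<mu> i * success f \<pi> s i)"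
  proof (cases "\<epsilon> \<le> 1")
    case True
    then have "1 - 22 * \<epsilon> \<le> 1 - 16 * \<epsilon>\<^sup>2 - 6 * \<epsilon>"
      using \<epsilon> by (simp add: power2_eq_square mult_left_le)
    with * show ?thesis by linarith
  next
    case False
    moreover have "0 \<le> (\<Sum>i\<in>UNIV. \<mu> i * success f \<pi> s i)"
      by (intro sum_nonneg mult_nonneg_nonneg \<mu>(1)) (auto simp: success_def prob q0 intro!: sum_nonneg)
    ultimately show ?thesis by linarith
  qed
  then show ?thesis using s by blast
qed

section \<open>From attacks that are good on average to one randomised attack\<close>

theorem theorem2:
  fixes f :: "'u::finite \<Rightarrow> 'v::finite \<Rightarrow> 'z::finite"
    and \<epsilon> :: real
    and \<pi> :: protocol
  assumes "\<epsilon> \<ge> 0"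
    and "protocol_for f \<pi>"
    and "eps_correct \<epsilon> f \<pi>"
    and "eps_secure_against_bob \<epsilon> f \<pi>"
  shows "\<exists>S :: 'v alice_strategy. cheating_strategy f \<pi> S \<and>
    (\<exists>Q :: 'u \<Rightarrow> 'v \<Rightarrow> 'v pmf.
      (\<forall>u\<^sub>0 v w. pmf (Q u\<^sub>0 v) w = outcome_prob \<pi> S u\<^sub>0 v w) \<and>
      (\<forall>u\<^sub>0 v u. measure_pmf.prob (Q u\<^sub>0 v) {w. f u v = f u w} \<ge> 1 - 28 * \<epsilon>))"
proof -
  have attack: "\<exists>s\<in>attacks f \<pi>. 1 - 22 * \<epsilon> \<le> (\<Sum>i\<in>UNIV. \<mu> i * success f \<pi> s i)"
    if "\<And>i. 0 \<le> \<mu> i" "(\<Sum>i\<in>(UNIV :: ('u \<times> 'u \<times> 'v) set). \<mu> i) = 1" for \<mu>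
    using attack_exists[OF assms that] .
  have "\<exists>S w. finite S \<and> S \<subseteq> attacks f \<pi> \<and> (\<forall>s\<in>S. 0 \<le> w s) \<and> (\<Sum>s\<in>S. w s) = 1 \<and>
    (\<forall>i. 1 - 28 * \<epsilon> \<le> (\<Sum>s\<in>S. w s * success f \<pi> s i))"
  proof (cases "\<epsilon> = 0")
    case False
    then show ?thesis using assms(1) by (intro minimax[OF attack]) auto
  next
    \<comment> \<open>The minimax argument loses an arbitrarily small amount; for \<open>\<epsilon> = 0\<close> the uniform distribution already forces certainty.\<close>
    case True
    define N where "N = real CARD('u \<times> 'u \<times> 'v)"
    have N: "N > 0" by (simp add: N_def)
    obtain s where s: "s \<in> attacks f \<pi>" and "1 - 22 * \<epsilon> \<le> (\<Sum>i\<in>UNIV. 1 / N * success f \<pi> s i)"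
      using attack[of "\<lambda>_. 1 / N"] N by (auto simp: N_def)
    then have ge: "N \<le> (\<Sum>i\<in>UNIV. success f \<pi> s i)"
      using True N by (simp add: pos_le_divide_eq flip: sum_divide_distrib)
    have le: "success f \<pi> s i \<le> 1" for i
    proof (cases i)
      case (fields u\<^sub>0 u v)
      have "(\<Sum>w\<in>UNIV. of_bool (f u v = f u w) * strategy_prob \<pi> s u\<^sub>0 v w) \<le> (\<Sum>w\<in>UNIV. strategy_prob \<pi> s u\<^sub>0 v w)"
        using s by (intro sum_mono) (auto simp: attacks_def)
      then show ?thesis using s by (simp add: fields success_def attacks_def)
    qed
    have "1 \<le> success f \<pi> s i" for i
    proof (rule ccontr)
      assume "\<not> 1 \<le> success f \<pi> s i"
      then have "(\<Sum>i\<in>UNIV. success f \<pi> s i) < (\<Sum>i\<in>(UNIV :: ('u \<times> 'u \<times> 'v) set). 1)"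
        using le by (intro sum_strict_mono_ex1 bexI[of _ i]) simp_all
      then show False using ge by (simp add: N_def)
    qed
    then show ?thesis using s True by (intro exI[of _ "{s}"] exI[of _ "\<lambda>_. 1"]) simp
  qed
  then obtain T c where T: "finite T" "T \<subseteq> attacks f \<pi>" "\<And>s. s \<in> T \<Longrightarrow> 0 \<le> c s" "(\<Sum>s\<in>T. c s) = 1"
    and good: "\<And>i. 1 - 28 * \<epsilon> \<le> (\<Sum>s\<in>T. c s * success f \<pi> s i)" by blast
  \<comment> \<open>The weights of the mixture become Alice's private randomness.\<close>
  obtain S where S: "set_pmf S \<subseteq> T" "\<forall>s\<in>T. pmf S s = c s"
    using pmf_of_weights[OF T(1,3,4)] by blast
  have out: "outcome_prob \<pi> S u v w = (\<Sum>s\<in>T. c s * strategy_prob \<pi> s u v w)" for u :: 'u and v w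
  proof -
    have "outcome_prob \<pi> S u v w = measure_pmf.expectation S (\<lambda>s. strategy_prob \<pi> s u v w)"
      by (simp add: outcome_prob_def strategy_prob_def case_prod_unfold)
    also have "\<dots> = (\<Sum>s\<in>T. pmf S s *\<^sub>R strategy_prob \<pi> s u v w)"
      by (rule integral_measure_pmf[OF T(1)]) (use S(1) in auto)
    finally show ?thesis using S(2) by simp
  qed
  have out0: "0 \<le> outcome_prob \<pi> S u v w" for u :: 'u and v w
    unfolding out using T(2,3) by (intro sum_nonneg mult_nonneg_nonneg) (auto simp: attacks_def)
  have out1: "(\<Sum>w\<in>UNIV. outcome_prob \<pi> S u v w) = 1" for u :: 'u and v
  proof -
    have "(\<Sum>w\<in>UNIV. outcome_prob \<pi> S u v w) = (\<Sum>s\<in>T. c s * (\<Sum>w\<in>UNIV. strategy_prob \<pi> s u v w))"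
      unfolding out sum_distrib_left by (rule sum.swap)
    also have "\<dots> = (\<Sum>s\<in>T. c s)" using T(2) by (intro sum.cong refl) (auto simp: attacks_def)
    finally show ?thesis by (simp add: T(4))
  qed
  have "\<exists>q. \<forall>w. pmf q w = outcome_prob \<pi> S u v w" for u :: 'u and v
    using pmf_of_weights[of UNIV "outcome_prob \<pi> S u v"] out0 out1 by auto
  then obtain Q where Q: "\<And>u v w. pmf (Q u v) w = outcome_prob \<pi> S (u :: 'u) v w" by metis
  have "1 - 28 * \<epsilon> \<le> measure_pmf.prob (Q u\<^sub>0 v) {w. f u v = f u w}" for u\<^sub>0 v u
  proof -
    have "measure_pmf.prob (Q u\<^sub>0 v) {w. f u v = f u w} = (\<Sum>w\<in>{w. f u v = f u w}. outcome_prob \<pi> S u\<^sub>0 v w)"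
      by (simp add: measure_measure_pmf_finite Q)
    also have "\<dots> = (\<Sum>w\<in>UNIV. \<Sum>s\<in>T. c s * (of_bool (f u v = f u w) * strategy_prob \<pi> s u\<^sub>0 v w))"
      unfolding out by (rule sum.mono_neutral_cong_left) auto
    also have "\<dots> = (\<Sum>s\<in>T. c s * success f \<pi> s (u\<^sub>0, u, v))"
      unfolding success_def prod.case sum_distrib_left by (rule sum.swap)
    finally show ?thesis using good[of "(u\<^sub>0, u, v)"] by simp
  qed
  moreover have "cheating_strategy f \<pi> S"
    using S(1) T(1,2) finite_subset unfolding cheating_strategy_def attacks_def by fastforce
  ultimately show ?thesis using Q by blast
qed

end
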